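(* Let $\mathcal{U}$ be the upper cluster algebra of the seed with mutable variables $x_1,x_2,x_3$, frozen variables $f_1,f_2,f_3$ (cluster $(x_1,x_2,x_3,f_1,f_2,f_3)$) and exchange matrix $$B=\begin{bmatrix}0&-2&2\\2&0&-2\\-2&2&0\\1&0&0\\0&1&0\\0&0&1\end{bmatrix}.$$ Put $\alpha:=f_1f_2f_3-1$. Then $\mathcal{U}$ is generated over $\mathbb{Z}[f_1^{\pm1},f_2^{\pm1},f_3^{\pm1}]$ by $x_1,x_2,x_3$ and $$L_1=\frac{x_2^2+f_2f_3x_3^2+f_3x_1^2}{x_2x_3},\quad L_2=\frac{x_3^2+f_3f_1x_1^2+f_1x_2^2}{x_3x_1},\quad L_3=\frac{x_1^2+f_1f_2x_2^2+f_2x_3^2}{x_1x_2},$$ $$y_1=\frac{f_1L_1^2+(f_1f_2f_3-1)^2}{x_1},\quad y_2=\frac{f_2L_2^2+(f_1f_2f_3-1)^2}{x_2},\quad y_3=\frac{f_3L_3^2+(f_1f_2f_3-1)^2}{x_3}.$$ The ideal of relations among these generators is generated by the elements $$x_1x_2L_3=x_1^2+f_1f_2x_2^2+f_2x_3^2,\qquad y_1y_2L_3=f_1f_2y_1^2+y_2^2+f_1y_3^2,$$ $$x_2x_3L_1=x_2^2+f_2f_3x_3^2+f_3x_1^2,\qquad y_2y_3L_1=f_2f_3y_2^2+y_3^2+f_2y_1^2,$$ $$x_3x_1L_2=x_3^2+f_3f_1x_1^2+f_1x_2^2,\qquad y_3y_1L_2=f_3f_1y_3^2+y_1^2+f_3y_2^2,$$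 $$f_3x_1L_3-x_3L_1=\alpha x_2,\qquad f_1L_1y_3-L_3y_1=\alpha y_2,$$ $$f_1x_2L_1-x_1L_2=\alpha x_3,\qquad f_2L_2y_1-L_1y_2=\alpha y_3,$$ $$f_2x_3L_2-x_2L_3=\alpha x_1,\qquad f_3L_3y_2-L_2y_3=\alpha y_1,$$ $$x_1L_2L_3=f_1f_2x_2L_2+f_1x_1L_1+x_3L_3,\qquad y_1L_2L_3=y_2L_2+f_1y_1L_1+f_1f_3y_3L_3,$$ $$x_2L_3L_1=f_2f_3x_3L_3+f_2x_2L_2+x_1L_1,\qquad y_2L_3L_1=y_3L_3+f_2y_2L_2+f_2f_1y_1L_1,$$ $$x_3L_1L_2=f_3f_1x_1L_1+f_3x_3L_3+x_2L_2,\qquad y_3L_1L_2=y_1L_1+f_3y_3L_3+f_3f_2y_2L_2,$$ $$x_2y_3=f_2f_3L_2L_3-\alpha L_1,\quad x_3y_1=f_3f_1L_3L_1-\alpha L_2,\quad x_1y_2=f_1f_2L_1L_2-\alpha L_3,$$ $$x_1y_3=L_1L_3+f_2\alpha L_2,\quad x_2y_1=L_2L_1+f_3\alpha L_3,\quad x_3y_2=L_3L_2+f_1\alpha L_1,$$ $$x_1y_1=f_1L_1^2+\alpha^2,\quad x_2y_2=f_2L_2^2+\alpha^2,\quad x_3y_3=f_3L_3^2+\alpha^2,$$ $$L_1L_2L_3-f_1L_1^2-f_2L_2^2-f_3L_3^2=\alpha^2.$$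
   Context: A seed (with $m$ mutable and $n-m$ frozen variables) is a pair $(\mathbf{x},B)$ where $\mathbf{x}=(x_1,\dots,x_n)$ freely generates a field $\mathcal{F}$ over $\mathbb{Q}$, and $B$ is an $n\times m$ integer matrix whose top $m\times m$ submatrix is skew-symmetric; $x_1,\dots,x_m$ are mutable and $x_{m+1},\dots,x_n$ are frozen. (Here $m=3$, $n=6$, and $x_4,x_5,x_6$ are named $f_1,f_2,f_3$.) For $1\le k\le m$ the mutation at $k$ is the seed $(\mathbf{x}',B')$ with $x_i'=x_i$ for $i\neq k$, $x_k'=\left(\prod_{B_{jk}>0}x_j^{B_{jk}}+\prod_{B_{jk}<0}x_j^{-B_{jk}}\right)x_k^{-1}$, and $B'_{ij}=-B_{ij}$ if $i=k$ or $j=k$, $B'_{ij}=B_{ij}+\frac{|B_{ik}|B_{kj}+B_{ik}|B_{kj}|}{2}$ otherwise. Mutation-equivalence is generated by mutations and by permutations of the indices preserving $\{1,\dots,m\}$ (acting simultaneously on $\mathbf{x}$ and the rows and columns of $B$). The clusters are the sets $\{z_1,\dots,z_n\}$ of variables (mutable and frozen) of seeds mutation-equivalent to the initial seed. The upper cluster algebra is $\mathcal{U}=\bigcap_{\text{clusters }\{z_1,\dots,z_n\}}\mathbb{Z}[z_1^{\pm1},\dots,z_n^{\pm1}]\subset\mathcal{F}$. The ideal of relations is the kernel of the surjection onto $\mathcal{U}$ from the polynomial ring over $\mathbb{Z}[f_1^{\pm1},f_2^{\pm1},f_3^{\pm1}]$ on symbols for the listed generators; an equation $P=Q$ stands for the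 element $P-Q$. *)

theory Defs
  imports Complex_Main "HOL-Library.Poly_Mapping" "HOL-Combinatorics.Permutations"
begin

text \<open>
  The polynomial ring over a commutative ring \<open>'c\<close> with set of variables \<open>'v\<close> is represented by
  the type \<open>('v \<Rightarrow>\<^sub>0 nat) \<Rightarrow>\<^sub>0 'c\<close> of finitely supported functions from exponent vectors to
  coefficients, with convolution as multiplication.  Exponents in \<open>int\<close> instead of \<open>nat\<close> give the
  Laurent polynomial ring.
\<close>

definition poly_eval :: "('c::zero \<Rightarrow> 'a::comm_ring_1) \<Rightarrow> ('v \<Rightarrow> 'a) \<Rightarrow> (('v \<Rightarrow>\<^sub>0 nat) \<Rightarrow>\<^sub>0 'c) \<Rightarrow> 'a" where
  "poly_eval c z p =
     (\<Sum>e\<in>Poly_Mapping.keys p.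
        c (Poly_Mapping.lookup p e) *
        (\<Prod>v\<in>Poly_Mapping.keys e. z v ^ Poly_Mapping.lookup e v))"

definition laurent_eval :: "('v \<Rightarrow> 'a::field) \<Rightarrow> (('v \<Rightarrow>\<^sub>0 int) \<Rightarrow>\<^sub>0 int) \<Rightarrow> 'a" where
  "laurent_eval z p =
     (\<Sum>e\<in>Poly_Mapping.keys p.
        of_int (Poly_Mapping.lookup p e) *
        (\<Prod>v\<in>Poly_Mapping.keys e. z v powi Poly_Mapping.lookup e v))"

definition is_subring :: "'a::comm_ring_1 set \<Rightarrow> bool" where
  "is_subring S \<longleftrightarrow> 1 \<in> S \<and> (\<forall>a\<in>S. \<forall>b\<in>S. a - b \<in> S \<and> a * b \<in> S)"

definition is_subfield :: "'a::field set \<Rightarrow> bool" where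
  "is_subfield S \<longleftrightarrow> is_subring S \<and> (\<forall>a\<in>S. inverse a \<in> S)"

text \<open>The ring \<open>\<int>[z\<^sup>\<plusminus>\<^sup>1. z \<in> Z]\<close> inside a field.\<close>

definition laurent_ring :: "'a::field set \<Rightarrow> 'a set" where
  "laurent_ring Z = is_subring hull (Z \<union> inverse ` Z)"

text \<open>The ideal generated by a set: the span in the ring viewed as a module over itself.\<close>

definition ideal_generated :: "'a::comm_ring_1 set \<Rightarrow> 'a set" where
  "ideal_generated S = module.span (*) S"


subsection \<open>Seeds and mutation\<close>

text \<open>
  The ambient field is the type \<open>'a\<close>.  A seed with \<open>n\<close> variables, the first \<open>m\<close> of them mutable,
  is a pair \<open>(x, B)\<close> of functions of which only the values \<open>x i\<close> and \<open>B i j\<close> for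
  \<open>i \<in> {1..n}\<close>, \<open>j \<in> {1..m}\<close> are relevant.
\<close>

type_synonym 'a seed = "(nat \<Rightarrow> 'a) \<times> (nat \<Rightarrow> nat \<Rightarrow> int)"

definition freely_generates :: "nat \<Rightarrow> (nat \<Rightarrow> 'a::field_char_0) \<Rightarrow> bool" where
  "freely_generates n x \<longleftrightarrow>
     (\<forall>p :: (nat \<Rightarrow>\<^sub>0 nat) \<Rightarrow>\<^sub>0 rat.
        (\<forall>e\<in>Poly_Mapping.keys p. Poly_Mapping.keys e \<subseteq> {1..n}) \<longrightarrow>
        poly_eval of_rat x p = 0 \<longrightarrow> p = 0) \<and>
     is_subfield hull (x ` {1..n}) = UNIV"

definition is_seed :: "nat \<Rightarrow> nat \<Rightarrow> 'a::field_char_0 seed \<Rightarrow> bool" where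
  "is_seed n m = (\<lambda>(x, B). m \<le> n \<and> freely_generates n x \<and>
     (\<forall>i\<in>{1..m}. \<forall>j\<in>{1..m}. B i j = - B j i))"

text \<open>The division by 2 below is exact.\<close>

definition mutate :: "nat \<Rightarrow> nat \<Rightarrow> 'a::field_char_0 seed \<Rightarrow> 'a seed" where
  "mutate n k = (\<lambda>(x, B).
     (\<lambda>i. if i = k
          then ((\<Prod>j | j \<in> {1..n} \<and> B j k > 0. x j ^ nat (B j k)) +
                (\<Prod>j | j \<in> {1..n} \<and> B j k < 0. x j ^ nat (- B j k))) * inverse (x k)
          else x i,
      \<lambda>i j. if i = k \<or> j = k then - B i j
            else B i j + (\<bar>B i k\<bar> * B k j + B i k * \<bar>B k j\<bar>) div 2))"

definition permute_seed :: "(nat \<Rightarrow> nat) \<Rightarrow> 'a seed \<Rightarrow> 'a seed" where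
  "permute_seed \<sigma> = (\<lambda>(x, B). (\<lambda>i. x (\<sigma> i), \<lambda>i j. B (\<sigma> i) (\<sigma> j)))"

definition seed_step :: "nat \<Rightarrow> nat \<Rightarrow> 'a::field_char_0 seed \<Rightarrow> 'a seed \<Rightarrow> bool" where
  "seed_step n m s t \<longleftrightarrow>
     (\<exists>k\<in>{1..m}. t = mutate n k s) \<or>
     (\<exists>\<sigma>. \<sigma> permutes {1..n} \<and> \<sigma> ` {1..m} = {1..m} \<and> t = permute_seed \<sigma> s)"

definition mutation_equivalent :: "nat \<Rightarrow> nat \<Rightarrow> 'a::field_char_0 seed \<Rightarrow> 'a seed \<Rightarrow> bool" where
  "mutation_equivalent n m = equivclp (seed_step n m)"

definition clusters :: "nat \<Rightarrow> nat \<Rightarrow> 'a::field_char_0 seed \<Rightarrow> 'a set set" where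
  "clusters n m s = {fst t ` {1..n} | t. mutation_equivalent n m s t}"

definition upper_cluster_algebra :: "nat \<Rightarrow> nat \<Rightarrow> 'a::field_char_0 seed \<Rightarrow> 'a set" where
  "upper_cluster_algebra n m s = (\<Inter>Z\<in>clusters n m s. laurent_ring Z)"


subsection \<open>The seed and its presentation\<close>

definition vector_of :: "'a list \<Rightarrow> nat \<Rightarrow> 'a" where
  "vector_of xs i = xs ! (i - 1)"

definition matrix_of_rows :: "int list list \<Rightarrow> nat \<Rightarrow> nat \<Rightarrow> int" where
  "matrix_of_rows rs i j = rs ! (i - 1) ! (j - 1)"

definition exchange_matrix :: "nat \<Rightarrow> nat \<Rightarrow> int" where
  "exchange_matrix = matrix_of_rows
     [[ 0, -2,  2],
      [ 2,  0, -2],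
      [-2,  2,  0],
      [ 1,  0,  0],
      [ 0,  1,  0],
      [ 0,  0,  1]]"

datatype frozen_sym = F1 | F2 | F3

datatype gen_sym = X1 | X2 | X3 | L1 | L2 | L3 | Y1 | Y2 | Y3

type_synonym coeff_ring = "(frozen_sym \<Rightarrow>\<^sub>0 int) \<Rightarrow>\<^sub>0 int"

type_synonym gen_ring = "(gen_sym \<Rightarrow>\<^sub>0 nat) \<Rightarrow>\<^sub>0 coeff_ring"

definition frozen_var :: "frozen_sym \<Rightarrow> gen_ring" where
  "frozen_var i = Poly_Mapping.single 0 (Poly_Mapping.single (Poly_Mapping.single i 1) 1)"

definition gen_var :: "gen_sym \<Rightarrow> gen_ring" where
  "gen_var g = Poly_Mapping.single (Poly_Mapping.single g 1) 1"

definition presentation_map ::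
    "(frozen_sym \<Rightarrow> 'a::field) \<Rightarrow> (gen_sym \<Rightarrow> 'a) \<Rightarrow> gen_ring \<Rightarrow> 'a" where
  "presentation_map f g = poly_eval (laurent_eval f) g"

definition relations_in ::
    "'r::comm_ring_1 \<Rightarrow> 'r \<Rightarrow> 'r \<Rightarrow> 'r \<Rightarrow> 'r \<Rightarrow> 'r \<Rightarrow> 'r \<Rightarrow> 'r \<Rightarrow> 'r \<Rightarrow> 'r \<Rightarrow> 'r \<Rightarrow> 'r \<Rightarrow> 'r set" where
  "relations_in f1 f2 f3 x1 x2 x3 l1 l2 l3 y1 y2 y3 = (let \<alpha> = f1 * f2 * f3 - 1 in
    {x1 * x2 * l3 - (x1\<^sup>2 + f1 * f2 * x2\<^sup>2 + f2 * x3\<^sup>2),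
     y1 * y2 * l3 - (f1 * f2 * y1\<^sup>2 + y2\<^sup>2 + f1 * y3\<^sup>2),
     x2 * x3 * l1 - (x2\<^sup>2 + f2 * f3 * x3\<^sup>2 + f3 * x1\<^sup>2),
     y2 * y3 * l1 - (f2 * f3 * y2\<^sup>2 + y3\<^sup>2 + f2 * y1\<^sup>2),
     x3 * x1 * l2 - (x3\<^sup>2 + f3 * f1 * x1\<^sup>2 + f1 * x2\<^sup>2),
     y3 * y1 * l2 - (f3 * f1 * y3\<^sup>2 + y1\<^sup>2 + f3 * y2\<^sup>2),
     (f3 * x1 * l3 - x3 * l1) - \<alpha> * x2,
     (f1 * l1 * y3 - l3 * y1) - \<alpha> * y2,
     (f1 * x2 * l1 - x1 * l2) - \<alpha> * x3,
     (f2 * l2 * y1 - l1 * y2) - \<alpha> * y3,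
     (f2 * x3 * l2 - x2 * l3) - \<alpha> * x1,
     (f3 * l3 * y2 - l2 * y3) - \<alpha> * y1,
     x1 * l2 * l3 - (f1 * f2 * x2 * l2 + f1 * x1 * l1 + x3 * l3),
     y1 * l2 * l3 - (y2 * l2 + f1 * y1 * l1 + f1 * f3 * y3 * l3),
     x2 * l3 * l1 - (f2 * f3 * x3 * l3 + f2 * x2 * l2 + x1 * l1),
     y2 * l3 * l1 - (y3 * l3 + f2 * y2 * l2 + f2 * f1 * y1 * l1),
     x3 * l1 * l2 - (f3 * f1 * x1 * l1 + f3 * x3 * l3 + x2 * l2),
     y3 * l1 * l2 - (y1 * l1 + f3 * y3 * l3 + f3 * f2 * y2 * l2),
     x2 * y3 - (f2 * f3 * l2 * l3 - \<alpha> * l1),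
     x3 * y1 - (f3 * f1 * l3 * l1 - \<alpha> * l2),
     x1 * y2 - (f1 * f2 * l1 * l2 - \<alpha> * l3),
     x1 * y3 - (l1 * l3 + f2 * \<alpha> * l2),
     x2 * y1 - (l2 * l1 + f3 * \<alpha> * l3),
     x3 * y2 - (l3 * l2 + f1 * \<alpha> * l1),
     x1 * y1 - (f1 * l1\<^sup>2 + \<alpha>\<^sup>2),
     x2 * y2 - (f2 * l2\<^sup>2 + \<alpha>\<^sup>2),
     x3 * y3 - (f3 * l3\<^sup>2 + \<alpha>\<^sup>2),
     (l1 * l2 * l3 - f1 * l1\<^sup>2 - f2 * l2\<^sup>2 - f3 * l3\<^sup>2) - \<alpha>\<^sup>2})"

definition relations :: "gen_ring set" where
  "relations = relations_in (frozen_var F1) (frozen_var F2) (frozen_var F3)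
     (gen_var X1) (gen_var X2) (gen_var X3)
     (gen_var L1) (gen_var L2) (gen_var L3)
     (gen_var Y1) (gen_var Y2) (gen_var Y3)"

end

theory Submission
  imports Defs "HOL-Computational_Algebra.Polynomial"
begin

text \<open>
  Let \<open>A\<close> be the ring generated by the nine elements.  For every seed of the mutation class the
  top of the exchange matrix is again the Markov matrix up to sign, and the analogous nine elements,
  formed with the Laurent monomials in the frozen variables given by the columns of the exchange
  matrix, generate a ring containing \<open>A\<close>; hence \<open>A\<close> is contained in every cluster's Laurent ring.

  The other inclusion and the relations both come from the divisor \<open>x\<^sub>1 = 0\<close>, which in the cluster
  \<open>{x\<^sub>1', x\<^sub>2, x\<^sub>3}\<close> is the hypersurface \<open>f\<^sub>1 x\<^sub>2\<^sup>2 + x\<^sub>3\<^sup>2 = 0\<close>.  The relations allow to write every polynomial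
  in the generators as \<open>n\<^sub>0 + x\<^sub>1 n\<^sub>1 + x\<^sub>1\<^sup>2 n\<^sub>2 + \<dots>\<close>, each \<open>n\<^sub>k\<close> being a linear combination of
  certain normal monomials, and these monomials stay linearly independent over the coefficient ring
  when restricted to that hypersurface.  So an element of the kernel has \<open>n\<^sub>0 = 0\<close>, and one can divide by \<open>x\<^sub>1\<close> and repeat;
  and if \<open>x\<^sub>1 u \<in> A\<close> for some \<open>u\<close> that is a Laurent polynomial in the mutated cluster, then \<open>n\<^sub>0 = 0\<close>,
  that is, \<open>u \<in> A\<close>.  By cyclic symmetry this applies to \<open>x\<^sub>2\<close> and \<open>x\<^sub>3\<close>, and every element of the upper
  cluster algebra gets into \<open>A\<close> after multiplication with some monomial in \<open>x\<^sub>1, x\<^sub>2, x\<^sub>3\<close>.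
\<close>

subsection \<open>Evaluation of polynomials and Laurent polynomials\<close>

text \<open>A field element has no value on x1 = 0, so restriction to the divisor is done with real
  functions: \<open>rep\<close> attaches to an element a Laurent expression in a cluster and the
  function it defines at real points with nonzero coordinates, and independence of the cluster turns
  identities of the field into identities of functions. The divisor has real points once f1 < 0:
  with f1 = -t^2 it splits into x3 = t * x2 and x3 = -t * x2. On the algebraic side the listed
  relations, read as rewriting rules, are supplemented by consequences such as
  \<open>red_l3l3\<close> and \<open>red_l3y3\<close>, and the rule for l2^2 * y1 is split by
  whether y3 occurs, so that a weight decreases. The weight ignores x1, which is treated as a
  scalar; every polynomial thus gets a finite expansion in powers of x1, and repeated division ends
  by induction. In the mutation class the obstacle is walking backwards: mutation is undone by a
  second mutation only when the variable concerned is nonzero. Nonvanishing is not preserved by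
  sums, so positivity at the point (1, ..., 1) is carried along instead.\<close>

definition mp_eval ::
    "('c::zero \<Rightarrow> 'a::comm_ring_1) \<Rightarrow> ('e \<Rightarrow> 'a) \<Rightarrow> ('e \<Rightarrow>\<^sub>0 'c) \<Rightarrow> 'a" where
  "mp_eval c m p = (\<Sum>e\<in>Poly_Mapping.keys p. c (Poly_Mapping.lookup p e) * m e)"

lemma poly_mapping_eq_sum_single:
  "p = (\<Sum>k\<in>Poly_Mapping.keys p. Poly_Mapping.single k (Poly_Mapping.lookup p k))"
  by (rule poly_mapping_eqI)
     (simp add: lookup_sum lookup_single when_def in_keys_iff sum.delta)

text \<open>One homomorphism proof serves Laurent evaluation, \<open>presentation_map\<close> and
  evaluation of rational polynomials; they differ only in the coefficient map \<open>c\<close> and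
  the monomial map \<open>m\<close>.\<close>

locale mp_hom =
  fixes c :: "'c::comm_ring_1 \<Rightarrow> 'a::comm_ring_1" and m :: "'e::comm_monoid_add \<Rightarrow> 'a"
  assumes c_add: "c (a + b) = c a + c b" and c_mult: "c (a * b) = c a * c b" and c_one: "c 1 = 1"
    and m_zero: "m 0 = 1" and m_add: "m (e + e') = m e * m e'"
begin

lemma c_zero: "c 0 = 0"
  using c_add[of 0 0] by simp

lemma eval_superset:
  assumes "finite S" "Poly_Mapping.keys p \<subseteq> S"
  shows "mp_eval c m p = (\<Sum>e\<in>S. c (Poly_Mapping.lookup p e) * m e)"
  unfolding mp_eval_def
  by (rule sum.mono_neutral_left) (use assms in \<open>auto simp: in_keys_iff c_zero\<close>)

lemma eval_zero: "mp_eval c m 0 = 0"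
  by (simp add: mp_eval_def)

lemma eval_add: "mp_eval c m (p + q) = mp_eval c m p + mp_eval c m q"
proof -
  let ?S = "Poly_Mapping.keys p \<union> Poly_Mapping.keys q"
  have "Poly_Mapping.keys (p + q) \<subseteq> ?S" by (rule keys_add)
  then show ?thesis
    using eval_superset[of ?S "p + q"] eval_superset[of ?S p] eval_superset[of ?S q]
    by (simp add: lookup_add c_add distrib_right sum.distrib)
qed

lemma eval_single: "mp_eval c m (Poly_Mapping.single k a) = c a * m k"
  by (simp add: mp_eval_def c_zero)

lemma eval_sum: "mp_eval c m (\<Sum>i\<in>A. p i) = (\<Sum>i\<in>A. mp_eval c m (p i))"
  by (induction A rule: infinite_finite_induct) (simp_all add: eval_zero eval_add)

lemma eval_mult: "mp_eval c m (p * q) = mp_eval c m p * mp_eval c m q"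
proof -
  let ?s = "\<lambda>p k. Poly_Mapping.single k (Poly_Mapping.lookup p k)"
  have "p * q = (\<Sum>i\<in>Poly_Mapping.keys p. ?s p i) * (\<Sum>j\<in>Poly_Mapping.keys q. ?s q j)"
    using poly_mapping_eq_sum_single[of p] poly_mapping_eq_sum_single[of q] by simp
  also have "\<dots> = (\<Sum>i\<in>Poly_Mapping.keys p. \<Sum>j\<in>Poly_Mapping.keys q. ?s p i * ?s q j)"
    by (rule sum_product)
  finally have "mp_eval c m (p * q) = (\<Sum>i\<in>Poly_Mapping.keys p. \<Sum>j\<in>Poly_Mapping.keys q.
      (c (Poly_Mapping.lookup p i) * m i) * (c (Poly_Mapping.lookup q j) * m j))"
    by (simp add: eval_sum mult_single eval_single c_mult m_add mult_ac)
  also have "\<dots> = mp_eval c m p * mp_eval c m q"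
    unfolding mp_eval_def by (rule sum_product[symmetric])
  finally show ?thesis .
qed

lemma eval_one: "mp_eval c m 1 = 1"
  by (simp add: mp_eval_def c_one m_zero)

lemma eval_uminus: "mp_eval c m (- p) = - mp_eval c m p"
  using eval_add[of p "- p"] by (simp add: eval_zero eq_neg_iff_add_eq_0 add.commute)

lemma eval_diff: "mp_eval c m (p - q) = mp_eval c m p - mp_eval c m q"
  using eval_add[of p "- q"] by (simp add: eval_uminus)

lemma eval_power: "mp_eval c m (p ^ n) = mp_eval c m p ^ n"
  by (induction n) (simp_all add: eval_one eval_mult)

end

definition mon :: "('v \<Rightarrow> 'a::comm_ring_1) \<Rightarrow> ('v \<Rightarrow>\<^sub>0 nat) \<Rightarrow> 'a" where
  "mon z e = (\<Prod>v\<in>Poly_Mapping.keys e. z v ^ Poly_Mapping.lookup e v)"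

definition lmon :: "('v \<Rightarrow> 'a::field) \<Rightarrow> ('v \<Rightarrow>\<^sub>0 int) \<Rightarrow> 'a" where
  "lmon z e = (\<Prod>v\<in>Poly_Mapping.keys e. z v powi Poly_Mapping.lookup e v)"

lemma mon_superset:
  assumes "finite S" "Poly_Mapping.keys e \<subseteq> S"
  shows "mon z e = (\<Prod>v\<in>S. z v ^ Poly_Mapping.lookup e v)"
  unfolding mon_def
  by (rule prod.mono_neutral_left) (use assms in \<open>auto simp: in_keys_iff\<close>)

lemma lmon_superset:
  assumes "finite S" "Poly_Mapping.keys e \<subseteq> S"
  shows "lmon z e = (\<Prod>v\<in>S. z v powi Poly_Mapping.lookup e v)"
  unfolding lmon_def
  by (rule prod.mono_neutral_left) (use assms in \<open>auto simp: in_keys_iff\<close>)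

lemma mon_add: "mon z (e + e') = mon z e * mon z e'"
proof -
  let ?S = "Poly_Mapping.keys e \<union> Poly_Mapping.keys e'"
  have "Poly_Mapping.keys (e + e') \<subseteq> ?S" by (rule keys_add)
  then show ?thesis
    using mon_superset[of ?S "e + e'" z] mon_superset[of ?S e z] mon_superset[of ?S e' z]
    by (simp add: lookup_add power_add prod.distrib)
qed

lemma lmon_add:
  assumes "\<And>v. z v \<noteq> 0"
  shows "lmon z (e + e') = lmon z e * lmon z e'"
proof -
  let ?S = "Poly_Mapping.keys e \<union> Poly_Mapping.keys e'"
  have "Poly_Mapping.keys (e + e') \<subseteq> ?S" by (rule keys_add)
  then show ?thesis
    using lmon_superset[of ?S "e + e'" z] lmon_superset[of ?S e z] lmon_superset[of ?S e' z] assms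
    by (simp add: lookup_add power_int_add prod.distrib)
qed

lemma mon_zero [simp]: "mon z 0 = 1"
  by (simp add: mon_def)

lemma lmon_zero [simp]: "lmon z 0 = 1"
  by (simp add: lmon_def)

lemma lmon_single [simp]: "lmon z (Poly_Mapping.single v k) = z v powi k"
  by (simp add: lmon_def)

lemma mon_single [simp]: "mon z (Poly_Mapping.single v k) = z v ^ k"
  by (simp add: mon_def)

lemma poly_eval_eq: "poly_eval c z = mp_eval c (mon z)"
  by (rule ext) (simp add: poly_eval_def mp_eval_def mon_def)

lemma laurent_eval_eq: "laurent_eval z = mp_eval of_int (lmon z)"
  by (rule ext) (simp add: laurent_eval_def mp_eval_def lmon_def)

lemma mp_hom_laurent: "(\<And>v. z v \<noteq> 0) \<Longrightarrow> mp_hom of_int (lmon z)"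
  by unfold_locales (simp_all add: lmon_add)

lemma laurent_eval_hom:
  assumes "\<And>v. z v \<noteq> 0"
  shows "laurent_eval z (p + q) = laurent_eval z p + laurent_eval z q"
    "laurent_eval z (p - q) = laurent_eval z p - laurent_eval z q"
    "laurent_eval z (p * q) = laurent_eval z p * laurent_eval z q"
    "laurent_eval z (p ^ n) = laurent_eval z p ^ n"
    "laurent_eval z (- p) = - laurent_eval z p"
    "laurent_eval z 1 = 1" "laurent_eval z 0 = 0"
    "laurent_eval z (Poly_Mapping.single e a) = of_int a * lmon z e"
    "laurent_eval z (\<Sum>i\<in>A. r i) = (\<Sum>i\<in>A. laurent_eval z (r i))"
proof -
  interpret mp_hom of_int "lmon z" using assms by (rule mp_hom_laurent)
  show "laurent_eval z (p + q) = laurent_eval z p + laurent_eval z q"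
    "laurent_eval z (p - q) = laurent_eval z p - laurent_eval z q"
    "laurent_eval z (p * q) = laurent_eval z p * laurent_eval z q"
    "laurent_eval z (p ^ n) = laurent_eval z p ^ n"
    "laurent_eval z (- p) = - laurent_eval z p"
    "laurent_eval z 1 = 1" "laurent_eval z 0 = 0"
    "laurent_eval z (Poly_Mapping.single e a) = of_int a * lmon z e"
    "laurent_eval z (\<Sum>i\<in>A. r i) = (\<Sum>i\<in>A. laurent_eval z (r i))"
    by (simp_all add: laurent_eval_eq eval_add eval_diff eval_mult eval_power eval_uminus eval_one
        eval_zero eval_single eval_sum)
qed

lemma presentation_map_hom:
  assumes "\<And>v. z v \<noteq> 0"
  shows "presentation_map z g (p + q) = presentation_map z g p + presentation_map z g q"
    "presentation_map z g (p - q) = presentation_map z g p - presentation_map z g q"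
    "presentation_map z g (p * q) = presentation_map z g p * presentation_map z g q"
    "presentation_map z g (p ^ n) = presentation_map z g p ^ n"
    "presentation_map z g (- p) = - presentation_map z g p"
    "presentation_map z g 1 = 1" "presentation_map z g 0 = 0"
    "presentation_map z g (Poly_Mapping.single e a) = laurent_eval z a * mon g e"
    "presentation_map z g (\<Sum>i\<in>A. r i) = (\<Sum>i\<in>A. presentation_map z g (r i))"
proof -
  interpret mp_hom "laurent_eval z" "mon g"
    using assms by unfold_locales (simp_all add: laurent_eval_hom mon_add)
  show "presentation_map z g (p + q) = presentation_map z g p + presentation_map z g q"
    "presentation_map z g (p - q) = presentation_map z g p - presentation_map z g q"
    "presentation_map z g (p * q) = presentation_map z g p * presentation_map z g q"
    "presentation_map z g (p ^ n) = presentation_map z g p ^ n"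
    "presentation_map z g (- p) = - presentation_map z g p"
    "presentation_map z g 1 = 1" "presentation_map z g 0 = 0"
    "presentation_map z g (Poly_Mapping.single e a) = laurent_eval z a * mon g e"
    "presentation_map z g (\<Sum>i\<in>A. r i) = (\<Sum>i\<in>A. presentation_map z g (r i))"
    by (simp_all add: presentation_map_def poly_eval_eq eval_add eval_diff eval_mult eval_power
        eval_uminus eval_one eval_zero eval_single eval_sum)
qed

lemma presentation_map_vars:
  assumes "\<And>v. z v \<noteq> 0"
  shows "presentation_map z g (frozen_var i) = z i" "presentation_map z g (gen_var j) = g j"
  using assms by (simp_all add: frozen_var_def gen_var_def presentation_map_hom laurent_eval_hom)

section \<open>Vanishing of Laurent polynomials on products of infinite sets\<close>

lemma powi_sum_zero_imp:
  fixes a :: "int \<Rightarrow> real"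
  assumes "finite K" "infinite T" "0 \<notin> T"
    and zero: "\<And>z. z \<in> T \<Longrightarrow> (\<Sum>k\<in>K. a k * z powi k) = 0" and "k \<in> K"
  shows "a k = 0"
proof -
  \<comment> \<open>Multiplying by z^N clears the negative exponents, which leaves a polynomial with
    infinitely many roots.\<close>
  obtain N :: nat where N: "\<And>k. k \<in> K \<Longrightarrow> 0 \<le> k + int N"
  proof -
    have "0 \<le> k + int (nat (\<Sum>j\<in>K. \<bar>j\<bar>))" if "k \<in> K" for k
      using member_le_sum[of k K abs] that \<open>finite K\<close> by simp
    then show ?thesis by (rule that)
  qed
  define p where "p = (\<Sum>k\<in>K. monom (a k) (nat (k + int N)))"
  have "poly p z = 0" if "z \<in> T" for z
  proof -
    have "z \<noteq> 0" using that \<open>0 \<notin> T\<close> by auto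
    then have "z powi k * z ^ N = z ^ nat (k + int N)" if "k \<in> K" for k
      using N[OF that] by (simp add: power_int_add flip: power_int_of_nat)
    then have "poly p z = (\<Sum>k\<in>K. a k * z powi k) * z ^ N"
      by (simp add: p_def poly_sum poly_monom sum_distrib_right mult.assoc)
    then show ?thesis using zero[OF that] by simp
  qed
  then have "T \<subseteq> {z. poly p z = 0}" by auto
  then have "p = 0" using poly_roots_finite[of p] \<open>infinite T\<close> finite_subset by blast
  then have "coeff p (nat (k + int N)) = 0" by simp
  moreover have "coeff p (nat (k + int N)) = (\<Sum>j\<in>K. if j = k then a j else 0)"
    unfolding p_def coeff_sum coeff_monom
    by (rule sum.cong) (use N \<open>k \<in> K\<close> in \<open>auto simp: nat_eq_iff2\<close>)
  ultimately show ?thesis using \<open>finite K\<close> \<open>k \<in> K\<close> by (simp add: sum.delta)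
qed

text \<open>With the other coordinates fixed, the terms are grouped by their exponent of one
  variable; each group vanishes by the case of one variable and is a sum of the same kind over fewer
  variables. Exponents are plain functions compared only on V, so that the induction can drop a
  coordinate.\<close>

lemma lsum_zero_imp:
  fixes c :: "('v \<Rightarrow> int) \<Rightarrow> real"
  assumes "finite V" "finite E" and inj: "inj_on (\<lambda>e. restrict e V) E"
    and T: "\<And>v. v \<in> V \<Longrightarrow> infinite (T v)"
        "\<And>v. v \<in> V \<Longrightarrow> 0 \<notin> T v"
    and zero: "\<And>z. (\<And>v. v \<in> V \<Longrightarrow> z v \<in> T v)
        \<Longrightarrow> (\<Sum>e\<in>E. c e * (\<Prod>v\<in>V. z v powi e v)) = 0"
    and "e \<in> E"
  shows "c e = 0"
  using assms
proof (induction V arbitrary: E e rule: finite_induct)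
  case empty
  then have "E = {e}"
    by (auto simp: inj_on_def)
  then show ?case using empty.prems(5)[of undefined] by simp
next
  case (insert v V)
  let ?K = "(\<lambda>e. e v) ` E"
  define A where "A k = {e \<in> E. e v = k}" for k
  have A0: "(\<Sum>e\<in>A k. c e * (\<Prod>v\<in>V. z v powi e v)) = 0"
    if z: "\<And>u. u \<in> V \<Longrightarrow> z u \<in> T u" for k z
  proof (cases "k \<in> ?K")
    case True
    show ?thesis
    proof (rule powi_sum_zero_imp[OF _ _ _ _ True])
      show "finite ?K" using insert.prems by simp
      show "infinite (T v)" "0 \<notin> T v" using insert.prems by auto
      fix w assume w: "w \<in> T v"
      let ?z = "z(v := w)"
      have "?z u \<in> T u" if "u \<in> insert v V" for u using that z w by auto
      then have "0 = (\<Sum>e\<in>E. c e * (\<Prod>u\<in>insert v V. ?z u powi e u))"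
        by (rule insert.prems(5)[of ?z, symmetric])
      also have "\<dots> = (\<Sum>e\<in>E. (c e * (\<Prod>u\<in>V. z u powi e u)) * w powi e v)"
      proof (rule sum.cong[OF refl])
        fix e
        have "(\<Prod>u\<in>V. ?z u powi e u) = (\<Prod>u\<in>V. z u powi e u)"
          by (rule prod.cong) (use insert.hyps in auto)
        then show "c e * (\<Prod>u\<in>insert v V. ?z u powi e u)
            = (c e * (\<Prod>u\<in>V. z u powi e u)) * w powi e v"
          using insert.hyps by (simp add: mult_ac)
      qed
      also have "\<dots> = (\<Sum>k\<in>?K. \<Sum>e\<in>A k. (c e * (\<Prod>u\<in>V. z u powi e u))
          * w powi e v)"
        unfolding A_def by (rule sum.image_gen) (use insert.prems in simp)
      also have "\<dots> = (\<Sum>k\<in>?K. (\<Sum>e\<in>A k. c e * (\<Prod>u\<in>V. z u powi e u))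
          * w powi k)"
        by (simp add: A_def sum_distrib_right)
      finally show "(\<Sum>k\<in>?K. (\<Sum>e\<in>A k. c e * (\<Prod>u\<in>V. z u powi e u))
          * w powi k) = 0" by simp
    qed
  next
    case False
    then have "A k = {}" by (auto simp: A_def)
    then show ?thesis by simp
  qed
  show ?case
  proof (rule insert.IH[of "A (e v)"])
    show "finite (A (e v))" using insert.prems by (simp add: A_def)
    show "inj_on (\<lambda>e. restrict e V) (A (e v))"
    proof (rule inj_onI)
      fix a b assume ab: "a \<in> A (e v)" "b \<in> A (e v)" and "restrict a V = restrict b V"
      then have "a u = b u" if "u \<in> V" for u using that by (metis restrict_apply')
      then have "restrict a (insert v V) = restrict b (insert v V)"
        using ab by (auto simp: A_def restrict_def fun_eq_iff)
      then show "a = b" by (rule inj_onD[OF insert.prems(2)]) (use ab in \<open>auto simp: A_def\<close>)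
    qed
    show "e \<in> A (e v)" using insert.prems by (simp add: A_def)
  qed (use insert.prems A0 in auto)
qed

text \<open>Each variable has its own set because f1 will range over negative numbers while f2 and
  f3 stay positive.\<close>

lemma laurent_poly_zeroI:
  fixes P :: "('v::finite \<Rightarrow>\<^sub>0 int) \<Rightarrow>\<^sub>0 int" and T ::
      "'v \<Rightarrow> real set"
  assumes T: "\<And>v. infinite (T v)" "\<And>v. 0 \<notin> T v"
    and zero: "\<And>z. (\<And>v. z v \<in> T v) \<Longrightarrow> laurent_eval z P = 0"
  shows "P = 0"
proof (rule poly_mapping_eqI)
  fix e
  let ?E = "Poly_Mapping.lookup ` Poly_Mapping.keys P"
  let ?c = "\<lambda>d. real_of_int (Poly_Mapping.lookup P (Abs_poly_mapping d))"
  have AL: "Abs_poly_mapping (Poly_Mapping.lookup d) = d" for d :: "'v \<Rightarrow>\<^sub>0 int"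
    by (rule poly_mapping.lookup_inverse)
  have "?c (Poly_Mapping.lookup e) = 0" if "e \<in> Poly_Mapping.keys P"
  proof (rule lsum_zero_imp[of UNIV ?E T ?c])
    show "inj_on (\<lambda>e. restrict e UNIV) ?E" by (simp add: restrict_def inj_on_def)
    fix z assume z: "\<And>v. v \<in> UNIV \<Longrightarrow> z v \<in> T v"
    have "(\<Sum>d\<in>?E. ?c d * (\<Prod>v\<in>UNIV. z v powi d v))
        = (\<Sum>d\<in>Poly_Mapping.keys P. real_of_int (Poly_Mapping.lookup P d) * lmon z d)"
      by (subst sum.reindex)
        (auto intro!: inj_onI poly_mapping_eqI sum.cong simp: AL lmon_superset[of UNIV])
    also have "\<dots> = laurent_eval z P" by (simp add: laurent_eval_eq mp_eval_def)
    finally show "(\<Sum>d\<in>?E. ?c d * (\<Prod>v\<in>UNIV. z v powi d v)) = 0"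
      using zero z by simp
  qed (use T that in auto)
  then show "Poly_Mapping.lookup P e = Poly_Mapping.lookup 0 e"
    by (cases "e \<in> Poly_Mapping.keys P") (auto simp: AL in_keys_iff)
qed

subsection \<open>Reduction modulo the relations\<close>

locale markov_ideal =
  fixes I :: "'r::comm_ring_1 set" and f1 f2 f3 g1 g2 g3 x1 x2 x3 l1 l2 l3 y1 y2 y3 :: 'r
  assumes I_add: "p \<in> I \<Longrightarrow> q \<in> I \<Longrightarrow> p + q \<in> I"
    and I_mult: "p \<in> I \<Longrightarrow> r * p \<in> I"
    and units: "f1 * g1 = 1" "f2 * g2 = 1" "f3 * g3 = 1"
    and relations_in: "relations_in f1 f2 f3 x1 x2 x3 l1 l2 l3 y1 y2 y3 \<subseteq> I"
begin

definition \<alpha> :: 'r where "\<alpha> = f1 * f2 * f3 - 1"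

lemma rels:
  shows "x1 * x2 * l3 - (x1^2 + f1 * f2 * x2^2 + f2 * x3^2) \<in> I"
    "y1 * y2 * l3 - (f1 * f2 * y1^2 + y2^2 + f1 * y3^2) \<in> I"
    "x3 * x1 * l2 - (x3^2 + f3 * f1 * x1^2 + f1 * x2^2) \<in> I"
    "y3 * y1 * l2 - (f3 * f1 * y3^2 + y1^2 + f3 * y2^2) \<in> I"
    "(f3 * x1 * l3 - x3 * l1) - \<alpha> * x2 \<in> I"
    "(f1 * l1 * y3 - l3 * y1) - \<alpha> * y2 \<in> I"
    "(f1 * x2 * l1 - x1 * l2) - \<alpha> * x3 \<in> I"
    "(f2 * l2 * y1 - l1 * y2) - \<alpha> * y3 \<in> I"
    "(f2 * x3 * l2 - x2 * l3) - \<alpha> * x1 \<in> I"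
    "(f3 * l3 * y2 - l2 * y3) - \<alpha> * y1 \<in> I"
    "x1 * l2 * l3 - (f1 * f2 * x2 * l2 + f1 * x1 * l1 + x3 * l3) \<in> I"
    "y1 * l2 * l3 - (y2 * l2 + f1 * y1 * l1 + f1 * f3 * y3 * l3) \<in> I"
    "x2 * y3 - (f2 * f3 * l2 * l3 - \<alpha> * l1) \<in> I"
    "x3 * y1 - (f3 * f1 * l3 * l1 - \<alpha> * l2) \<in> I"
    "x1 * y2 - (f1 * f2 * l1 * l2 - \<alpha> * l3) \<in> I"
    "x1 * y3 - (l1 * l3 + f2 * \<alpha> * l2) \<in> I"
    "x2 * y1 - (l2 * l1 + f3 * \<alpha> * l3) \<in> I"
    "x3 * y2 - (l3 * l2 + f1 * \<alpha> * l1) \<in> I"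
    "x1 * y1 - (f1 * l1^2 + \<alpha>^2) \<in> I"
    "x2 * y2 - (f2 * l2^2 + \<alpha>^2) \<in> I"
    "x3 * y3 - (f3 * l3^2 + \<alpha>^2) \<in> I"
    "(l1 * l2 * l3 - f1 * l1^2 - f2 * l2^2 - f3 * l3^2) - \<alpha>^2 \<in> I"
  using relations_in unfolding relations_in_def Let_def \<alpha>_def by simp_all

lemma red_x2y3: "x2 * y3 - ((f2 * f3) * (l2 * l3) + (- \<alpha>) * l1) \<in> I"
proof -
  have "x2 * y3 - ((f2 * f3) * (l2 * l3) + (- \<alpha>) * l1)
      = (x2 * y3 - (f2 * f3 * l2 * l3 - \<alpha> * l1))"
    by (simp add: \<alpha>_def algebra_simps power2_eq_square)
  then show ?thesis by (rule ssubst[of _ _ "\<lambda>t. t \<in> I"]) (intro I_add I_mult rels)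
qed

lemma red_x3y1: "x3 * y1 - ((f3 * f1) * (l3 * l1) + (- \<alpha>) * l2) \<in> I"
proof -
  have "x3 * y1 - ((f3 * f1) * (l3 * l1) + (- \<alpha>) * l2)
      = (x3 * y1 - (f3 * f1 * l3 * l1 - \<alpha> * l2))"
    by (simp add: \<alpha>_def algebra_simps power2_eq_square)
  then show ?thesis by (rule ssubst[of _ _ "\<lambda>t. t \<in> I"]) (intro I_add I_mult rels)
qed

lemma red_x2y1: "x2 * y1 - (l2 * l1 + (f3 * \<alpha>) * l3) \<in> I"
proof -
  have "x2 * y1 - (l2 * l1 + (f3 * \<alpha>) * l3)
      = (x2 * y1 - (l2 * l1 + f3 * \<alpha> * l3))"
    by (simp add: \<alpha>_def algebra_simps power2_eq_square)
  then show ?thesis by (rule ssubst[of _ _ "\<lambda>t. t \<in> I"]) (intro I_add I_mult rels)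
qed

lemma red_x3y2: "x3 * y2 - (l3 * l2 + (f1 * \<alpha>) * l1) \<in> I"
proof -
  have "x3 * y2 - (l3 * l2 + (f1 * \<alpha>) * l1)
      = (x3 * y2 - (l3 * l2 + f1 * \<alpha> * l1))"
    by (simp add: \<alpha>_def algebra_simps power2_eq_square)
  then show ?thesis by (rule ssubst[of _ _ "\<lambda>t. t \<in> I"]) (intro I_add I_mult rels)
qed

lemma red_x2y2: "x2 * y2 - (f2 * (l2 * l2) + \<alpha>^2) \<in> I"
proof -
  have "x2 * y2 - (f2 * (l2 * l2) + \<alpha>^2)
      = (x2 * y2 - (f2 * l2^2 + \<alpha>^2))"
    by (simp add: \<alpha>_def algebra_simps power2_eq_square)
  then show ?thesis by (rule ssubst[of _ _ "\<lambda>t. t \<in> I"]) (intro I_add I_mult rels)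
qed

lemma red_x3y3: "x3 * y3 - (f3 * (l3 * l3) + \<alpha>^2) \<in> I"
proof -
  have "x3 * y3 - (f3 * (l3 * l3) + \<alpha>^2)
      = (x3 * y3 - (f3 * l3^2 + \<alpha>^2))"
    by (simp add: \<alpha>_def algebra_simps power2_eq_square)
  then show ?thesis by (rule ssubst[of _ _ "\<lambda>t. t \<in> I"]) (intro I_add I_mult rels)
qed

lemma red_x3x3: "x3 * x3 - (x1 * (x3 * l2) + (- (f3 * f1 * x1^2)) + (- f1) * (x2 * x2)) \<in> I"
proof -
  have "x3 * x3 - (x1 * (x3 * l2) + (- (f3 * f1 * x1^2)) + (- f1) * (x2 * x2))
      = (- 1) * (x3 * x1 * l2 - (x3^2 + f3 * f1 * x1^2 + f1 * x2^2))"
    by (simp add: \<alpha>_def algebra_simps power2_eq_square)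
  then show ?thesis by (rule ssubst[of _ _ "\<lambda>t. t \<in> I"]) (intro I_add I_mult rels)
qed

lemma red_x3l1: "x3 * l1 - ((f3 * x1) * l3 + (- \<alpha>) * x2) \<in> I"
proof -
  have "x3 * l1 - ((f3 * x1) * l3 + (- \<alpha>) * x2)
      = (- 1) * ((f3 * x1 * l3 - x3 * l1) - \<alpha> * x2)"
    by (simp add: \<alpha>_def algebra_simps power2_eq_square)
  then show ?thesis by (rule ssubst[of _ _ "\<lambda>t. t \<in> I"]) (intro I_add I_mult rels)
qed

lemma red_x2l1: "x2 * l1 - ((g1 * x1) * l2 + (g1 * \<alpha>) * x3) \<in> I"
proof -
  have "(f1) * (g1) = (f1 * g1)" by (simp add: algebra_simps power2_eq_square)
  then have u: "(f1) * (g1) = 1" using units by simp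
  have "x2 * l1 - ((g1 * x1) * l2 + (g1 * \<alpha>) * x3)
      = ((f1) * (g1)) * (x2 * l1) - ((g1 * x1) * l2 + (g1 * \<alpha>) * x3)" unfolding u by simp
  also have "\<dots> = g1 * ((f1 * x2 * l1 - x1 * l2) - \<alpha> * x3)"
    by (simp add: \<alpha>_def algebra_simps power2_eq_square)
  finally show ?thesis by (rule ssubst[of _ _ "\<lambda>t. t \<in> I"]) (intro I_add I_mult rels)
qed

lemma red_x2l3: "x2 * l3 - (f2 * (x3 * l2) + (- (\<alpha> * x1))) \<in> I"
proof -
  have "x2 * l3 - (f2 * (x3 * l2) + (- (\<alpha> * x1)))
      = (- 1) * ((f2 * x3 * l2 - x2 * l3) - \<alpha> * x1)"
    by (simp add: \<alpha>_def algebra_simps power2_eq_square)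
  then show ?thesis by (rule ssubst[of _ _ "\<lambda>t. t \<in> I"]) (intro I_add I_mult rels)
qed

lemma red_x3l3: "x3 * l3 - (x1 * (l2 * l3) + (- (f1 * f2)) * (x2 * l2) + (- (f1 * x1)) * l1) \<in> I"
proof -
  have "x3 * l3 - (x1 * (l2 * l3) + (- (f1 * f2)) * (x2 * l2) + (- (f1 * x1)) * l1)
      = (- 1) * (x1 * l2 * l3 - (f1 * f2 * x2 * l2 + f1 * x1 * l1 + x3 * l3))"
    by (simp add: \<alpha>_def algebra_simps power2_eq_square)
  then show ?thesis by (rule ssubst[of _ _ "\<lambda>t. t \<in> I"]) (intro I_add I_mult rels)
qed

lemma red_l1l1: "l1 * l1 - ((g1 * x1) * y1 + (- (g1 * \<alpha>^2))) \<in> I"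
proof -
  have "(f1) * (g1) = (f1 * g1)" by (simp add: algebra_simps power2_eq_square)
  then have u: "(f1) * (g1) = 1" using units by simp
  have "l1 * l1 - ((g1 * x1) * y1 + (- (g1 * \<alpha>^2)))
      = ((f1) * (g1)) * (l1 * l1) - ((g1 * x1) * y1 + (- (g1 * \<alpha>^2)))" unfolding u by simp
  also have "\<dots> = (- g1) * (x1 * y1 - (f1 * l1^2 + \<alpha>^2))"
    by (simp add: \<alpha>_def algebra_simps power2_eq_square)
  finally show ?thesis by (rule ssubst[of _ _ "\<lambda>t. t \<in> I"]) (intro I_add I_mult rels)
qed

lemma red_l1l2: "l1 * l2 - ((g1 * g2 * x1) * y2 + (g1 * g2 * \<alpha>) * l3) \<in> I"
proof -
  have "(f1 * f2) * (g1 * g2) = (f1 * g1) * (f2 * g2)" by (simp add: algebra_simps power2_eq_square)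
  then have u: "(f1 * f2) * (g1 * g2) = 1" using units by simp
  have "l1 * l2 - ((g1 * g2 * x1) * y2 + (g1 * g2 * \<alpha>) * l3)
      = ((f1 * f2) * (g1 * g2)) * (l1 * l2) - ((g1 * g2 * x1) * y2
          + (g1 * g2 * \<alpha>) * l3)" unfolding u by simp
  also have "\<dots> = (- (g1 * g2)) * (x1 * y2 - (f1 * f2 * l1 * l2 - \<alpha> * l3))"
    by (simp add: \<alpha>_def algebra_simps power2_eq_square)
  finally show ?thesis by (rule ssubst[of _ _ "\<lambda>t. t \<in> I"]) (intro I_add I_mult rels)
qed

lemma red_l1l3: "l1 * l3 - (x1 * y3 + (- (f2 * \<alpha>)) * l2) \<in> I"
proof -
  have "l1 * l3 - (x1 * y3 + (- (f2 * \<alpha>)) * l2)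
      = (- 1) * (x1 * y3 - (l1 * l3 + f2 * \<alpha> * l2))"
    by (simp add: \<alpha>_def algebra_simps power2_eq_square)
  then show ?thesis by (rule ssubst[of _ _ "\<lambda>t. t \<in> I"]) (intro I_add I_mult rels)
qed

text \<open>Eliminating l1 * l2 * l3 between the cubic relation and l3 times the one for x1 * y2,
  and l1^2 by the one for x1 * y1, leaves l3^2 with coefficient f1 * f2 * f3 - \<alpha> = 1.\<close>

lemma red_l3l3: "l3 * l3 - (x1 * (y2 * l3) + (- (f1 * f2 * x1)) * y1 + (- (f1 * f2^2)) * (l2 * l2)) \<in> I"
proof -
  have "l3 * l3 - (x1 * (y2 * l3) + (- (f1 * f2 * x1)) * y1 + (- (f1 * f2^2)) * (l2 * l2))
      = (- (f1 * f2)) * ((l1 * l2 * l3 - f1 * l1^2 - f2 * l2^2 - f3 * l3^2) - \<alpha>^2)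
      + (- l3) * (x1 * y2 - (f1 * f2 * l1 * l2 - \<alpha> * l3))
      + (f1 * f2) * (x1 * y1 - (f1 * l1^2 + \<alpha>^2))"
    by (simp add: \<alpha>_def algebra_simps power2_eq_square)
  then show ?thesis by (rule ssubst[of _ _ "\<lambda>t. t \<in> I"]) (intro I_add I_mult rels)
qed

lemma red_l1y2: "l1 * y2 - (f2 * (l2 * y1) + (- \<alpha>) * y3) \<in> I"
proof -
  have "l1 * y2 - (f2 * (l2 * y1) + (- \<alpha>) * y3)
      = (- 1) * ((f2 * l2 * y1 - l1 * y2) - \<alpha> * y3)"
    by (simp add: \<alpha>_def algebra_simps power2_eq_square)
  then show ?thesis by (rule ssubst[of _ _ "\<lambda>t. t \<in> I"]) (intro I_add I_mult rels)
qed

lemma red_l1y3: "l1 * y3 - (g1 * (l3 * y1) + (g1 * \<alpha>) * y2) \<in> I"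
proof -
  have "(f1) * (g1) = (f1 * g1)" by (simp add: algebra_simps power2_eq_square)
  then have u: "(f1) * (g1) = 1" using units by simp
  have "l1 * y3 - (g1 * (l3 * y1) + (g1 * \<alpha>) * y2)
      = ((f1) * (g1)) * (l1 * y3) - (g1 * (l3 * y1) + (g1 * \<alpha>) * y2)" unfolding u by simp
  also have "\<dots> = g1 * ((f1 * l1 * y3 - l3 * y1) - \<alpha> * y2)"
    by (simp add: \<alpha>_def algebra_simps power2_eq_square)
  finally show ?thesis by (rule ssubst[of _ _ "\<lambda>t. t \<in> I"]) (intro I_add I_mult rels)
qed

lemma red_l3y2: "l3 * y2 - (g3 * (l2 * y3) + (g3 * \<alpha>) * y1) \<in> I"
proof -
  have "f3 * g3 = f3 * g3" by simp
  then have u: "(f3) * (g3) = 1" using units by simp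
  have "l3 * y2 - (g3 * (l2 * y3) + (g3 * \<alpha>) * y1)
      = ((f3) * (g3)) * (l3 * y2) - (g3 * (l2 * y3) + (g3 * \<alpha>) * y1)" unfolding u by simp
  also have "\<dots> = g3 * ((f3 * l3 * y2 - l2 * y3) - \<alpha> * y1)"
    by (simp add: \<alpha>_def algebra_simps power2_eq_square)
  finally show ?thesis by (rule ssubst[of _ _ "\<lambda>t. t \<in> I"]) (intro I_add I_mult rels)
qed

text \<open>Expand x1 * y2 * y3 by the relation for x1 * y2, then rewrite l1 * y3 and y1 * l2 * l3;
  the coefficients of l3 * y3 again add up to f1 * f2 * f3 - \<alpha> = 1.\<close>

lemma red_l3y3: "l3 * y3 - ((- (f1 * f2^2 * f3)) * (l2 * y2) + (- (f1 * f2)) * (l1 * y1)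
    + x1 * (y2 * y3)) \<in> I"
proof -
  have "l3 * y3 - ((- (f1 * f2^2 * f3)) * (l2 * y2) + (- (f1 * f2)) * (l1 * y1) + x1 * (y2 * y3))
      = (- y3) * (x1 * y2 - (f1 * f2 * l1 * l2 - \<alpha> * l3))
      + (- (f2 * l2)) * ((f1 * l1 * y3 - l3 * y1) - \<alpha> * y2)
      + (- f2) * (y1 * l2 * l3 - (y2 * l2 + f1 * y1 * l1 + f1 * f3 * y3 * l3))"
    by (simp add: \<alpha>_def algebra_simps power2_eq_square)
  then show ?thesis by (rule ssubst[of _ _ "\<lambda>t. t \<in> I"]) (intro I_add I_mult rels)
qed

text \<open>In the relation for y1 * l2 * l3 the term y3 * l3 has the same linear part of
  \<open>weight\<close> as the left side, so it is replaced at once by means of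
  \<open>red_l3y3\<close>.\<close>

lemma red_l2l3y1: "l2 * l3 * y1 - ((1 - f1 * f3 * (f1 * f2^2 * f3)) * (l2 * y2)
    + (f1 - f1 * f3 * (f1 * f2)) * (l1 * y1) + (f1 * f3 * x1) * (y2 * y3)) \<in> I"
proof -
  have "l2 * l3 * y1 - ((1 - f1 * f3 * (f1 * f2^2 * f3)) * (l2 * y2)
      + (f1 - f1 * f3 * (f1 * f2)) * (l1 * y1) + (f1 * f3 * x1) * (y2 * y3))
      = (y1 * l2 * l3 - (y2 * l2 + f1 * y1 * l1 + f1 * f3 * y3 * l3))
      + (f1 * f3) * (l3 * y3 - ((- (f1 * f2^2 * f3)) * (l2 * y2) + (- (f1 * f2)) * (l1 * y1)
          + x1 * (y2 * y3)))"
    by (simp add: \<alpha>_def algebra_simps power2_eq_square)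
  then show ?thesis by (rule ssubst[of _ _ "\<lambda>t. t \<in> I"]) (intro I_add I_mult rels red_l3y3)
qed

text \<open>In the presence of y3, \<open>red_l2l2y1\<close> would trade y3 for y3^2 at equal linear
  part of \<open>weight\<close> and raise its last summand. Here instead l2 times the relation for
  y3 * y1 * l2 is used, and its term l2 * y3^2 is reduced further.\<close>

lemma red_l2l2y1y3: "l2 * l2 * y1 * y3 - ((f3 - f1 * f3 * (f1 * f2^2 * f3^2)) * (l2 * y2 * y2)
    + (1 - f1 * f3 * (f1 * f2^2 * f3)) * (l2 * y1 * y1) + (f1 * f3 * \<alpha>^2) * (y1 * y3)
    + (f1 * f3 * (f3 * x1)) * (y2 * y2 * y3)) \<in> I"
proof -
  have "l2 * l2 * y1 * y3 - ((f3 - f1 * f3 * (f1 * f2^2 * f3^2)) * (l2 * y2 * y2)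
      + (1 - f1 * f3 * (f1 * f2^2 * f3)) * (l2 * y1 * y1) + (f1 * f3 * \<alpha>^2) * (y1 * y3)
      + (f1 * f3 * (f3 * x1)) * (y2 * y2 * y3))
      = l2 * (y3 * y1 * l2 - (f3 * f1 * y3^2 + y1^2 + f3 * y2^2))
      + (- (f1 * f3 * y3)) * ((f3 * l3 * y2 - l2 * y3) - \<alpha> * y1)
      + (f1 * f3 * (f3 * y2)) * (l3 * y3 - ((- (f1 * f2^2 * f3)) * (l2 * y2)
          + (- (f1 * f2)) * (l1 * y1) + x1 * (y2 * y3)))
      + (f1 * f3 * (f1 * f2 * f3 * y1)) * ((f2 * l2 * y1 - l1 * y2) - \<alpha> * y3)"
    by (simp add: \<alpha>_def algebra_simps power2_eq_square)
  then show ?thesis by (rule ssubst[of _ _ "\<lambda>t. t \<in> I"]) (intro I_add I_mult rels red_l3y3)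
qed

text \<open>The product x1 * y3^2 arises in two ways, by rewriting x1 * y3 and l1 * y3, and as a
  term of x1 * y1 * y2 * l3; it cancels in the comparison. The coefficient of l2 * y3 is \<alpha> +
  f1 * f2 * f3 * \<alpha> = \<alpha> * (\<alpha> + 2), up to the unit that is divided out.\<close>

lemma red_l2l2y1: "l2 * l2 * y1 - ((g1 * g2^2 * g3 * f3 * x1) * (y2 * y2)
    + (g1 * g2^2 * g3 * (\<alpha> * (\<alpha> + 2))) * (l2 * y3)
    + (g1 * g2^2 * g3 * \<alpha>^2) * y1) \<in> I"
proof -
  have "(f1 * f2^2 * f3) * (g1 * g2^2 * g3) = (f1 * g1) * (f2 * g2) * (f2 * g2) * (f3 * g3)"
      by (simp add: algebra_simps power2_eq_square)
  then have u: "(f1 * f2^2 * f3) * (g1 * g2^2 * g3) = 1" using units by simp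
  have "l2 * l2 * y1 - ((g1 * g2^2 * g3 * f3 * x1) * (y2 * y2)
      + (g1 * g2^2 * g3 * (\<alpha> * (\<alpha> + 2))) * (l2 * y3) + (g1 * g2^2 * g3 * \<alpha>^2) * y1)
      = ((f1 * f2^2 * f3) * (g1 * g2^2 * g3)) * (l2 * l2 * y1)
          - ((g1 * g2^2 * g3 * f3 * x1) * (y2 * y2) + (g1 * g2^2 * g3 * (\<alpha> * (\<alpha>
          + 2))) * (l2 * y3) + (g1 * g2^2 * g3 * \<alpha>^2) * y1)" unfolding u by simp
  also have "\<dots> = (g1 * g2^2 * g3 * (f3 * f1 * y3)) * (x1 * y3 - (l1 * l3 + f2 * \<alpha> * l2))
      + (g1 * g2^2 * g3 * (f3 * l3)) * ((f1 * l1 * y3 - l3 * y1) - \<alpha> * y2)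
      + (g1 * g2^2 * g3 * (f3 * y1)) * (l3 * l3 - (x1 * (y2 * l3) + (- (f1 * f2 * x1)) * y1
          + (- (f1 * f2^2)) * (l2 * l2)))
      + (g1 * g2^2 * g3 * (f3 * x1)) * (y1 * y2 * l3 - (f1 * f2 * y1^2 + y2^2 + f1 * y3^2))
      + (g1 * g2^2 * g3 * \<alpha>) * ((f3 * l3 * y2 - l2 * y3) - \<alpha> * y1)"
    by (simp add: \<alpha>_def algebra_simps power2_eq_square)
  finally show ?thesis by (rule ssubst[of _ _ "\<lambda>t. t \<in> I"]) (intro I_add I_mult rels red_l3l3)
qed

lemma red_y3y3: "y3 * y3 - ((g1 * g3) * (y3 * y1 * l2) + (- (g1 * g3)) * (y1 * y1)
    + (- (g1 * g3 * f3)) * (y2 * y2)) \<in> I"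
proof -
  have "(f1 * f3) * (g1 * g3) = (f1 * g1) * (f3 * g3)" by (simp add: algebra_simps power2_eq_square)
  then have u: "(f1 * f3) * (g1 * g3) = 1" using units by simp
  have "y3 * y3 - ((g1 * g3) * (y3 * y1 * l2) + (- (g1 * g3)) * (y1 * y1) + (- (g1 * g3 * f3)) * (y2 * y2))
      = ((f1 * f3) * (g1 * g3)) * (y3 * y3) - ((g1 * g3) * (y3 * y1 * l2)
          + (- (g1 * g3)) * (y1 * y1) + (- (g1 * g3 * f3)) * (y2 * y2))" unfolding u by simp
  also have "\<dots> = (- (g1 * g3)) * (y3 * y1 * l2 - (f3 * f1 * y3^2 + y1^2 + f3 * y2^2))"
    by (simp add: \<alpha>_def algebra_simps power2_eq_square)
  finally show ?thesis by (rule ssubst[of _ _ "\<lambda>t. t \<in> I"]) (intro I_add I_mult rels)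
qed

end

section \<open>Normal monomials and termination of the reductions\<close>

definition normal ::
    "nat \<Rightarrow> nat \<Rightarrow> nat \<Rightarrow> nat \<Rightarrow> nat \<Rightarrow> nat \<Rightarrow> nat \<Rightarrow> nat \<Rightarrow> bool" where
  "normal a2 a3 b1 b2 b3 c1 c2 c3 \<longleftrightarrow>
     (a3 \<le> 1 \<and> b1 = 0 \<and> b3 = 0 \<and> c1 = 0 \<and> c2 = 0 \<and> c3 = 0) \<or>
     (a2 = 0 \<and> a3 = 0 \<and> b1 = 0 \<and> b3 = 1 \<and> c1 = 0 \<and> c2 = 0 \<and> c3 = 0) \<or>
     (a2 = 0 \<and> a3 = 0 \<and> b1 = 0 \<and> b3 = 0 \<and> c3 \<le> 1 \<and> (c1
         = 0 \<or> b2 \<le> 1)) \<or>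
     (a2 = 0 \<and> a3 = 0 \<and> b1 = 1 \<and> b2 = 0 \<and> b3 = 0 \<and> c2 = 0 \<and> c3 = 0) \<or>
     (a2 = 0 \<and> a3 = 0 \<and> b1 = 0 \<and> b2 = 0 \<and> b3 = 1 \<and> c2 = 0 \<and> c3 = 0)"

text \<open>The hypotheses rule out the left sides of the reductions one by one. What survives falls
  into five families: x2 and at most one x3 with powers of l2; powers of l2 with one l3; powers of
  l2 with y's; and l1 or l3 with powers of y1.\<close>

lemma normal_if_irreducible:
  assumes "a2 = 0 \<or> c1 = 0" "a2 = 0 \<or> c2 = 0" "a2 = 0 \<or> c3 = 0"
    "a3 = 0 \<or> c1 = 0" "a3 = 0 \<or> c2 = 0" "a3 = 0 \<or> c3 = 0"
    "a3 \<le> 1" "a3 = 0 \<or> b1 = 0" "a2 = 0 \<or> b1 = 0" "a2 = 0 \<or> b3 = 0" "a3 = 0 \<or> b3 = 0"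
    "b1 \<le> 1" "b1 = 0 \<or> b2 = 0" "b1 = 0 \<or> b3 = 0" "b3 \<le> 1" 
    "b1 = 0 \<or> c2 = 0" "b1 = 0 \<or> c3 = 0" "b3 = 0 \<or> c2 = 0" "b3 = 0 \<or> c3 = 0"
    "b2 = 0 \<or> b3 = 0 \<or> c1 = 0" "b2 \<le> 1 \<or> c1 = 0" "c3 \<le> 1"
  shows "normal a2 a3 b1 b2 b3 c1 c2 c3"
proof (cases "a2 = 0 \<and> a3 = 0")
  case False
  then have "b1 = 0 \<and> b3 = 0 \<and> c1 = 0 \<and> c2 = 0 \<and> c3 = 0" using assms(1-6,8-11) by auto
  then show ?thesis using assms(7) unfolding normal_def by simp
next
  case a: True
  show ?thesis
  proof (cases "b1 = 0")
    case False
    then have "b1 = 1" "b2 = 0" "b3 = 0" "c2 = 0" "c3 = 0" using assms(12-14,16,17) by auto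
    then show ?thesis using a unfolding normal_def by simp
  next
    case b1: True
    show ?thesis
    proof (cases "b3 = 0")
      case True
      then show ?thesis using a b1 assms(21,22) unfolding normal_def by auto
    next
      case False
      then have "b3 = 1" "c2 = 0" "c3 = 0" "b2 = 0 \<or> c1 = 0" using assms(15,18-20) by auto
      then show ?thesis using a b1 unfolding normal_def by auto
    qed
  qed
qed
text \<open>
  All reductions below strictly decrease this weight.  The last summand distinguishes
  \<open>l2\<^sup>2 * y1 \<rightarrow> l2 * y3\<close> and \<open>y3\<^sup>2 \<rightarrow> y1 * y3
      * l2\<close>, for which the linear part stays the same.
\<close>

definition weight ::
    "nat \<Rightarrow> nat \<Rightarrow> nat \<Rightarrow> nat \<Rightarrow> nat \<Rightarrow> nat \<Rightarrow> nat \<Rightarrow> nat \<Rightarrow> nat" where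
  "weight a2 a3 b1 b2 b3 c1 c2 c3 =
     3 * (10 * a2 + 11 * a3 + 3 * b1 + b2 + 3 * b3 + c3) + (if c3 = 0 then 1 else c3 - 1)"

locale markov_span = markov_ideal I f1 f2 f3 g1 g2 g3 x1 x2 x3 l1 l2 l3 y1 y2 y3
  for I :: "'r::comm_ring_1 set" and f1 f2 f3 g1 g2 g3 x1 x2 x3 l1 l2 l3 y1 y2 y3 +
  fixes T :: "'r set"
  assumes T_add: "p \<in> T \<Longrightarrow> q \<in> T \<Longrightarrow> p + q \<in> T"
    and T_uminus: "p \<in> T \<Longrightarrow> - p \<in> T"
    and T_scale: "c \<in> {f1, f2, f3, g1, g2, g3, x1} \<Longrightarrow> p \<in> T
        \<Longrightarrow> c * p \<in> T"
    and T_cong: "q \<in> T \<Longrightarrow> p - q \<in> I \<Longrightarrow> p \<in> T"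
    and T_normal': "normal a2 a3 b1 b2 b3 c1 c2 c3 \<Longrightarrow>
      x2 ^ a2 * x3 ^ a3 * l1 ^ b1 * l2 ^ b2 * l3 ^ b3 * y1 ^ c1 * y2 ^ c2 * y3 ^ c3 \<in> T"
begin

definition M :: "nat \<Rightarrow> nat \<Rightarrow> nat \<Rightarrow> nat \<Rightarrow> nat \<Rightarrow> nat \<Rightarrow> nat \<Rightarrow> nat \<Rightarrow> 'r" where
  "M a2 a3 b1 b2 b3 c1 c2 c3 =
     x2 ^ a2 * x3 ^ a3 * l1 ^ b1 * l2 ^ b2 * l3 ^ b3 * y1 ^ c1 * y2 ^ c2 * y3 ^ c3"

lemmas T_normal = T_normal'[folded M_def]

definition K :: "'r set" where "K = {c. \<forall>p\<in>T. c * p \<in> T}"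

lemma K_mult: "c \<in> K \<Longrightarrow> p \<in> T \<Longrightarrow> c * p \<in> T"
  by (simp add: K_def)

lemma K_add: "a \<in> K \<Longrightarrow> b \<in> K \<Longrightarrow> a + b \<in> K"
  by (simp add: K_def T_add distrib_right)

lemma K_uminus: "a \<in> K \<Longrightarrow> - a \<in> K"
  by (simp add: K_def T_uminus)

lemma K_diff: "a \<in> K \<Longrightarrow> b \<in> K \<Longrightarrow> a - b \<in> K"
  using K_add[of a "- b"] K_uminus[of b] by simp

lemma K_times: "a \<in> K \<Longrightarrow> b \<in> K \<Longrightarrow> a * b \<in> K"
  by (simp add: K_def mult.assoc)

lemma K_one: "1 \<in> K"
  by (simp add: K_def)

lemma K_power: "a \<in> K \<Longrightarrow> a ^ n \<in> K"
  by (induction n) (simp_all add: K_one K_times)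

lemma K_two: "2 \<in> K"
  using K_add[OF K_one K_one] by simp

lemma K_gens: "f1 \<in> K" "f2 \<in> K" "f3 \<in> K" "g1 \<in> K" "g2 \<in> K" "g3 \<in> K" "x1 \<in> K"
  by (simp_all add: K_def T_scale)

lemma K_alpha: "\<alpha> \<in> K"
  by (simp add: \<alpha>_def K_gens K_times K_diff K_one)

lemmas K = K_add K_uminus K_diff K_times K_one K_power K_two K_gens K_alpha

lemma T_reduce:
  assumes "p - q \<in> I" "s \<in> T" "s = q * r" "m = p * r"
  shows "m \<in> T"
proof (rule T_cong[OF assms(2)])
  show "m - s \<in> I"
    unfolding assms(3,4) using I_mult[OF assms(1), of r] by (simp add: algebra_simps)
qed

text \<open>The weights 10 and 11 let a product of some x with some y turn into two l's, of weight
  at most 6. That x3 is heavier than x2 orients x3^2 to x2^2, while 10 + 3 > 11 + 1 still lets x2 *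
  l3 turn into x3 * l2. The factor 3 in \<open>weight\<close> lets a drop of the linear part
  outweigh any rise of the last summand.\<close>

lemma M_in_T: "M a2 a3 b1 b2 b3 c1 c2 c3 \<in> T"
proof (induction "weight a2 a3 b1 b2 b3 c1 c2 c3" arbitrary: a2 a3 b1 b2 b3 c1 c2 c3
    rule: less_induct)
  case less
  show ?case
  proof (rule ccontr)
    assume notin: "M a2 a3 b1 b2 b3 c1 c2 c3 \<notin> T"
    have x2y3: "a2 = 0 \<or> c3 = 0"
    proof (rule ccontr)
      assume "\<not> (a2 = 0 \<or> c3 = 0)"
      then have "1 \<le> a2 \<and> 1 \<le> c3" by simp
      then obtain a2' c3' where e: "a2 = a2' + 1" "c3 = c3' + 1"
        using le_add_diff_inverse2 by metis
      have "(f2 * f3) * M a2' a3 b1 (b2 + 1) (b3 + 1) c1 c2 c3'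
          + (- \<alpha>) * M a2' a3 (b1 + 1) b2 b3 c1 c2 c3' \<in> T"
        by (intro T_add K_mult less.hyps) (use e in \<open>auto simp: weight_def K\<close>)
      then have "M a2 a3 b1 b2 b3 c1 c2 c3 \<in> T"
        by (rule T_reduce[OF red_x2y3, where r = "M a2' a3 b1 b2 b3 c1 c2 c3'"])
          (use e in \<open>simp_all add: M_def algebra_simps power2_eq_square\<close>)
      then show False using notin by contradiction
    qed
    have x3y1: "a3 = 0 \<or> c1 = 0"
    proof (rule ccontr)
      assume "\<not> (a3 = 0 \<or> c1 = 0)"
      then have "1 \<le> a3 \<and> 1 \<le> c1" by simp
      then obtain a3' c1' where e: "a3 = a3' + 1" "c1 = c1' + 1"
        using le_add_diff_inverse2 by metis
      have "(f3 * f1) * M a2 a3' (b1 + 1) b2 (b3 + 1) c1' c2 c3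
          + (- \<alpha>) * M a2 a3' b1 (b2 + 1) b3 c1' c2 c3 \<in> T"
        by (intro T_add K_mult less.hyps) (use e in \<open>auto simp: weight_def K\<close>)
      then have "M a2 a3 b1 b2 b3 c1 c2 c3 \<in> T"
        by (rule T_reduce[OF red_x3y1, where r = "M a2 a3' b1 b2 b3 c1' c2 c3"])
          (use e in \<open>simp_all add: M_def algebra_simps power2_eq_square\<close>)
      then show False using notin by contradiction
    qed
    have x2y1: "a2 = 0 \<or> c1 = 0"
    proof (rule ccontr)
      assume "\<not> (a2 = 0 \<or> c1 = 0)"
      then have "1 \<le> a2 \<and> 1 \<le> c1" by simp
      then obtain a2' c1' where e: "a2 = a2' + 1" "c1 = c1' + 1"
        using le_add_diff_inverse2 by metis
      have "M a2' a3 (b1 + 1) (b2 + 1) b3 c1' c2 c3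
          + (f3 * \<alpha>) * M a2' a3 b1 b2 (b3 + 1) c1' c2 c3 \<in> T"
        by (intro T_add K_mult less.hyps) (use e in \<open>auto simp: weight_def K\<close>)
      then have "M a2 a3 b1 b2 b3 c1 c2 c3 \<in> T"
        by (rule T_reduce[OF red_x2y1, where r = "M a2' a3 b1 b2 b3 c1' c2 c3"])
          (use e in \<open>simp_all add: M_def algebra_simps power2_eq_square\<close>)
      then show False using notin by contradiction
    qed
    have x3y2: "a3 = 0 \<or> c2 = 0"
    proof (rule ccontr)
      assume "\<not> (a3 = 0 \<or> c2 = 0)"
      then have "1 \<le> a3 \<and> 1 \<le> c2" by simp
      then obtain a3' c2' where e: "a3 = a3' + 1" "c2 = c2' + 1"
        using le_add_diff_inverse2 by metis
      have "M a2 a3' b1 (b2 + 1) (b3 + 1) c1 c2' c3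
          + (f1 * \<alpha>) * M a2 a3' (b1 + 1) b2 b3 c1 c2' c3 \<in> T"
        by (intro T_add K_mult less.hyps) (use e in \<open>auto simp: weight_def K\<close>)
      then have "M a2 a3 b1 b2 b3 c1 c2 c3 \<in> T"
        by (rule T_reduce[OF red_x3y2, where r = "M a2 a3' b1 b2 b3 c1 c2' c3"])
          (use e in \<open>simp_all add: M_def algebra_simps power2_eq_square\<close>)
      then show False using notin by contradiction
    qed
    have x2y2: "a2 = 0 \<or> c2 = 0"
    proof (rule ccontr)
      assume "\<not> (a2 = 0 \<or> c2 = 0)"
      then have "1 \<le> a2 \<and> 1 \<le> c2" by simp
      then obtain a2' c2' where e: "a2 = a2' + 1" "c2 = c2' + 1"
        using le_add_diff_inverse2 by metis
      have "f2 * M a2' a3 b1 (b2 + 2) b3 c1 c2' c3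
          + \<alpha>^2 * M a2' a3 b1 b2 b3 c1 c2' c3 \<in> T"
        by (intro T_add K_mult less.hyps) (use e in \<open>auto simp: weight_def K\<close>)
      then have "M a2 a3 b1 b2 b3 c1 c2 c3 \<in> T"
        by (rule T_reduce[OF red_x2y2, where r = "M a2' a3 b1 b2 b3 c1 c2' c3"])
          (use e in \<open>simp_all add: M_def algebra_simps power2_eq_square\<close>)
      then show False using notin by contradiction
    qed
    have x3y3: "a3 = 0 \<or> c3 = 0"
    proof (rule ccontr)
      assume "\<not> (a3 = 0 \<or> c3 = 0)"
      then have "1 \<le> a3 \<and> 1 \<le> c3" by simp
      then obtain a3' c3' where e: "a3 = a3' + 1" "c3 = c3' + 1"
        using le_add_diff_inverse2 by metis
      have "f3 * M a2 a3' b1 b2 (b3 + 2) c1 c2 c3'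
          + \<alpha>^2 * M a2 a3' b1 b2 b3 c1 c2 c3' \<in> T"
        by (intro T_add K_mult less.hyps) (use e in \<open>auto simp: weight_def K\<close>)
      then have "M a2 a3 b1 b2 b3 c1 c2 c3 \<in> T"
        by (rule T_reduce[OF red_x3y3, where r = "M a2 a3' b1 b2 b3 c1 c2 c3'"])
          (use e in \<open>simp_all add: M_def algebra_simps power2_eq_square\<close>)
      then show False using notin by contradiction
    qed
    have x3x3: "a3 \<le> 1"
    proof (rule ccontr)
      assume "\<not> (a3 \<le> 1)"
      then have "2 \<le> a3" by simp
      then obtain a3' where e: "a3 = a3' + 2"
        using le_add_diff_inverse2 by metis
      have "x1 * M a2 (a3' + 1) b1 (b2 + 1) b3 c1 c2 c3
          + (- (f3 * f1 * x1^2)) * M a2 a3' b1 b2 b3 c1 c2 c3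
          + (- f1) * M (a2 + 2) a3' b1 b2 b3 c1 c2 c3 \<in> T"
        by (intro T_add K_mult less.hyps) (use e in \<open>auto simp: weight_def K\<close>)
      then have "M a2 a3 b1 b2 b3 c1 c2 c3 \<in> T"
        by (rule T_reduce[OF red_x3x3, where r = "M a2 a3' b1 b2 b3 c1 c2 c3"])
          (use e in \<open>simp_all add: M_def algebra_simps power2_eq_square\<close>)
      then show False using notin by contradiction
    qed
    have x3l1: "a3 = 0 \<or> b1 = 0"
    proof (rule ccontr)
      assume "\<not> (a3 = 0 \<or> b1 = 0)"
      then have "1 \<le> a3 \<and> 1 \<le> b1" by simp
      then obtain a3' b1' where e: "a3 = a3' + 1" "b1 = b1' + 1"
        using le_add_diff_inverse2 by metis
      have "(f3 * x1) * M a2 a3' b1' b2 (b3 + 1) c1 c2 c3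
          + (- \<alpha>) * M (a2 + 1) a3' b1' b2 b3 c1 c2 c3 \<in> T"
        by (intro T_add K_mult less.hyps) (use e in \<open>auto simp: weight_def K\<close>)
      then have "M a2 a3 b1 b2 b3 c1 c2 c3 \<in> T"
        by (rule T_reduce[OF red_x3l1, where r = "M a2 a3' b1' b2 b3 c1 c2 c3"])
          (use e in \<open>simp_all add: M_def algebra_simps power2_eq_square\<close>)
      then show False using notin by contradiction
    qed
    have x2l1: "a2 = 0 \<or> b1 = 0"
    proof (rule ccontr)
      assume "\<not> (a2 = 0 \<or> b1 = 0)"
      then have "1 \<le> a2 \<and> 1 \<le> b1" by simp
      then obtain a2' b1' where e: "a2 = a2' + 1" "b1 = b1' + 1"
        using le_add_diff_inverse2 by metis
      have "(g1 * x1) * M a2' a3 b1' (b2 + 1) b3 c1 c2 c3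
          + (g1 * \<alpha>) * M a2' (a3 + 1) b1' b2 b3 c1 c2 c3 \<in> T"
        by (intro T_add K_mult less.hyps) (use e in \<open>auto simp: weight_def K\<close>)
      then have "M a2 a3 b1 b2 b3 c1 c2 c3 \<in> T"
        by (rule T_reduce[OF red_x2l1, where r = "M a2' a3 b1' b2 b3 c1 c2 c3"])
          (use e in \<open>simp_all add: M_def algebra_simps power2_eq_square\<close>)
      then show False using notin by contradiction
    qed
    have x2l3: "a2 = 0 \<or> b3 = 0"
    proof (rule ccontr)
      assume "\<not> (a2 = 0 \<or> b3 = 0)"
      then have "1 \<le> a2 \<and> 1 \<le> b3" by simp
      then obtain a2' b3' where e: "a2 = a2' + 1" "b3 = b3' + 1"
        using le_add_diff_inverse2 by metis
      have "f2 * M a2' (a3 + 1) b1 (b2 + 1) b3' c1 c2 c3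
          + (- (\<alpha> * x1)) * M a2' a3 b1 b2 b3' c1 c2 c3 \<in> T"
        by (intro T_add K_mult less.hyps) (use e in \<open>auto simp: weight_def K\<close>)
      then have "M a2 a3 b1 b2 b3 c1 c2 c3 \<in> T"
        by (rule T_reduce[OF red_x2l3, where r = "M a2' a3 b1 b2 b3' c1 c2 c3"])
          (use e in \<open>simp_all add: M_def algebra_simps power2_eq_square\<close>)
      then show False using notin by contradiction
    qed
    have x3l3: "a3 = 0 \<or> b3 = 0"
    proof (rule ccontr)
      assume "\<not> (a3 = 0 \<or> b3 = 0)"
      then have "1 \<le> a3 \<and> 1 \<le> b3" by simp
      then obtain a3' b3' where e: "a3 = a3' + 1" "b3 = b3' + 1"
        using le_add_diff_inverse2 by metis
      have "x1 * M a2 a3' b1 (b2 + 1) (b3' + 1) c1 c2 c3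
          + (- (f1 * f2)) * M (a2 + 1) a3' b1 (b2 + 1) b3' c1 c2 c3
          + (- (f1 * x1)) * M a2 a3' (b1 + 1) b2 b3' c1 c2 c3 \<in> T"
        by (intro T_add K_mult less.hyps) (use e in \<open>auto simp: weight_def K\<close>)
      then have "M a2 a3 b1 b2 b3 c1 c2 c3 \<in> T"
        by (rule T_reduce[OF red_x3l3, where r = "M a2 a3' b1 b2 b3' c1 c2 c3"])
          (use e in \<open>simp_all add: M_def algebra_simps power2_eq_square\<close>)
      then show False using notin by contradiction
    qed
    have l1l1: "b1 \<le> 1"
    proof (rule ccontr)
      assume "\<not> (b1 \<le> 1)"
      then have "2 \<le> b1" by simp
      then obtain b1' where e: "b1 = b1' + 2"
        using le_add_diff_inverse2 by metis
      have "(g1 * x1) * M a2 a3 b1' b2 b3 (c1 + 1) c2 c3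
          + (- (g1 * \<alpha>^2)) * M a2 a3 b1' b2 b3 c1 c2 c3 \<in> T"
        by (intro T_add K_mult less.hyps) (use e in \<open>auto simp: weight_def K\<close>)
      then have "M a2 a3 b1 b2 b3 c1 c2 c3 \<in> T"
        by (rule T_reduce[OF red_l1l1, where r = "M a2 a3 b1' b2 b3 c1 c2 c3"])
          (use e in \<open>simp_all add: M_def algebra_simps power2_eq_square\<close>)
      then show False using notin by contradiction
    qed
    have l1l2: "b1 = 0 \<or> b2 = 0"
    proof (rule ccontr)
      assume "\<not> (b1 = 0 \<or> b2 = 0)"
      then have "1 \<le> b1 \<and> 1 \<le> b2" by simp
      then obtain b1' b2' where e: "b1 = b1' + 1" "b2 = b2' + 1"
        using le_add_diff_inverse2 by metis
      have "(g1 * g2 * x1) * M a2 a3 b1' b2' b3 c1 (c2 + 1) c3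
          + (g1 * g2 * \<alpha>) * M a2 a3 b1' b2' (b3 + 1) c1 c2 c3 \<in> T"
        by (intro T_add K_mult less.hyps) (use e in \<open>auto simp: weight_def K\<close>)
      then have "M a2 a3 b1 b2 b3 c1 c2 c3 \<in> T"
        by (rule T_reduce[OF red_l1l2, where r = "M a2 a3 b1' b2' b3 c1 c2 c3"])
          (use e in \<open>simp_all add: M_def algebra_simps power2_eq_square\<close>)
      then show False using notin by contradiction
    qed
    have l1l3: "b1 = 0 \<or> b3 = 0"
    proof (rule ccontr)
      assume "\<not> (b1 = 0 \<or> b3 = 0)"
      then have "1 \<le> b1 \<and> 1 \<le> b3" by simp
      then obtain b1' b3' where e: "b1 = b1' + 1" "b3 = b3' + 1"
        using le_add_diff_inverse2 by metis
      have "x1 * M a2 a3 b1' b2 b3' c1 c2 (c3 + 1)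
          + (- (f2 * \<alpha>)) * M a2 a3 b1' (b2 + 1) b3' c1 c2 c3 \<in> T"
        by (intro T_add K_mult less.hyps) (use e in \<open>auto simp: weight_def K\<close>)
      then have "M a2 a3 b1 b2 b3 c1 c2 c3 \<in> T"
        by (rule T_reduce[OF red_l1l3, where r = "M a2 a3 b1' b2 b3' c1 c2 c3"])
          (use e in \<open>simp_all add: M_def algebra_simps power2_eq_square\<close>)
      then show False using notin by contradiction
    qed
    have l3l3: "b3 \<le> 1"
    proof (rule ccontr)
      assume "\<not> (b3 \<le> 1)"
      then have "2 \<le> b3" by simp
      then obtain b3' where e: "b3 = b3' + 2"
        using le_add_diff_inverse2 by metis
      have "x1 * M a2 a3 b1 b2 (b3' + 1) c1 (c2 + 1) c3
          + (- (f1 * f2 * x1)) * M a2 a3 b1 b2 b3' (c1 + 1) c2 c3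
          + (- (f1 * f2^2)) * M a2 a3 b1 (b2 + 2) b3' c1 c2 c3 \<in> T"
        by (intro T_add K_mult less.hyps) (use e in \<open>auto simp: weight_def K\<close>)
      then have "M a2 a3 b1 b2 b3 c1 c2 c3 \<in> T"
        by (rule T_reduce[OF red_l3l3, where r = "M a2 a3 b1 b2 b3' c1 c2 c3"])
          (use e in \<open>simp_all add: M_def algebra_simps power2_eq_square\<close>)
      then show False using notin by contradiction
    qed
    have l1y2: "b1 = 0 \<or> c2 = 0"
    proof (rule ccontr)
      assume "\<not> (b1 = 0 \<or> c2 = 0)"
      then have "1 \<le> b1 \<and> 1 \<le> c2" by simp
      then obtain b1' c2' where e: "b1 = b1' + 1" "c2 = c2' + 1"
        using le_add_diff_inverse2 by metis
      have "f2 * M a2 a3 b1' (b2 + 1) b3 (c1 + 1) c2' c3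
          + (- \<alpha>) * M a2 a3 b1' b2 b3 c1 c2' (c3 + 1) \<in> T"
        by (intro T_add K_mult less.hyps) (use e in \<open>auto simp: weight_def K\<close>)
      then have "M a2 a3 b1 b2 b3 c1 c2 c3 \<in> T"
        by (rule T_reduce[OF red_l1y2, where r = "M a2 a3 b1' b2 b3 c1 c2' c3"])
          (use e in \<open>simp_all add: M_def algebra_simps power2_eq_square\<close>)
      then show False using notin by contradiction
    qed
    have l1y3: "b1 = 0 \<or> c3 = 0"
    proof (rule ccontr)
      assume "\<not> (b1 = 0 \<or> c3 = 0)"
      then have "1 \<le> b1 \<and> 1 \<le> c3" by simp
      then obtain b1' c3' where e: "b1 = b1' + 1" "c3 = c3' + 1"
        using le_add_diff_inverse2 by metis
      have "g1 * M a2 a3 b1' b2 (b3 + 1) (c1 + 1) c2 c3'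
          + (g1 * \<alpha>) * M a2 a3 b1' b2 b3 c1 (c2 + 1) c3' \<in> T"
        by (intro T_add K_mult less.hyps) (use e in \<open>auto simp: weight_def K\<close>)
      then have "M a2 a3 b1 b2 b3 c1 c2 c3 \<in> T"
        by (rule T_reduce[OF red_l1y3, where r = "M a2 a3 b1' b2 b3 c1 c2 c3'"])
          (use e in \<open>simp_all add: M_def algebra_simps power2_eq_square\<close>)
      then show False using notin by contradiction
    qed
    have l3y2: "b3 = 0 \<or> c2 = 0"
    proof (rule ccontr)
      assume "\<not> (b3 = 0 \<or> c2 = 0)"
      then have "1 \<le> b3 \<and> 1 \<le> c2" by simp
      then obtain b3' c2' where e: "b3 = b3' + 1" "c2 = c2' + 1"
        using le_add_diff_inverse2 by metis
      have "g3 * M a2 a3 b1 (b2 + 1) b3' c1 c2' (c3 + 1)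
          + (g3 * \<alpha>) * M a2 a3 b1 b2 b3' (c1 + 1) c2' c3 \<in> T"
        by (intro T_add K_mult less.hyps) (use e in \<open>auto simp: weight_def K\<close>)
      then have "M a2 a3 b1 b2 b3 c1 c2 c3 \<in> T"
        by (rule T_reduce[OF red_l3y2, where r = "M a2 a3 b1 b2 b3' c1 c2' c3"])
          (use e in \<open>simp_all add: M_def algebra_simps power2_eq_square\<close>)
      then show False using notin by contradiction
    qed
    have l3y3: "b3 = 0 \<or> c3 = 0"
    proof (rule ccontr)
      assume "\<not> (b3 = 0 \<or> c3 = 0)"
      then have "1 \<le> b3 \<and> 1 \<le> c3" by simp
      then obtain b3' c3' where e: "b3 = b3' + 1" "c3 = c3' + 1"
        using le_add_diff_inverse2 by metis
      have "(- (f1 * f2^2 * f3)) * M a2 a3 b1 (b2 + 1) b3' c1 (c2 + 1) c3'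
          + (- (f1 * f2)) * M a2 a3 (b1 + 1) b2 b3' (c1 + 1) c2 c3'
          + x1 * M a2 a3 b1 b2 b3' c1 (c2 + 1) (c3' + 1) \<in> T"
        by (intro T_add K_mult less.hyps) (use e in \<open>auto simp: weight_def K\<close>)
      then have "M a2 a3 b1 b2 b3 c1 c2 c3 \<in> T"
        by (rule T_reduce[OF red_l3y3, where r = "M a2 a3 b1 b2 b3' c1 c2 c3'"])
          (use e in \<open>simp_all add: M_def algebra_simps power2_eq_square\<close>)
      then show False using notin by contradiction
    qed
    have l2l3y1: "b2 = 0 \<or> b3 = 0 \<or> c1 = 0"
    proof (rule ccontr)
      assume "\<not> (b2 = 0 \<or> b3 = 0 \<or> c1 = 0)"
      then have "1 \<le> b2 \<and> 1 \<le> b3 \<and> 1 \<le> c1" by simp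
      then obtain b2' b3' c1' where e: "b2 = b2' + 1" "b3 = b3' + 1" "c1 = c1' + 1"
        using le_add_diff_inverse2 by metis
      have "(1 - f1 * f3 * (f1 * f2^2 * f3)) * M a2 a3 b1 (b2' + 1) b3' c1' (c2 + 1) c3
          + (f1 - f1 * f3 * (f1 * f2)) * M a2 a3 (b1 + 1) b2' b3' (c1' + 1) c2 c3
          + (f1 * f3 * x1) * M a2 a3 b1 b2' b3' c1' (c2 + 1) (c3 + 1) \<in> T"
        by (intro T_add K_mult less.hyps) (use e in \<open>auto simp: weight_def K\<close>)
      then have "M a2 a3 b1 b2 b3 c1 c2 c3 \<in> T"
        by (rule T_reduce[OF red_l2l3y1, where r = "M a2 a3 b1 b2' b3' c1' c2 c3"])
          (use e in \<open>simp_all add: M_def algebra_simps power2_eq_square\<close>)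
      then show False using notin by contradiction
    qed
    have l2l2y1y3: "b2 \<le> 1 \<or> c1 = 0 \<or> c3 = 0"
    proof (rule ccontr)
      assume "\<not> (b2 \<le> 1 \<or> c1 = 0 \<or> c3 = 0)"
      then have "2 \<le> b2 \<and> 1 \<le> c1 \<and> 1 \<le> c3" by simp
      then obtain b2' c1' c3' where e: "b2 = b2' + 2" "c1 = c1' + 1" "c3 = c3' + 1"
        using le_add_diff_inverse2 by metis
      have "(f3 - f1 * f3 * (f1 * f2^2 * f3^2)) * M a2 a3 b1 (b2' + 1) b3 c1' (c2 + 2) c3'
          + (1 - f1 * f3 * (f1 * f2^2 * f3)) * M a2 a3 b1 (b2' + 1) b3 (c1' + 2) c2 c3'
          + (f1 * f3 * \<alpha>^2) * M a2 a3 b1 b2' b3 (c1' + 1) c2 (c3' + 1)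
          + (f1 * f3 * (f3 * x1)) * M a2 a3 b1 b2' b3 c1' (c2 + 2) (c3' + 1) \<in> T"
        by (intro T_add K_mult less.hyps) (use e in \<open>auto simp: weight_def K\<close>)
      then have "M a2 a3 b1 b2 b3 c1 c2 c3 \<in> T"
        by (rule T_reduce[OF red_l2l2y1y3, where r = "M a2 a3 b1 b2' b3 c1' c2 c3'"])
          (use e in \<open>simp_all add: M_def algebra_simps power2_eq_square\<close>)
      then show False using notin by contradiction
    qed
    have l2l2y1: "b2 \<le> 1 \<or> c1 = 0"
    proof (rule ccontr)
      assume "\<not> (b2 \<le> 1 \<or> c1 = 0)"
      \<comment> \<open>The previous rule forces c3 = 0, so the last summand of
        \<open>weight\<close> drops from 1 to 0 when y3 appears.\<close>
      then have "2 \<le> b2 \<and> 1 \<le> c1 \<and> c3 = 0" using l2l2y1y3 by auto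
      then obtain b2' c1' where e: "b2 = b2' + 2" "c1 = c1' + 1" "c3 = 0"
        using le_add_diff_inverse2 by metis
      have "(g1 * g2^2 * g3 * f3 * x1) * M a2 a3 b1 b2' b3 c1' (c2 + 2) 0
          + (g1 * g2^2 * g3 * (\<alpha> * (\<alpha> + 2))) * M a2 a3 b1 (b2' + 1) b3 c1' c2 (0 + 1)
          + (g1 * g2^2 * g3 * \<alpha>^2) * M a2 a3 b1 b2' b3 (c1' + 1) c2 0 \<in> T"
        by (intro T_add K_mult less.hyps) (use e in \<open>auto simp: weight_def K\<close>)
      then have "M a2 a3 b1 b2 b3 c1 c2 c3 \<in> T"
        by (rule T_reduce[OF red_l2l2y1, where r = "M a2 a3 b1 b2' b3 c1' c2 0"])
          (use e in \<open>simp_all add: M_def algebra_simps power2_eq_square\<close>)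
      then show False using notin by contradiction
    qed
    have y3y3: "c3 \<le> 1"
    proof (rule ccontr)
      assume "\<not> (c3 \<le> 1)"
      then have "2 \<le> c3" by simp
      then obtain c3' where e: "c3 = c3' + 2"
        using le_add_diff_inverse2 by metis
      have "(g1 * g3) * M a2 a3 b1 (b2 + 1) b3 (c1 + 1) c2 (c3' + 1)
          + (- (g1 * g3)) * M a2 a3 b1 b2 b3 (c1 + 2) c2 c3'
          + (- (g1 * g3 * f3)) * M a2 a3 b1 b2 b3 c1 (c2 + 2) c3' \<in> T"
        by (intro T_add K_mult less.hyps) (use e in \<open>auto simp: weight_def K\<close>)
      then have "M a2 a3 b1 b2 b3 c1 c2 c3 \<in> T"
        by (rule T_reduce[OF red_y3y3, where r = "M a2 a3 b1 b2 b3 c1 c2 c3'"])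
          (use e in \<open>simp_all add: M_def algebra_simps power2_eq_square\<close>)
      then show False using notin by contradiction
    qed
    have "normal a2 a3 b1 b2 b3 c1 c2 c3"
      by (rule normal_if_irreducible)
        (fact x2y1 x2y2 x2y3 x3y1 x3y2 x3y3 x3x3 x3l1 x2l1 x2l3 x3l3 l1l1 l1l2 l1l3 l3l3 l1y2 l1y3 l3y2 l3y3 l2l3y1 l2l2y1 y3y3)+
    then show False using T_normal notin by blast
  qed
qed

end

subsection \<open>Independence of the normal monomials modulo \<open>x\<^sub>1\<close>\<close>

text \<open>
  These monomials represent a basis of the quotient
      by \<open>x\<^sub>1\<close>.  On the divisor \<open>x\<^sub>1 = 0\<close> of the
  cluster \<open>{x\<^sub>1', x\<^sub>2, x\<^sub>3}\<close> put \<open>w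
      = x\<^sub>1' / x\<^sub>2\<close> and \<open>x\<^sub>3 / x\<^sub>2
      = s * t\<close> with \<open>s \<in> {1, -1}\<close>, so that
  \<open>f\<^sub>1 = - t\<^sup>2\<close>.  There each
      of them is \<open>x\<^sub>2\<close> to the power \<open>dg\<close> times \<open>s\<close> to the power \<open>par\<close> times a
  polynomial in \<open>w\<close> with nonzero terms only between the degrees \<open>lo\<close> and \<open>hi\<close>.
\<close>

datatype nform = XX nat bool nat | LL nat | YY nat nat bool nat | YL1 nat | YL3 nat

text \<open>A \<open>YY\<close> without any y would repeat \<open>XX 0 False b\<close>; the second
  condition is irreducibility under \<open>red_l2l2y1\<close>.\<close>

fun valid :: "nform \<Rightarrow> bool" where
  "valid (YY i j e b) \<longleftrightarrow> 0 < i + j + of_bool e \<and> (i = 0 \<or> b \<le> 1)"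
| "valid _ \<longleftrightarrow> True"

fun nmon :: "(gen_sym \<Rightarrow> 'a::comm_ring_1) \<Rightarrow> nform \<Rightarrow> 'a" where
  "nmon g (XX a e b) = g X2 ^ a * g X3 ^ of_bool e * g L2 ^ b"
| "nmon g (LL b) = g L2 ^ Suc b * g L3"
| "nmon g (YY i j e b) = g L2 ^ b * g Y1 ^ i * g Y2 ^ j * g Y3 ^ of_bool e"
| "nmon g (YL1 d) = g L1 * g Y1 ^ d"
| "nmon g (YL3 d) = g L3 * g Y1 ^ d"

fun dg :: "nform \<Rightarrow> int" where
  "dg (XX a e b) = int (a + of_bool e)"
| "dg (LL b) = 0"
| "dg (YY i j e b) = - int (i + j + of_bool e)"
| "dg (YL1 d) = - int d"
| "dg (YL3 d) = - int d"

fun par :: "nform \<Rightarrow> nat" where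
  "par (XX a e b) = of_bool e + b"
| "par (LL b) = Suc b"
| "par (YY i j e b) = of_bool e + b"
| "par (YL1 d) = 1"
| "par (YL3 d) = 0"

fun lo :: "nform \<Rightarrow> nat" where
  "lo (XX a e b) = b"
| "lo (LL b) = b + 2"
| "lo (YY i j e b) = i + b"
| "lo (YL1 d) = d"
| "lo (YL3 d) = d + 1"

fun hi :: "nform \<Rightarrow> nat" where
  "hi (YY i j e b) = i + b + 2 * (j + of_bool e)"
| "hi n = lo n"

fun piv :: "nform \<Rightarrow> nat" where
  "piv (YY i j e b) = (if b = 0 then lo (YY i j e b) else hi (YY i j e b))"
| "piv n = lo n"

text \<open>In degree -d and for fixed parity, \<open>YY\<close> with b = 0 occupies the exponents
  from i to 2 * d - i, with b = 1 those from i + 1 to 2 * d - i + 1. Taking the pairs (i, b) in the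
  order (0, 1), (0, 0), (1, 1), (1, 0), (2, 1) and so on uncovers an upper and a lower end in turn.
  Those with i = 0 and larger b stick out at the top and come before; the single terms
  \<open>YL1 d\<close> and \<open>YL3 d\<close> come last.\<close>

fun rank :: "nform \<Rightarrow> int" where
  "rank (YY i j e b) = (if b = 0 then 2 * int i else if i = 0 then - int b else 2 * int i - 1)"
| "rank (YL1 d) = 2 * int d + 1"
| "rank (YL3 d) = 2 * int d + 1"
| "rank _ = 0"

text \<open>
  Processing the monomials of one degree and parity
      by increasing \<open>rank\<close>, the coefficient at \<open>piv\<close>
  (alternately a lowest and a highest one) isolates one monomial at a time.
\<close>

lemma pivot_outside:
  assumes "valid n" "valid n'" "dg n = dg n'" "even (par n) = even (par n')"
    "rank n \<le> rank n'" "n \<noteq> n'"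
  shows "piv n < lo n' \<or> hi n' < piv n"
  using assms
  by (cases n; cases n'; simp add: of_bool_def split: if_splits; presburger)

section \<open>Restriction of the normal monomials to the divisor\<close>

locale real_point =
  fixes t f2 f3 :: real
  assumes t: "t > 0" and f2: "f2 > 0" and f3: "f3 > 0" and small: "f2 * f3 * t\<^sup>2 < 1"
begin

text \<open>\<open>a\<close> is the value of \<alpha> at f1 = -t^2, and \<open>u\<close>,
  \<open>A\<close>, \<open>q\<close> are what remains of y1, y2, y3 on the divisor, see
  \<open>mgen_at\<close>. The assumption \<open>small\<close> makes \<open>u\<close> nonzero, so
  that y1 does not vanish there identically.\<close>

definition "a = - (1 + f2 * f3 * t\<^sup>2)"
definition "u = (1 - (f2 * f3)\<^sup>2 * t ^ 4) / t\<^sup>2"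
definition "A = [:a\<^sup>2, 0, f2 / t\<^sup>2:]"
definition "q = [:a\<^sup>2, 0, f3 * f2\<^sup>2:]"

lemma a_nonzero: "a \<noteq> 0"
proof -
  have "0 < f2 * f3 * t\<^sup>2" using t f2 f3 by simp
  then show ?thesis by (simp add: a_def)
qed

lemma u_nonzero: "u \<noteq> 0"
proof -
  have "0 < f2 * f3 * t\<^sup>2" using t f2 f3 by simp
  then have "(f2 * f3 * t\<^sup>2)\<^sup>2 < 1" using small
      by (intro power_less_one_iff[THEN iffD2]) simp_all
  then have "(f2 * f3)\<^sup>2 * t ^ 4 < 1" by (simp add: power_mult_distrib)
  then show ?thesis using t by (simp add: u_def)
qed

text \<open>The factor of a normal monomial that depends on w, once the powers of x2 and of the sign
  s are split off, see \<open>nmon_at\<close>.\<close>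

fun Q :: "nform \<Rightarrow> real poly" where
  "Q (XX x e b) = monom (t ^ of_bool e / t ^ b) b"
| "Q (LL b) = monom (f2 / t ^ Suc b) (b + 2)"
| "Q (YY i j e b) = monom (u ^ i / t ^ b / t ^ of_bool e) (i + b) * (A ^ j * q ^ of_bool e)"
| "Q (YL1 d) = monom (- a / t * u ^ d) d"
| "Q (YL3 d) = monom (f2 * u ^ d) (d + 1)"

lemma A_q: "degree A = 2" "degree q = 2" "coeff A 0 = a\<^sup>2" "coeff q 0
    = a\<^sup>2" "A \<noteq> 0" "q \<noteq> 0"
  using t f2 f3 by (simp_all add: A_def q_def)

lemma deg_Aq: "degree (A ^ j * q ^ of_bool e) = 2 * (j + of_bool e)"
  using A_q by (simp add: degree_mult_eq degree_power_eq)

lemma Q_outside: "k < lo n \<or> hi n < k \<Longrightarrow> coeff (Q n) k = 0"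
proof (cases n)
  case [simp]: (YY i j e b)
  have "coeff (A ^ j * q ^ of_bool e) m = 0" if "2 * (j + of_bool e) < m" for m
    using that by (simp only: coeff_eq_0 deg_Aq)
  moreover assume "k < lo n \<or> hi n < k"
  ultimately show ?thesis by (simp only: Q.simps YY coeff_monom_mult lo.simps hi.simps) auto
qed auto

lemma Q_pivot: "coeff (Q n) (piv n) \<noteq> 0"
proof (cases n)
  case [simp]: (YY i j e b)
  have lead: "coeff (A ^ j * q ^ of_bool e) (2 * (j + of_bool e)) \<noteq> 0"
    unfolding deg_Aq[symmetric] using A_q(5,6) by (simp del: of_bool_eq_1_iff)
  have "coeff (A ^ j * q ^ of_bool e) 0 \<noteq> 0"
    using A_q a_nonzero by (simp add: coeff_mult coeff_0_power)
  then show ?thesis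
    using lead t u_nonzero by (auto simp: coeff_monom_mult)
qed (use t f2 u_nonzero a_nonzero in auto)

text \<open>Letting l vary separates the degrees, adding and subtracting the equations for s = 1 and
  s = -1 separates the parities, and what is left is an identity of polynomials in w, to which the
  pivots apply.\<close>

lemma independent:
  assumes S: "finite S" "\<And>n. n \<in> S \<Longrightarrow> valid n"
    and zero: "\<And>l w s. l > 0 \<Longrightarrow> w > 0
        \<Longrightarrow> s \<in> {1, -1} \<Longrightarrow>
      (\<Sum>n\<in>S. c n * (l powi dg n * s ^ par n * poly (Q n) w)) = 0"
    and "n \<in> S"
  shows "c n = 0"
proof -
  define S' where "S' d b = {n\<in>S. dg n = d \<and> even (par n) = b}" for d b
  have 1: "(\<Sum>n | n \<in> S \<and> dg n = d. c n * (s ^ par n * poly (Q n) w)) = 0"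
    if "w > 0" "s \<in> {1, -1}" for w s d
  proof (cases "d \<in> dg ` S")
    case True
    show ?thesis
    proof (rule powi_sum_zero_imp[OF _ _ _ _ True, where T = "{0<..}"])
      fix l :: real assume "l \<in> {0<..}"
      then have "0 = (\<Sum>n\<in>S. c n * (l powi dg n * s ^ par n * poly (Q n) w))"
        using zero that by simp
      also have "\<dots> = (\<Sum>d\<in>dg ` S. \<Sum>n | n \<in> S \<and> dg n
          = d. c n * (l powi dg n * s ^ par n * poly (Q n) w))"
        by (rule sum.image_gen[OF S(1)])
      also have "\<dots> = (\<Sum>d\<in>dg ` S. (\<Sum>n | n \<in> S \<and> dg n
          = d. c n * (s ^ par n * poly (Q n) w)) * l powi d)"
        by (intro sum.cong[OF refl]) (simp add: sum_distrib_left sum_distrib_right mult_ac)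
      finally show "(\<Sum>d\<in>dg ` S. (\<Sum>n | n \<in> S \<and> dg n
          = d. c n * (s ^ par n * poly (Q n) w)) * l powi d) = 0"
        by simp
    qed (use S infinite_Ioi in auto)
  next
    case False
    then have "{n \<in> S. dg n = d} = {}" by auto
    then show ?thesis by (simp only: sum.empty)
  qed
  have 2: "(\<Sum>n\<in>S' d b. c n * poly (Q n) w) = 0" if w: "w > 0" for w d b
  proof -
    have spl: "{n. n \<in> S \<and> dg n = d} = S' d True \<union> S' d False"
        "S' d True \<inter> S' d False = {}"
      "finite (S' d True)" "finite (S' d False)"
      using S by (auto simp: S'_def)
    have eq: "(\<Sum>n | n \<in> S \<and> dg n = d. h n) = (\<Sum>n\<in>S' d True. h n)
        + (\<Sum>n\<in>S' d False. h n)"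
      for h :: "nform \<Rightarrow> real"
      unfolding spl(1) by (rule sum.union_disjoint[OF spl(3,4,2)])
    have "(\<Sum>n\<in>S' d True. c n * poly (Q n) w) + (\<Sum>n\<in>S' d False. c n * poly (Q n) w) = 0"
      using 1[OF w, of 1 d] unfolding eq by simp
    moreover have "(\<Sum>n\<in>S' d True. c n * ((-1) ^ par n * poly (Q n) w))
        + (\<Sum>n\<in>S' d False. c n * ((-1) ^ par n * poly (Q n) w)) = 0"
      using 1[OF w, of "-1" d] unfolding eq by simp
    then have "(\<Sum>n\<in>S' d True. c n * poly (Q n) w) - (\<Sum>n\<in>S' d False. c n
        * poly (Q n) w) = 0"
      by (simp add: S'_def sum_negf)
    ultimately show ?thesis by (cases b) auto
  qed
  have 3: "(\<Sum>n\<in>S' d b. smult (c n) (Q n)) = 0" (is "?p = 0") for d b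
  proof -
    have "{0<..} \<subseteq> {w. poly ?p w = 0}"
      using 2 by (auto simp: poly_sum)
    then show ?thesis using poly_roots_finite[of ?p] infinite_Ioi[of 0] finite_subset by blast
  qed
  show ?thesis
  proof (rule ccontr)
    assume "c n \<noteq> 0"
    define B where "B = {n\<in>S. c n \<noteq> 0}"
    have B: "finite B" "B \<noteq> {}" using S \<open>n \<in> S\<close> \<open>c n
        \<noteq> 0\<close> by (auto simp: B_def)
    \<comment> \<open>Among the monomials with nonzero coefficient one of least rank is taken: by
      \<open>pivot_outside\<close> no other one of its degree and parity reaches the exponent
      \<open>piv m\<close>.\<close>
    then obtain m where m: "m \<in> B" "\<And>n. n \<in> B \<Longrightarrow> rank m \<le> rank n"
      using ex_min_if_finite[of "rank ` B"] by (auto simp: not_less)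
    let ?C = "S' (dg m) (even (par m))"
    have "0 = coeff (\<Sum>n\<in>?C. smult (c n) (Q n)) (piv m)" unfolding 3 by simp
    also have "\<dots> = (\<Sum>n\<in>?C. c n * coeff (Q n) (piv m))" by (simp add: coeff_sum)
    also have "\<dots> = (\<Sum>n\<in>{m}. c n * coeff (Q n) (piv m))"
    proof (rule sum.mono_neutral_right)
      show "\<forall>i\<in>?C - {m}. c i * coeff (Q i) (piv m) = 0"
      proof
        fix i assume i: "i \<in> ?C - {m}"
        show "c i * coeff (Q i) (piv m) = 0"
        proof (cases "i \<in> B")
          case True
          have "piv m < lo i \<or> hi i < piv m"
            using i True m S by (intro pivot_outside) (auto simp: S'_def B_def)
          then show ?thesis using Q_outside by simp
        next
          case False
          then show ?thesis using i by (auto simp: B_def S'_def)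
        qed
      qed
    qed (use m S in \<open>auto simp: S'_def B_def\<close>)
    finally show False using Q_pivot[of m] m by (auto simp: B_def)
  qed
qed

end

text \<open>
  The generators in terms of the cluster \<open>{w, x\<^sub>2, x\<^sub>3}\<close> with \<open>w
      = x\<^sub>1'\<close>, written such that only \<open>w\<close>,
  \<open>x\<^sub>2\<close> and \<open>x\<^sub>3\<close> occur in denominators.
\<close>

definition mgen :: "'a::field \<Rightarrow> 'a \<Rightarrow> 'a \<Rightarrow> 'a \<Rightarrow> 'a \<Rightarrow> 'a \<Rightarrow> gen_sym \<Rightarrow> 'a" where
  "mgen w x2 x3 f1 f2 f3 = (
    let x1 = (f1 * x2\<^sup>2 + x3\<^sup>2) / w;
        l1 = (x2\<^sup>2 + f2 * f3 * x3\<^sup>2 + f3 * x1\<^sup>2) / (x2 * x3);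
        l2 = (w + f1 * f3 * x1) / x3;
        l3 = (x1 + f2 * w) / x2
    in case_gen_sym x1 x2 x3 l1 l2 l3
      ((w * (x2\<^sup>2 + f1 * (f2 * f3)\<^sup>2 * x3\<^sup>2) + 2 * f1 * f3 * x1 * (x2\<^sup>2
          + f2 * f3 * x3\<^sup>2)
         + f1 * f3\<^sup>2 * x1 ^ 3) / (x2 * x3)\<^sup>2)
      ((f2 * l2\<^sup>2 + (f1 * f2 * f3 - 1)\<^sup>2) / x2)
      ((f3 * l3\<^sup>2 + (f1 * f2 * f3 - 1)\<^sup>2) / x3))"

context real_point
begin

lemma mgen_at:
  assumes l: "l > 0" and s: "s \<in> {1, -1}" and g: "g = mgen (l * w) l (s * t * l) (- t\<^sup>2) f2 f3"
  shows "g X2 = l" "g X3 = s * (t * l)" "g L1 = s * (- a / t)" "g L2 = s * (w / t)" "g L3 = f2 * w"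
    "g Y1 = u * w / l" "g Y2 = poly A w / l" "g Y3 = s * (poly q w / (t * l))"
proof -
  have s2: "s\<^sup>2 = 1" "s * s = 1" "s \<noteq> 0" "1 / s = s" using s by auto
  have x1: "- t\<^sup>2 * l\<^sup>2 + (s * t * l)\<^sup>2 = 0"
    by (simp add: power_mult_distrib s2)
  have l2: "w * l / (s * t * l) = s * (w / t)" using s l t by (auto simp: field_simps)
  show "g X2 = l" "g X3 = s * (t * l)" unfolding g mgen_def Let_def by simp_all
  show "g L3 = f2 * w" unfolding g mgen_def Let_def x1 using l by simp
  show L2: "g L2 = s * (w / t)" unfolding g mgen_def Let_def x1 using l2 by (simp add: mult_ac)
  show "g L1 = s * (- a / t)"
    unfolding g mgen_def Let_def x1 a_def using l t s
    by (auto simp: field_simps power2_eq_square)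
  show "g Y1 = u * w / l"
    unfolding g mgen_def Let_def x1 u_def using l t s
    by (auto simp: field_simps power2_eq_square power4_eq_xxxx)
  show "g Y2 = poly A w / l"
    unfolding g mgen_def Let_def x1 using l t s
    by (auto simp: field_simps power2_eq_square A_def a_def)
  show "g Y3 = s * (poly q w / (t * l))"
    unfolding g mgen_def Let_def x1 using l t s
    by (auto simp: field_simps power2_eq_square q_def a_def)
qed

lemma nmon_at:
  assumes l: "l > 0" and s: "s \<in> {1, -1}"
  shows "nmon (mgen (l * w) l (s * t * l) (- t\<^sup>2) f2 f3) n = l powi dg n * s ^ par n * poly (Q n) w"
proof -
  have lp: "l powi int k = l ^ k" for k by simp
  note at = mgen_at[OF l s refl]
  show ?thesis
  proof (cases n)
    case (XX x e b)
    then show ?thesis using l t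
      by (simp only: nmon.simps at dg.simps par.simps Q.simps poly_monom lp)
        (simp add: power_mult_distrib power_add power_divide mult_ac)
  next
    case (LL b)
    then show ?thesis using l t
      by (simp only: nmon.simps at dg.simps par.simps Q.simps poly_monom)
        (simp add: power_mult_distrib power_divide mult_ac)
  next
    case (YY i j e b)
    then show ?thesis using l t
      by (simp only: nmon.simps at dg.simps par.simps Q.simps poly_monom poly_mult poly_power
          power_int_minus lp)
        (simp add: power_mult_distrib power_add power_divide divide_simps)
  next
    case (YL1 d)
    then show ?thesis using l t
      by (simp only: nmon.simps at dg.simps par.simps Q.simps poly_monom power_int_minus lp)
        (simp add: power_mult_distrib power_divide divide_simps)
  next
    case (YL3 d)
    then show ?thesis using l t
      by (simp only: nmon.simps at dg.simps par.simps Q.simps poly_monom power_int_minus lp)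
        (simp add: power_mult_distrib power_divide divide_simps)
  qed
qed

end

section \<open>Independence over the coefficient ring\<close>

instance frozen_sym :: finite
proof
  have "(UNIV :: frozen_sym set) \<subseteq> {F1, F2, F3}"
    using frozen_sym.exhaust by blast
  then show "finite (UNIV :: frozen_sym set)" by (rule finite_subset) simp
qed

lemma normal_independent:
  fixes c :: "nform \<Rightarrow> coeff_ring"
  assumes S: "finite S" "\<And>n. n \<in> S \<Longrightarrow> valid n"
    and zero: "\<And>w x2 x3 f1 f2 f3 :: real. w \<noteq> 0 \<Longrightarrow> x2
        \<noteq> 0 \<Longrightarrow> x3 \<noteq> 0 \<Longrightarrow> f1 \<noteq> 0
        \<Longrightarrow> f2 \<noteq> 0 \<Longrightarrow> f3 \<noteq> 0 \<Longrightarrow>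
      f1 * x2\<^sup>2 + x3\<^sup>2 = 0 \<Longrightarrow>
      (\<Sum>n\<in>S. laurent_eval (case_frozen_sym f1 f2 f3) (c n) * nmon (mgen w x2 x3 f1 f2 f3) n) = 0"
    and "n \<in> S"
  shows "c n = 0"
\<comment> \<open>Negative f1 gives the divisor real points with t^2 = -f1, and the bounds by 1 give
  f2 * f3 * t^2 < 1 as \<open>real_point\<close> demands.\<close>
proof (rule laurent_poly_zeroI[where T = "case_frozen_sym {-1<..<0} {0<..<1} {0<..<1}"])
  fix v :: frozen_sym
  show "infinite (case_frozen_sym {-1<..<0} {0<..<1} {0<..<1::real} v)"
      "0 \<notin> case_frozen_sym {-1<..<0} {0<..<1} {0<..<1::real} v"
    by (cases v; simp)+
next
  fix z :: "frozen_sym \<Rightarrow> real"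
  assume "\<And>v. z v \<in> case_frozen_sym {-1<..<0} {0<..<1} {0<..<1} v"
  from this[of F1] this[of F2] this[of F3]
  have z: "-1 < z F1" "z F1 < 0" "0 < z F2" "z F2 < 1" "0 < z F3" "z F3 < 1" by simp_all
  have zz: "case_frozen_sym (z F1) (z F2) (z F3) = z" by (rule ext) (simp split: frozen_sym.split)
  define t where "t = sqrt (- z F1)"
  have t: "t > 0" "t\<^sup>2 = - z F1" using z by (simp_all add: t_def)
  interpret rp: real_point t "z F2" "z F3"
  proof
    have "z F2 * z F3 * t\<^sup>2 < 1 * 1 * 1"
      unfolding t(2) using z by (intro mult_strict_mono) auto
    then show "z F2 * z F3 * t\<^sup>2 < 1" by simp
  qed (use t z in auto)
  show "laurent_eval z (c n) = 0"
  proof (rule rp.independent[OF S _ \<open>n \<in> S\<close>])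
    fix l w s :: real assume lw: "l > 0" "w > 0" and s: "s \<in> {1, -1}"
    have "(\<Sum>n\<in>S. laurent_eval (case_frozen_sym (z F1) (z F2) (z F3)) (c n) *
        nmon (mgen (l * w) l (s * t * l) (z F1) (z F2) (z F3)) n) = 0"
    proof (rule zero)
      have "s\<^sup>2 = 1" using s by auto
      then show "z F1 * l\<^sup>2 + (s * t * l)\<^sup>2 = 0" by (simp add: power_mult_distrib t(2))
    qed (use lw s t z in auto)
    then show "(\<Sum>n\<in>S. laurent_eval z (c n) * (l powi dg n * s ^ par n * poly (rp.Q n) w)) = 0"
      unfolding zz using rp.nmon_at[OF lw(1) s, of w] by (simp add: t(2))
  qed
qed

subsection \<open>The presented ring\<close>

definition coef :: "coeff_ring \<Rightarrow> gen_ring" where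
  "coef c = Poly_Mapping.single 0 c"

definition frozen_inv :: "frozen_sym \<Rightarrow> gen_ring" where
  "frozen_inv i = coef (Poly_Mapping.single (Poly_Mapping.single i (- 1)) 1)"

abbreviation (input) rel_ideal :: "gen_ring set" where
  "rel_ideal \<equiv> ideal_generated relations"

lemma coef_hom: "coef (a + b) = coef a + coef b" "coef (a * b) = coef a * coef b"
  "coef 0 = 0" "coef 1 = 1" "coef (- a) = - coef a"
  by (simp_all add: coef_def single_add mult_single single_uminus)

lemma module_mult: "module ((*) :: 'a::comm_ring_1 \<Rightarrow> 'a \<Rightarrow> 'a)"
  by unfold_locales (simp_all add: algebra_simps)

lemma ideal_add: "p \<in> ideal_generated S
    \<Longrightarrow> q \<in> ideal_generated S \<Longrightarrow> p + q \<in> ideal_generated S"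
  and ideal_mult: "p \<in> ideal_generated S \<Longrightarrow> r * p \<in> ideal_generated S"
  and ideal_zero: "0 \<in> ideal_generated S"
  and ideal_superset: "S \<subseteq> ideal_generated S"
  unfolding ideal_generated_def
  by (rule module.span_add[OF module_mult] module.span_scale[OF module_mult]
      module.span_zero[OF module_mult] module.span_superset[OF module_mult]; assumption)+

definition normal_span :: "gen_ring set" where
  "normal_span = {\<Sum>n\<in>S. coef (c n)
      * nmon gen_var n | S c. finite S \<and> (\<forall>n\<in>S. valid n)}"

text \<open>Being inductive, this admits only finite expansions in powers of x1, so an argument that
  strips one power at a time is an induction and no intersection of ideals has to be
  controlled.\<close>

inductive_set expansions :: "gen_ring set" where
  ideal: "i \<in> rel_ideal \<Longrightarrow> i \<in> expansions"
| step: "n \<in> normal_span \<Longrightarrow> p \<in> expansions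
    \<Longrightarrow> i \<in> rel_ideal \<Longrightarrow> n + gen_var X1 * p + i \<in> expansions"

lemma normal_spanI:
  assumes "p = (\<Sum>n\<in>S. coef (c n) * nmon gen_var n)" "finite S"
      "\<And>n. n \<in> S \<Longrightarrow> valid n"
  shows "p \<in> normal_span"
  unfolding normal_span_def
  by (rule CollectI, rule exI[of _ S], rule exI[of _ c]) (intro conjI ballI assms)

lemma normal_span_add:
  assumes "p \<in> normal_span" "q \<in> normal_span"
  shows "p + q \<in> normal_span"
proof -
  obtain S c where p: "p = (\<Sum>n\<in>S. coef (c n) * nmon gen_var n)" "finite S"
      "\<forall>n\<in>S. valid n"
    using assms(1) by (auto simp: normal_span_def)
  obtain S' c' where q: "q = (\<Sum>n\<in>S'. coef (c' n) * nmon gen_var n)" "finite S'"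
      "\<forall>n\<in>S'. valid n"
    using assms(2) by (auto simp: normal_span_def)
  have 1: "p = (\<Sum>n\<in>S \<union> S'. coef (if n \<in> S then c n else 0) * nmon gen_var n)"
    unfolding p by (rule sum.mono_neutral_cong_left) (use p q in \<open>auto simp: coef_hom\<close>)
  have 2: "q = (\<Sum>n\<in>S \<union> S'. coef (if n \<in> S' then c' n else 0) * nmon gen_var n)"
    unfolding q by (rule sum.mono_neutral_cong_left) (use p q in \<open>auto simp: coef_hom\<close>)
  have "p + q = (\<Sum>n\<in>S \<union> S'. coef ((if n \<in> S then c n else 0)
      + (if n \<in> S' then c' n else 0)) * nmon gen_var n)"
    by (subst 1, subst 2) (simp add: coef_hom distrib_right sum.distrib)
  then show ?thesis by (rule normal_spanI) (use p(2,3) q(2,3) in auto)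
qed

lemma normal_span_coef:
  assumes "p \<in> normal_span"
  shows "coef a * p \<in> normal_span"
proof -
  obtain S c where p: "p = (\<Sum>n\<in>S. coef (c n) * nmon gen_var n)" "finite S"
      "\<forall>n\<in>S. valid n"
    using assms by (auto simp: normal_span_def)
  have "coef a * p = (\<Sum>n\<in>S. coef (a * c n) * nmon gen_var n)"
    unfolding p(1) by (simp only: sum_distrib_left coef_hom mult.assoc)
  then show ?thesis by (rule normal_spanI) (use p(2,3) in auto)
qed

lemma normal_span_base:
  assumes "valid n"
  shows "nmon gen_var n \<in> normal_span"
proof -
  have "nmon gen_var n = (\<Sum>m\<in>{n}. coef 1 * nmon gen_var m)" by (simp add: coef_hom(4))
  then show ?thesis by (rule normal_spanI) (use assms in auto)
qed

lemma normal_span_zero: "0 \<in> normal_span"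
  by (rule normal_spanI[where S = "{}"]) simp_all

lemma expansions_cong:
  assumes "q \<in> expansions" "p - q \<in> rel_ideal"
  shows "p \<in> expansions"
  using assms(1)
proof cases
  case ideal
  then show ?thesis using ideal_add[OF assms(2), of q] by (simp add: expansions.ideal)
next
  case (step n p' i)
  have "n + gen_var X1 * p' + (i + (p - q)) \<in> expansions"
    using step(2-4) assms(2) by (intro expansions.step ideal_add)
  also have "n + gen_var X1 * p' + (i + (p - q)) = q + (p - q)"
    unfolding step(1) by (rule add.assoc[symmetric])
  finally show ?thesis by simp
qed

lemma expansions_add: "p \<in> expansions \<Longrightarrow> q \<in> expansions \<Longrightarrow> p
    + q \<in> expansions"
proof (induction p arbitrary: q rule: expansions.induct)
  case (ideal i)
  show ?case using expansions_cong[OF ideal(2), of "i + q"] ideal(1) by simp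
next
  case (step n p i)
  show ?case using \<open>q \<in> expansions\<close>
  proof cases
    case q: ideal
    show ?thesis
      using expansions.step[OF step.hyps(1,2) ideal_add[OF step.hyps(3) q]] by (simp add: add.assoc)
  next
    case q: (step m p' j)
    have "(n + m) + gen_var X1 * (p + p') + (i + j) \<in> expansions"
      using step.hyps step.IH[OF q(3)] q(2,4) by (intro expansions.step normal_span_add ideal_add)
    also have "(n + m) + gen_var X1 * (p + p') + (i + j) = (n + gen_var X1 * p + i) + q"
      unfolding q(1) by (simp only: distrib_left add_ac)
    finally show ?thesis .
  qed
qed

lemma expansions_coef: "p \<in> expansions \<Longrightarrow> coef a * p \<in> expansions"
proof (induction p rule: expansions.induct)
  case (ideal i)
  then show ?case by (intro expansions.ideal ideal_mult)
next
  case (step n p i)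
  have "coef a * n + gen_var X1 * (coef a * p) + coef a * i \<in> expansions"
    using step by (intro expansions.step normal_span_coef ideal_mult)
  also have "coef a * n + gen_var X1 * (coef a * p) + coef a * i = coef a * (n + gen_var X1 * p + i)"
    by (simp only: distrib_left mult_ac)
  finally show ?case .
qed

lemma expansions_normal_span: "n \<in> normal_span \<Longrightarrow> n \<in> expansions"
  using expansions.step[OF _ expansions.ideal[OF ideal_zero] ideal_zero] by simp

lemma expansions_X1: "p \<in> expansions \<Longrightarrow> gen_var X1 * p \<in> expansions"
  using expansions.step[OF normal_span_zero _ ideal_zero] by simp

lemma frozen_var_eq: "frozen_var i = coef (Poly_Mapping.single (Poly_Mapping.single i 1) 1)"
  by (simp add: frozen_var_def coef_def)

lemma frozen_units: "frozen_var i * frozen_inv i = 1"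
  by (simp add: frozen_var_eq frozen_inv_def mult_single flip: coef_hom single_add)

lemma normal_nform:
  assumes "normal a2 a3 b1 b2 b3 c1 c2 c3"
  shows "\<exists>n. valid n \<and> nmon g n = g X2 ^ a2 * g X3 ^ a3 * g L1 ^ b1 * g L2 ^ b2 * g L3 ^ b3
    * g Y1 ^ c1 * g Y2 ^ c2 * g Y3 ^ c3"
  using assms unfolding normal_def
proof (elim disjE conjE)
  assume "a3 \<le> 1" "b1 = 0" "b3 = 0" "c1 = 0" "c2 = 0" "c3 = 0"
  then show ?thesis by (intro exI[of _ "XX a2 (a3 = 1) b2"]) (cases a3; simp)
next
  assume "a2 = 0" "a3 = 0" "b1 = 0" "b3 = 1" "c1 = 0" "c2 = 0" "c3 = 0"
  then show ?thesis
    \<comment> \<open>The factor l3 alone is \<open>YL3 0\<close>, because \<open>LL b\<close>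
      carries l2 to the power b + 1.\<close>
    by (intro exI[of _ "if b2 = 0 then YL3 0 else LL (b2 - 1)"]) (cases b2; simp)
next
  assume "a2 = 0" "a3 = 0" "b1 = 0" "b3 = 0" "c3 \<le> 1" "c1 = 0"
  then show ?thesis
    \<comment> \<open>A pure power of l2 is listed under \<open>XX\<close>, since \<open>YY\<close>
      must contain some y.\<close>
    by (intro exI[of _ "if c1 + c2 + c3 = 0 then XX 0 False b2 else YY c1 c2 (c3 = 1) b2"])
      (cases c3; auto)
next
  assume "a2 = 0" "a3 = 0" "b1 = 0" "b3 = 0" "c3 \<le> 1" "b2 \<le> 1"
  then show ?thesis
    by (intro exI[of _ "if c1 + c2 + c3 = 0 then XX 0 False b2 else YY c1 c2 (c3 = 1) b2"])
      (cases c3; auto)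
next
  assume "a2 = 0" "a3 = 0" "b1 = 1" "b2 = 0" "b3 = 0" "c2 = 0" "c3 = 0"
  then show ?thesis by (intro exI[of _ "YL1 c1"]) simp
next
  assume "a2 = 0" "a3 = 0" "b1 = 0" "b2 = 0" "b3 = 1" "c2 = 0" "c3 = 0"
  then show ?thesis by (intro exI[of _ "YL3 c1"]) simp
qed

text \<open>Multiplication by x1 merely shifts an expansion by one order, which is why
  \<open>expansions\<close> may take the role of T with x1 among the scalars.\<close>

interpretation gen: markov_span rel_ideal "frozen_var F1" "frozen_var F2" "frozen_var F3"
  "frozen_inv F1" "frozen_inv F2" "frozen_inv F3" "gen_var X1" "gen_var X2" "gen_var X3"
  "gen_var L1" "gen_var L2" "gen_var L3" "gen_var Y1" "gen_var Y2" "gen_var Y3" expansions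
proof
  show "relations_in (frozen_var F1) (frozen_var F2) (frozen_var F3) (gen_var X1) (gen_var X2)
     (gen_var X3) (gen_var L1) (gen_var L2) (gen_var L3) (gen_var Y1) (gen_var Y2) (gen_var Y3)
     \<subseteq> rel_ideal"
    using ideal_superset[of relations] by (simp add: relations_def)
  show "- p \<in> expansions" if "p \<in> expansions" for p
    using expansions_coef[OF that, of "- 1"] by (simp add: coef_hom)
  show "c * p \<in> expansions" if "c \<in> {frozen_var F1, frozen_var F2, frozen_var F3,
    frozen_inv F1, frozen_inv F2, frozen_inv F3, gen_var X1}" "p \<in> expansions" for c p
    using that by (auto simp: frozen_var_eq frozen_inv_def intro: expansions_coef expansions_X1)
  show "gen_var X2 ^ a2 * gen_var X3 ^ a3 * gen_var L1 ^ b1 * gen_var L2 ^ b2 * gen_var L3 ^ b3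
      * gen_var Y1 ^ c1 * gen_var Y2 ^ c2 * gen_var Y3 ^ c3 \<in> expansions"
    if "normal a2 a3 b1 b2 b3 c1 c2 c3" for a2 a3 b1 b2 b3 c1 c2 c3
    using normal_nform[OF that, of gen_var] normal_span_base expansions_normal_span by metis
qed (simp_all add: ideal_add ideal_mult frozen_units expansions_add expansions_cong)

lemma UNIV_gen_sym: "UNIV = {X1, X2, X3, L1, L2, L3, Y1, Y2, Y3}"
  using gen_sym.exhaust by blast

lemma gen_var_power: "gen_var v ^ k = Poly_Mapping.single (Poly_Mapping.single v k) 1"
  by (induction k) (simp_all add: gen_var_def mult_single flip: single_add)

lemma monomial_eq_prod:
  "Poly_Mapping.single e 1 = (\<Prod>v\<in>Poly_Mapping.keys e. gen_var v ^ Poly_Mapping.lookup e v)"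
proof -
  have "(\<Prod>v\<in>A. gen_var v ^ h v)
      = Poly_Mapping.single (\<Sum>v\<in>A. Poly_Mapping.single v (h v)) 1"
    if "finite A" for A h
    using that by induction (simp_all add: gen_var_power mult_single)
  then show ?thesis using poly_mapping_eq_sum_single[of e] by simp
qed

lemma expansions_X1_power: "p \<in> expansions \<Longrightarrow> gen_var X1 ^ k * p \<in> expansions"
proof (induction k)
  case (Suc k)
  then show ?case using expansions_X1[of "gen_var X1 ^ k * p"] by (simp only: power_Suc mult.assoc)
qed simp

lemma monomial_in_expansions: "Poly_Mapping.single e 1 \<in> expansions"
proof -
  let ?l = "Poly_Mapping.lookup e"
  have "(\<Prod>v\<in>Poly_Mapping.keys e. gen_var v ^ ?l v)
      = (\<Prod>v\<in>{X1, X2, X3, L1, L2, L3, Y1, Y2, Y3}. gen_var v ^ ?l v)"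
  proof (rule prod.mono_neutral_left)
    show "Poly_Mapping.keys e \<subseteq> {X1, X2, X3, L1, L2, L3, Y1, Y2, Y3}"
      unfolding UNIV_gen_sym[symmetric] by (rule subset_UNIV)
  qed (auto simp: in_keys_iff)
  also have "\<dots> = gen_var X1 ^ ?l X1
      * gen.M (?l X2) (?l X3) (?l L1) (?l L2) (?l L3) (?l Y1) (?l Y2) (?l Y3)"
    unfolding gen.M_def by (simp only: prod.insert finite.intros gen_sym.distinct insert_iff empty_iff
      simp_thms not_False_eq_True prod.empty mult_1_left mult_1_right mult_ac)
  finally show ?thesis
    unfolding monomial_eq_prod using expansions_X1_power[OF gen.M_in_T] by simp
qed

lemma in_expansions: "p \<in> expansions"
proof -
  have 1: "Poly_Mapping.single e c \<in> expansions" for e and c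
  proof -
    have "Poly_Mapping.single e c = coef c * Poly_Mapping.single e 1"
      by (simp add: coef_def mult_single)
    then show ?thesis using expansions_coef[OF monomial_in_expansions] by simp
  qed
  have "(\<Sum>e\<in>A. Poly_Mapping.single e (h e)) \<in> expansions" if "finite A"
    for A :: "(gen_sym \<Rightarrow>\<^sub>0 nat) set" and h
    using that
  proof induction
    case empty
    show ?case by (simp add: expansions.ideal ideal_zero)
  next
    case (insert e A)
    then show ?case using expansions_add[OF 1] by simp
  qed
  then have "(\<Sum>e\<in>Poly_Mapping.keys p. Poly_Mapping.single e (Poly_Mapping.lookup p e)) \<in> expansions"
    by simp
  then show ?thesis using poly_mapping_eq_sum_single[of p] by (rule ssubst[rotated])
qed

text \<open>
  Evaluation at the real points
      of the cluster \<open>{x\<^sub>1', x\<^sub>2, x\<^sub>3}\<close>; the divisor \<open>x\<^sub>1 = 0\<close> is the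
  hypersurface \<open>f1 * x2\<^sup>2 + x3\<^sup>2 = 0\<close> there.
\<close>

definition real_eval ::
    "real \<Rightarrow> real \<Rightarrow> real \<Rightarrow> real \<Rightarrow> real \<Rightarrow> real \<Rightarrow> gen_ring \<Rightarrow> real" where
  "real_eval w x2 x3 f1 f2 f3 = presentation_map (case_frozen_sym f1 f2 f3) (mgen w x2 x3 f1 f2 f3)"

lemma case_frozen_sym_nonzero:
  "f1 \<noteq> 0 \<Longrightarrow> f2 \<noteq> 0 \<Longrightarrow> f3 \<noteq> 0
      \<Longrightarrow> case_frozen_sym f1 f2 f3 v \<noteq> (0::'a::zero)"
  by (cases v) simp_all

lemma presentation_map_nmon:
  assumes "\<And>v. z v \<noteq> 0"
  shows "presentation_map z g (coef c * nmon gen_var n) = laurent_eval z c * nmon g n"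
proof -
  have "presentation_map z g (coef c) = laurent_eval z c"
    by (simp add: coef_def presentation_map_hom[OF assms])
  moreover have "presentation_map z g (nmon gen_var n) = nmon g n"
    by (cases n) (simp_all add: presentation_map_hom[OF assms] presentation_map_vars[OF assms])
  ultimately show ?thesis by (simp add: presentation_map_hom[OF assms])
qed

lemma normal_span_zeroI:
  assumes "p \<in> normal_span"
    and zero: "\<And>w x2 x3 f1 f2 f3. w \<noteq> 0 \<Longrightarrow> x2 \<noteq> 0
        \<Longrightarrow> x3 \<noteq> 0 \<Longrightarrow> f1 \<noteq> 0
        \<Longrightarrow> f2 \<noteq> 0 \<Longrightarrow> f3 \<noteq> 0 \<Longrightarrow>
      f1 * x2\<^sup>2 + x3\<^sup>2 = 0 \<Longrightarrow> real_eval w x2 x3 f1 f2 f3 p = 0"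
  shows "p = 0"
proof -
  obtain S c where p: "p = (\<Sum>n\<in>S. coef (c n) * nmon gen_var n)" "finite S"
      "\<forall>n\<in>S. valid n"
    using assms(1) by (auto simp: normal_span_def)
  have "c n = 0" if "n \<in> S" for n
  proof (rule normal_independent[OF p(2) _ _ that])
    fix w x2 x3 f1 f2 f3 :: real
    assume nz: "w \<noteq> 0" "x2 \<noteq> 0" "x3 \<noteq> 0" "f1 \<noteq> 0" "f2
        \<noteq> 0" "f3 \<noteq> 0" "f1 * x2\<^sup>2 + x3\<^sup>2 = 0"
    note z = case_frozen_sym_nonzero[OF nz(4-6)]
    show "(\<Sum>n\<in>S. laurent_eval (case_frozen_sym f1 f2 f3) (c n)
        * nmon (mgen w x2 x3 f1 f2 f3) n) = 0"
      using zero[OF nz] unfolding p(1)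
      by (simp only: real_eval_def presentation_map_hom(9)[OF z] presentation_map_nmon[OF z])
  qed (use p in auto)
  then show ?thesis unfolding p(1) by (simp add: coef_hom)
qed

lemma real_eval_hom:
  assumes "f1 \<noteq> 0" "f2 \<noteq> 0" "f3 \<noteq> 0"
  shows "real_eval w x2 x3 f1 f2 f3 (p + q) = real_eval w x2 x3 f1 f2 f3 p + real_eval w x2 x3 f1 f2 f3 q"
    "real_eval w x2 x3 f1 f2 f3 (p * q) = real_eval w x2 x3 f1 f2 f3 p * real_eval w x2 x3 f1 f2 f3 q"
    "real_eval w x2 x3 f1 f2 f3 (gen_var X1) = (f1 * x2\<^sup>2 + x3\<^sup>2) / w"
  using case_frozen_sym_nonzero[OF assms]
  by (simp_all add: real_eval_def presentation_map_hom presentation_map_vars mgen_def Let_def)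

text \<open>On the divisor the multiple of x1 and the element of the ideal contribute nothing, so
  the hypothesis there concerns only the leading part of the expansion, which is zero by
  independence.\<close>

lemma divisible_by_X1:
  assumes ideal0: "\<And>i w x2 x3 f1 f2 f3. i \<in> rel_ideal
      \<Longrightarrow> w \<noteq> 0 \<Longrightarrow> x2 \<noteq> 0
      \<Longrightarrow> x3 \<noteq> 0 \<Longrightarrow>
      f1 \<noteq> 0 \<Longrightarrow> f2 \<noteq> 0 \<Longrightarrow> f3 \<noteq> 0
          \<Longrightarrow> real_eval w x2 x3 f1 f2 f3 i = 0"
    and zero: "\<And>w x2 x3 f1 f2 f3. w \<noteq> 0 \<Longrightarrow> x2 \<noteq> 0
        \<Longrightarrow> x3 \<noteq> 0 \<Longrightarrow> f1 \<noteq> 0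
        \<Longrightarrow> f2 \<noteq> 0 \<Longrightarrow> f3 \<noteq> 0 \<Longrightarrow>
      f1 * x2\<^sup>2 + x3\<^sup>2 = 0 \<Longrightarrow> real_eval w x2 x3 f1 f2 f3 p = 0"
  shows "\<exists>q. p - gen_var X1 * q \<in> rel_ideal"
  using in_expansions[of p]
proof cases
  case ideal
  then show ?thesis by (intro exI[of _ 0]) simp
next
  case (step n q i)
  have "n = 0"
  proof (rule normal_span_zeroI[OF step(2)])
    fix w x2 x3 f1 f2 f3 :: real
    assume nz: "w \<noteq> 0" "x2 \<noteq> 0" "x3 \<noteq> 0" "f1 \<noteq> 0" "f2
        \<noteq> 0" "f3 \<noteq> 0" "f1 * x2\<^sup>2 + x3\<^sup>2 = 0"
    show "real_eval w x2 x3 f1 f2 f3 n = 0"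
      using zero[OF nz] ideal0[OF step(4) nz(1-6)] nz by (simp add: step(1) real_eval_hom)
  qed
  then show ?thesis using step by (intro exI[of _ q]) simp
qed

text \<open>Once the leading part is known to vanish, \<phi> of x1 can be cancelled in the field, so
  the rest of the expansion is again in the kernel.\<close>

lemma kernel_subset_ideal:
  assumes ideal0: "\<And>i. i \<in> rel_ideal \<Longrightarrow> \<phi> i = 0"
    and hom: "\<And>p q. \<phi> (p + q) = \<phi> p + \<phi> q" "\<And>p q. \<phi> (p * q)
        = \<phi> p * \<phi> q"
    and X1: "\<phi> (gen_var X1) \<noteq> (0::'a::field)"
    and eval: "\<And>p w x2 x3 f1 f2 f3. \<phi> p = 0 \<Longrightarrow> w
        \<noteq> 0 \<Longrightarrow> x2 \<noteq> 0 \<Longrightarrow> x3 \<noteq> 0 \<Longrightarrow>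
      f1 \<noteq> 0 \<Longrightarrow> f2 \<noteq> 0 \<Longrightarrow> f3 \<noteq> 0
          \<Longrightarrow> real_eval w x2 x3 f1 f2 f3 p = 0"
    and "\<phi> p = 0"
  shows "p \<in> rel_ideal"
  using in_expansions[of p] \<open>\<phi> p = 0\<close>
proof (induction p rule: expansions.induct)
  case (step n p i)
  have "n = 0"
  proof (rule normal_span_zeroI[OF step.hyps(1)])
    fix w x2 x3 f1 f2 f3 :: real
    assume nz: "w \<noteq> 0" "x2 \<noteq> 0" "x3 \<noteq> 0" "f1 \<noteq> 0" "f2
        \<noteq> 0" "f3 \<noteq> 0" "f1 * x2\<^sup>2 + x3\<^sup>2 = 0"
    show "real_eval w x2 x3 f1 f2 f3 n = 0"
      using eval[OF step.prems nz(1-6)] eval[OF ideal0[OF step.hyps(3)] nz(1-6)] nz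
      by (simp add: real_eval_hom)
  qed
  then have "\<phi> p = 0"
    using step.prems ideal0[OF step.hyps(3)] X1 by (simp add: hom)
  then show ?case using step \<open>n = 0\<close> by (simp add: ideal_add ideal_mult)
qed

text \<open>One third of the relations; the others follow by rotating the indices.\<close>

lemma relations_aux:
  fixes x1 :: "'a::field"
  assumes nz: "x1 \<noteq> 0" "x2 \<noteq> 0" "x3 \<noteq> 0"
    and \<alpha>: "\<alpha> = f1 * f2 * f3 - 1"
    and l1: "x2 * x3 * l1 = x2\<^sup>2 + f2 * f3 * x3\<^sup>2 + f3 * x1\<^sup>2"
    and l2: "x3 * x1 * l2 = x3\<^sup>2 + f3 * f1 * x1\<^sup>2 + f1 * x2\<^sup>2"
    and l3: "x1 * x2 * l3 = x1\<^sup>2 + f1 * f2 * x2\<^sup>2 + f2 * x3\<^sup>2"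
    and y1: "x1 * y1 = f1 * l1\<^sup>2 + \<alpha>\<^sup>2"
    and y2: "x2 * y2 = f2 * l2\<^sup>2 + \<alpha>\<^sup>2"
    and y3: "x3 * y3 = f3 * l3\<^sup>2 + \<alpha>\<^sup>2"
  shows "f2 * x3 * l2 - x2 * l3 = \<alpha> * x1"
    "x1 * l2 * l3 = f1 * f2 * x2 * l2 + f1 * x1 * l1 + x3 * l3"
    "l1 * l2 * l3 - f1 * l1\<^sup>2 - f2 * l2\<^sup>2 - f3 * l3\<^sup>2 = \<alpha>\<^sup>2"
    "x1 * y2 = f1 * f2 * l1 * l2 - \<alpha> * l3"
    "x1 * y3 = l1 * l3 + f2 * \<alpha> * l2"
    "f1 * l1 * y3 - l3 * y1 = \<alpha> * y2"
    "y1 * l2 * l3 = y2 * l2 + f1 * y1 * l1 + f1 * f3 * y3 * l3"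
    "y1 * y2 * l3 = f1 * f2 * y1\<^sup>2 + y2\<^sup>2 + f1 * y3\<^sup>2"
proof -
  have l1': "l1 = (x2\<^sup>2 + f2 * f3 * x3\<^sup>2 + f3 * x1\<^sup>2) / (x2 * x3)"
    and l2': "l2 = (x3\<^sup>2 + f3 * f1 * x1\<^sup>2 + f1 * x2\<^sup>2) / (x3 * x1)"
    and l3': "l3 = (x1\<^sup>2 + f1 * f2 * x2\<^sup>2 + f2 * x3\<^sup>2) / (x1 * x2)"
    using l1 l2 l3 nz by (simp_all add: field_simps)
  show A1: "f2 * x3 * l2 - x2 * l3 = \<alpha> * x1"
    unfolding l2' l3' \<alpha> using nz by (simp add: field_simps power2_eq_square)
  have A2: "f3 * x1 * l3 - x3 * l1 = \<alpha> * x2"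
    unfolding l1' l3' \<alpha> using nz by (simp add: field_simps power2_eq_square)
  have A3: "f1 * x2 * l1 - x1 * l2 = \<alpha> * x3"
    unfolding l2' l1' \<alpha> using nz by (simp add: field_simps power2_eq_square)
  show C1: "x1 * l2 * l3 = f1 * f2 * x2 * l2 + f1 * x1 * l1 + x3 * l3"
    unfolding l1' l2' l3' \<alpha> using nz by (simp add: field_simps power2_eq_square)
  \<comment> \<open>From here on each identity is first multiplied by a nonzero x-variable, which
    makes it a combination of those already known, and then that variable is cancelled.\<close>
  have "x1 * (l1 * l2 * l3 - f1 * l1\<^sup>2 - f2 * l2\<^sup>2 - f3 * l3\<^sup>2 - \<alpha>\<^sup>2) = 0"
    using C1 A1 A2 A3 by algebra
  then show S: "l1 * l2 * l3 - f1 * l1\<^sup>2 - f2 * l2\<^sup>2 - f3 * l3\<^sup>2 = \<alpha>\<^sup>2"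
    using nz by simp
  have "x2 * (x1 * y2 - (f1 * f2 * l1 * l2 - \<alpha> * l3)) = 0"
    using y2 A1 A3 by algebra
  then show E12: "x1 * y2 = f1 * f2 * l1 * l2 - \<alpha> * l3"
    using nz by simp
  have "x3 * (x1 * y3 - (l1 * l3 + f2 * \<alpha> * l2)) = 0"
    using y3 A1 A2 by algebra
  then show E13: "x1 * y3 = l1 * l3 + f2 * \<alpha> * l2"
    using nz by simp
  have "x1 * (f1 * l1 * y3 - l3 * y1 - \<alpha> * y2) = 0"
    using y1 E12 E13 by algebra
  then show "f1 * l1 * y3 - l3 * y1 = \<alpha> * y2"
    using nz by simp
  have "x1 * (y1 * l2 * l3 - (y2 * l2 + f1 * y1 * l1 + f1 * f3 * y3 * l3)) = 0"
    using y1 E12 E13 S \<alpha> by algebra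
  then show "y1 * l2 * l3 = y2 * l2 + f1 * y1 * l1 + f1 * f3 * y3 * l3"
    using nz by simp
  \<comment> \<open>After multiplication by x1^2 every y occurs in a product x1 * y, hence
    everything is a polynomial in the l's and follows from the cubic relation.\<close>
  have "x1\<^sup>2 * (y1 * y2 * l3 - (f1 * f2 * y1\<^sup>2 + y2\<^sup>2 + f1 * y3\<^sup>2))
      = (x1 * y1) * (x1 * y2) * l3 - (f1 * f2 * (x1 * y1)\<^sup>2 + (x1 * y2)\<^sup>2
          + f1 * (x1 * y3)\<^sup>2)"
    by (simp add: algebra_simps power2_eq_square)
  also have "\<dots> = 0"
    unfolding y1 E12 E13 using S \<alpha> by algebra
  finally show "y1 * y2 * l3 = f1 * f2 * y1\<^sup>2 + y2\<^sup>2 + f1 * y3\<^sup>2"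
    using nz by simp
qed

subsection \<open>Laurent polynomials as real functions\<close>

definition laurent_independent :: "('v \<Rightarrow> 'a::field) \<Rightarrow> bool" where
  "laurent_independent z \<longleftrightarrow> (\<forall>v. z v
      \<noteq> 0) \<and> (\<forall>P. laurent_eval z P = 0 \<longrightarrow> P = 0)"

text \<open>A relation and not a function of \<open>a\<close>, because the Laurent polynomial behind
  \<open>a\<close> is determined only when \<open>z\<close> is independent. The functions matter
  only at points with nonzero coordinates, where they form a ring containing the inverses of the
  coordinates.\<close>

definition rep :: "('v \<Rightarrow> 'a::field) \<Rightarrow> 'a \<Rightarrow> (('v \<Rightarrow> real) \<Rightarrow> real) \<Rightarrow> bool" where
  "rep z a h \<longleftrightarrow> (\<exists>P. a
      = laurent_eval z P \<and> (\<forall>v. (\<forall>i. v i \<noteq> 0) \<longrightarrow> h v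
      = laurent_eval v P))"

lemma rep_zeroD:
  assumes "laurent_independent z" "rep z 0 h" "\<And>i. v i \<noteq> 0"
  shows "h v = 0"
  using assms unfolding laurent_independent_def rep_def by (metis laurent_eval_hom(7))

context
  fixes z :: "'v \<Rightarrow> 'a::field"
  assumes z: "\<forall>v. z v \<noteq> 0"
begin

lemma rep_add: "rep z a h \<Longrightarrow> rep z b k \<Longrightarrow> rep z (a
    + b) (\<lambda>v. h v + k v)"
  unfolding rep_def by (metis (no_types, lifting) laurent_eval_hom(1) z)

lemma rep_diff: "rep z a h \<Longrightarrow> rep z b k \<Longrightarrow> rep z (a
    - b) (\<lambda>v. h v - k v)"
  unfolding rep_def by (metis (no_types, lifting) laurent_eval_hom(2) z)

lemma rep_mult: "rep z a h \<Longrightarrow> rep z b k \<Longrightarrow> rep z (a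
    * b) (\<lambda>v. h v * k v)"
  unfolding rep_def by (metis (no_types, lifting) laurent_eval_hom(3) z)

lemma rep_of_int: "rep z (of_int n) (\<lambda>v. of_int n)"
  unfolding rep_def
  by (rule exI[of _ "Poly_Mapping.single 0 n"]) (simp add: laurent_eval_hom z)

lemma rep_numeral: "rep z 0 (\<lambda>v. 0)" "rep z 1 (\<lambda>v. 1)"
    "rep z (numeral n) (\<lambda>v. numeral n)"
  using rep_of_int[of 0] rep_of_int[of 1] rep_of_int[of "numeral n"] by simp_all

lemma rep_power: "rep z a h \<Longrightarrow> rep z (a ^ n) (\<lambda>v. h v ^ n)"
  by (induction n) (auto intro: rep_mult rep_numeral)

lemma rep_powi: "rep z (z i powi k) (\<lambda>v. v i powi k)"
  unfolding rep_def
  by (rule exI[of _ "Poly_Mapping.single (Poly_Mapping.single i k) 1"]) (simp add: laurent_eval_hom z)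

lemma rep_var: "rep z (z i) (\<lambda>v. v i)"
  using rep_powi[of i 1] by simp

lemma rep_divide: "rep z a h \<Longrightarrow> rep z (a / z i) (\<lambda>v. h v / v i)"
  using rep_mult[OF _ rep_powi[of i "- 1"], of a h] by (simp add: power_int_minus divide_inverse)

lemma rep_sum: "(\<And>i. i \<in> A \<Longrightarrow> rep z (a i) (h i))
    \<Longrightarrow> rep z (\<Sum>i\<in>A. a i) (\<lambda>v. \<Sum>i\<in>A. h i v)"
  by (induction A rule: infinite_finite_induct) (auto intro: rep_add rep_numeral)

lemma rep_prod: "(\<And>i. i \<in> A \<Longrightarrow> rep z (a i) (h i))
    \<Longrightarrow> rep z (\<Prod>i\<in>A. a i) (\<lambda>v. \<Prod>i\<in>A. h i v)"
  by (induction A rule: infinite_finite_induct) (auto intro: rep_mult rep_numeral)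

lemma rep_laurent_eval:
    "rep z (laurent_eval (\<lambda>i. z (\<iota> i)) c) (\<lambda>v. laurent_eval (\<lambda>i. v (\<iota> i)) c)"
  unfolding laurent_eval_def by (intro rep_sum rep_mult rep_prod rep_of_int rep_powi)

lemma rep_presentation_map:
  assumes "\<And>s. rep z (g s) (\<lambda>v. k v s)"
  shows "rep z (presentation_map (\<lambda>i. z (\<iota> i)) g p) (\<lambda>v. presentation_map (\<lambda>i. v (\<iota> i)) (k v) p)"
  unfolding presentation_map_def poly_eval_def
  by (intro rep_sum rep_mult rep_prod rep_power rep_laurent_eval assms)

lemma laurent_ring_rep:
  assumes "u \<in> laurent_ring (range z)"
  shows "\<exists>h. rep z u h"
proof -
  have "is_subring {u. \<exists>h. rep z u h}"
    unfolding is_subring_def using rep_numeral(2) rep_diff rep_mult by blast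
  moreover have "range z \<union> inverse ` range z \<subseteq> {u. \<exists>h. rep z u h}"
    using rep_var rep_powi[of _ "- 1"] by (auto simp: power_int_minus)
  ultimately have "laurent_ring (range z) \<subseteq> {u. \<exists>h. rep z u h}"
    unfolding laurent_ring_def by (intro hull_minimal)
  then show ?thesis using assms by auto
qed

end

text \<open>The mutable variables are indexed by \<open>Inl\<close>, the frozen ones
    by \<open>Inr\<close>.\<close>

type_synonym cluster_sym = "frozen_sym + frozen_sym"

definition cluster_vars ::
    "'a \<Rightarrow> 'a \<Rightarrow> 'a \<Rightarrow> 'a \<Rightarrow> 'a \<Rightarrow> 'a \<Rightarrow> cluster_sym \<Rightarrow> 'a" where
  "cluster_vars x1 x2 x3 f1 f2 f3 = case_sum (case_frozen_sym x1 x2 x3) (case_frozen_sym f1 f2 f3)"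

lemma cluster_vars_simps [simp]:
  "cluster_vars x1 x2 x3 f1 f2 f3 (Inl F1) = x1" "cluster_vars x1 x2 x3 f1 f2 f3 (Inl F2) = x2"
  "cluster_vars x1 x2 x3 f1 f2 f3 (Inl F3) = x3" "cluster_vars x1 x2 x3 f1 f2 f3 (Inr F1) = f1"
  "cluster_vars x1 x2 x3 f1 f2 f3 (Inr F2) = f2" "cluster_vars x1 x2 x3 f1 f2 f3 (Inr F3) = f3"
  by (simp_all add: cluster_vars_def)

lemma all_cluster_sym:
  "(\<forall>i. P i) \<longleftrightarrow> P (Inl F1) \<and> P (Inl F2) \<and> P (Inl F3) \<and> P (Inr F1) \<and> P (Inr F2) \<and> P (Inr F3)"
  (is "?l \<longleftrightarrow> ?r")
proof
  assume r: ?r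
  show ?l
  proof
    fix i :: cluster_sym
    show "P i"
    proof (cases i)
      case (Inl a)
      then show ?thesis using r by (cases a) simp_all
    next
      case (Inr a)
      then show ?thesis using r by (cases a) simp_all
    qed
  qed
qed blast

lemma range_cluster_vars: "range (cluster_vars x1 x2 x3 f1 f2 f3) = {x1, x2, x3, f1, f2, f3}"
proof -
  have U: "UNIV = {Inl F1, Inl F2, Inl F3, Inr F1, Inr F2, Inr F3 :: cluster_sym}"
    using all_cluster_sym[of
        "\<lambda>i. i \<in> {Inl F1, Inl F2, Inl F3, Inr F1, Inr F2, Inr F3}"] by blast
  show ?thesis unfolding U by (simp only: image_insert image_empty cluster_vars_simps)
qed

lemma cluster_vars_frozen: "(\<lambda>i. cluster_vars x1 x2 x3 f1 f2 f3 (Inr i)) = case_frozen_sym f1 f2 f3"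
  by (rule ext) (simp add: cluster_vars_def)

lemma rep_mgen:
  fixes w x2 x3 f1 f2 f3 :: "'a::field"
  assumes nz: "\<forall>v. cluster_vars w x2 x3 f1 f2 f3 v \<noteq> 0"
  shows "rep (cluster_vars w x2 x3 f1 f2 f3) (mgen w x2 x3 f1 f2 f3 s)
    (\<lambda>v. mgen (v (Inl F1)) (v (Inl F2)) (v (Inl F3)) (v (Inr F1)) (v (Inr F2)) (v (Inr F3)) s)"
proof -
  let ?z = "cluster_vars w x2 x3 f1 f2 f3"
  note intros = rep_add[OF nz] rep_diff[OF nz] rep_mult[OF nz] rep_power[OF nz] rep_numeral[OF nz]
  have var: "rep ?z w (\<lambda>v. v (Inl F1))" "rep ?z x2 (\<lambda>v. v (Inl F2))"
      "rep ?z x3 (\<lambda>v. v (Inl F3))"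
    "rep ?z f1 (\<lambda>v. v (Inr F1))" "rep ?z f2 (\<lambda>v. v (Inr F2))"
        "rep ?z f3 (\<lambda>v. v (Inr F3))"
    using rep_var[OF nz, where i = "Inl F1"] rep_var[OF nz, where i
        = "Inl F2"] rep_var[OF nz, where i = "Inl F3"]
      rep_var[OF nz, where i = "Inr F1"] rep_var[OF nz, where i = "Inr F2"] rep_var[OF nz, where i
          = "Inr F3"] by simp_all
  have div: "rep ?z (a / w) (\<lambda>v. h v / v (Inl F1))" "rep ?z (a / x2) (\<lambda>v. h v / v (Inl F2))"
    "rep ?z (a / x3) (\<lambda>v. h v / v (Inl F3))" if "rep ?z a h" for a h
    using rep_divide[OF nz that, where i = "Inl F1"] rep_divide[OF nz that, where i = "Inl F2"]
      rep_divide[OF nz that, where i = "Inl F3"] by simp_all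
  have div23: "rep ?z (a / (x2 * x3)) (\<lambda>v. h v / (v (Inl F2) * v (Inl F3)))" if "rep ?z a h" for a h
    using div(3)[OF div(2)[OF that]] by (simp add: divide_divide_eq_left)
  have div2323: "rep ?z (a / (x2 * x3)\<^sup>2) (\<lambda>v. h v / (v (Inl F2)
      * v (Inl F3))\<^sup>2)" if "rep ?z a h" for a h
    using div23[OF div23[OF that]] by (simp add: power2_eq_square)
  show ?thesis
    unfolding mgen_def Let_def by (cases s) (simp only: gen_sym.case, intro intros div div23 div2323 var)+
qed

text \<open>Exchanging x1 for (f1 * x2^2 + x3^2) / x1 is an involution: a Laurent relation in the
  new variables becomes one in the old variables, hence of real functions, and the involution
  carries this back to the vanishing of P at all positive points.\<close>

lemma laurent_independent_mutate:
  fixes x1 x2 x3 f1 f2 f3 :: "'a::field"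
  assumes ind: "laurent_independent (cluster_vars x1 x2 x3 f1 f2 f3)"
  shows "laurent_independent (cluster_vars ((f1 * x2\<^sup>2 + x3\<^sup>2) / x1) x2 x3 f1 f2 f3)"
proof -
  let ?z = "cluster_vars x1 x2 x3 f1 f2 f3"
  let ?w = "(f1 * x2\<^sup>2 + x3\<^sup>2) / x1"
  let ?z' = "cluster_vars ?w x2 x3 f1 f2 f3"
  have nz: "\<forall>v. ?z v \<noteq> 0" using ind by (simp add: laurent_independent_def)
  have nzs: "x1 \<noteq> 0" "x2 \<noteq> 0" "x3 \<noteq> 0" "f1 \<noteq> 0" "f2 \<noteq> 0" "f3 \<noteq> 0"
    using nz unfolding all_cluster_sym by simp_all
  define W :: "(cluster_sym \<Rightarrow> real) \<Rightarrow> real"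
    where "W v = (v (Inr F1) * (v (Inl F2))\<^sup>2 + (v (Inl F3))\<^sup>2) / v (Inl F1)" for v
  have repw: "rep ?z ?w W"
  proof -
    have "rep ?z ((?z (Inr F1) * (?z (Inl F2))\<^sup>2 + (?z (Inl F3))\<^sup>2) / ?z (Inl F1)) W"
      unfolding W_def
      by (intro rep_divide[OF nz] rep_add[OF nz] rep_mult[OF nz] rep_power[OF nz] rep_var[OF nz])
    then show ?thesis by simp
  qed
  have w: "?w \<noteq> 0"
  proof
    assume "?w = 0"
    then have "rep ?z 0 W" using repw by (simp only:)
    then have "W (\<lambda>_. 1) = 0" by (rule rep_zeroD[OF ind]) simp
    then show False by (simp add: W_def)
  qed
  have nz': "\<forall>v. ?z' v \<noteq> 0"
    unfolding all_cluster_sym cluster_vars_simps using w nzs by blast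
  have "P = 0" if P: "laurent_eval ?z' P = 0" for P
  proof -
    \<comment> \<open>Negative powers of the new variable are not Laurent polynomials in the old
      ones; multiplying by its N-th power removes them.\<close>
    define N where "N = (\<Sum>e\<in>Poly_Mapping.keys P. \<bar>Poly_Mapping.lookup e (Inl F1)\<bar>)"
    have N: "0 \<le> Poly_Mapping.lookup e (Inl F1) + N" if "e \<in> Poly_Mapping.keys P" for e
      using member_le_sum[of e "Poly_Mapping.keys P"
          "\<lambda>e. \<bar>Poly_Mapping.lookup e (Inl F1)\<bar>"] that
      by (simp add: N_def)
    have shift: "laurent_eval y P * y (Inl F1) powi N =
        (\<Sum>e\<in>Poly_Mapping.keys P. of_int (Poly_Mapping.lookup P e) *
          (y (Inl F1) ^ nat (Poly_Mapping.lookup e (Inl F1) + N) *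
           (\<Prod>v\<in>UNIV - {Inl F1}. y v powi Poly_Mapping.lookup e v)))"
      if "\<forall>v. y v \<noteq> 0" for y :: "cluster_sym \<Rightarrow> 'b::field"
      unfolding laurent_eval_eq mp_eval_def sum_distrib_right
    proof (rule sum.cong[OF refl])
      fix e assume e: "e \<in> Poly_Mapping.keys P"
      have 1: "lmon y e = y (Inl F1) powi Poly_Mapping.lookup e (Inl F1) *
          (\<Prod>v\<in>UNIV - {Inl F1}. y v powi Poly_Mapping.lookup e v)"
        unfolding lmon_superset[OF finite_UNIV subset_UNIV, of y e]
        by (rule prod.remove) simp_all
      have 2: "y (Inl F1) powi Poly_Mapping.lookup e (Inl F1) * y (Inl F1) powi N
          = y (Inl F1) ^ nat (Poly_Mapping.lookup e (Inl F1) + N)"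
        using N[OF e] that power_int_add[of "y (Inl F1)" "Poly_Mapping.lookup e (Inl F1)" N]
        by (simp add: power_int_def)
      show "of_int (Poly_Mapping.lookup P e) * lmon y e * y (Inl F1) powi N =
          of_int (Poly_Mapping.lookup P e) * (y (Inl F1) ^ nat (Poly_Mapping.lookup e (Inl F1) + N) *
           (\<Prod>v\<in>UNIV - {Inl F1}. y v powi Poly_Mapping.lookup e v))"
        unfolding 1 2[symmetric] by (simp only: mult_ac)
    qed
    define h where "h v = (\<Sum>e\<in>Poly_Mapping.keys P. of_int (Poly_Mapping.lookup P e) *
          (W v ^ nat (Poly_Mapping.lookup e (Inl F1) + N) *
           (\<Prod>i\<in>UNIV - {Inl F1}. v i powi Poly_Mapping.lookup e i)))" for v
    have same: "?z' v = ?z v" if "v \<in> UNIV - {Inl F1}" for v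
    proof -
      have "\<forall>v. v \<noteq> Inl F1 \<longrightarrow> ?z' v = ?z v" unfolding all_cluster_sym by simp
      then show ?thesis using that by blast
    qed
    have prod_same: "(\<Prod>v\<in>UNIV - {Inl F1}. ?z' v powi Poly_Mapping.lookup e v) =
        (\<Prod>v\<in>UNIV - {Inl F1}. ?z v powi Poly_Mapping.lookup e v)" for e
      by (rule prod.cong) (simp_all only: same)
    have "rep ?z (\<Sum>e\<in>Poly_Mapping.keys P. of_int (Poly_Mapping.lookup P e) *
          (?w ^ nat (Poly_Mapping.lookup e (Inl F1) + N) *
           (\<Prod>v\<in>UNIV - {Inl F1}. ?z v powi Poly_Mapping.lookup e v))) h"
      unfolding h_def
      by (intro rep_sum[OF nz] rep_mult[OF nz] rep_prod[OF nz] rep_power[OF nz] rep_of_int[OF nz]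
          rep_powi[OF nz] repw)
    moreover have "(\<Sum>e\<in>Poly_Mapping.keys P. of_int (Poly_Mapping.lookup P e) *
          (?w ^ nat (Poly_Mapping.lookup e (Inl F1) + N) *
           (\<Prod>v\<in>UNIV - {Inl F1}. ?z v powi Poly_Mapping.lookup e v))) = 0"
      using shift[of ?z', OF nz'] P unfolding prod_same by simp
    ultimately have h0: "rep ?z 0 h" by simp
    show "P = 0"
    proof (rule laurent_poly_zeroI[where T = "\<lambda>_. {0<..}"])
      fix y :: "cluster_sym \<Rightarrow> real" assume "\<And>v. y v \<in> {0<..}"
      then have y: "y v > 0" for v by simp
      then have ynz: "\<forall>v. y v \<noteq> 0" by (simp add: less_imp_neq[symmetric])
      \<comment> \<open>The point at which the new variable takes the prescribed value
        \<open>y (Inl F1)\<close>; positivity of \<open>y\<close> keeps its coordinates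
        nonzero.\<close>
      let ?v = "y(Inl F1 := (y (Inr F1) * (y (Inl F2))\<^sup>2 + (y (Inl F3))\<^sup>2) / y (Inl F1))"
      have "0 < y (Inr F1) * (y (Inl F2))\<^sup>2 + (y (Inl F3))\<^sup>2"
        by (intro add_pos_pos mult_pos_pos zero_less_power y)
      then have v: "\<forall>i. ?v i \<noteq> 0" and Wv: "W ?v = y (Inl F1)"
        using ynz by (simp_all add: W_def)
      have "h ?v = 0" by (rule rep_zeroD[OF ind h0]) (rule v[rule_format])
      moreover have "h ?v = laurent_eval y P * y (Inl F1) powi N"
        unfolding shift[of y, OF ynz] h_def Wv by simp
      ultimately show "laurent_eval y P = 0" using ynz by simp
    qed (simp_all add: infinite_Ioi)
  qed
  then show ?thesis using nz' by (simp add: laurent_independent_def)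
qed

section \<open>Subrings and the image of the presentation map\<close>

lemma subring_closed:
  assumes "is_subring S"
  shows "0 \<in> S" "1 \<in> S" "a \<in> S \<Longrightarrow> b \<in> S \<Longrightarrow> a
      - b \<in> S" "a \<in> S \<Longrightarrow> b \<in> S \<Longrightarrow> a * b \<in> S"
    "a \<in> S \<Longrightarrow> - a \<in> S" "a \<in> S
        \<Longrightarrow> b \<in> S \<Longrightarrow> a + b \<in> S" "a \<in> S
        \<Longrightarrow> a ^ n \<in> S"
proof -
  have d: "x - y \<in> S" and m: "x * y \<in> S" if "x \<in> S" "y \<in> S" for x y
    using assms that by (auto simp: is_subring_def)
  show one: "1 \<in> S" using assms by (simp add: is_subring_def)
  show zero: "0 \<in> S" using d[OF one one] by simp
  have u: "- x \<in> S" if "x \<in> S" for x using d[OF zero that] by simp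
  show "a - b \<in> S" "a * b \<in> S" if "a \<in> S" "b \<in> S" by (fact d[OF that] m[OF that])+
  show "- a \<in> S" if "a \<in> S" using u[OF that] .
  show "a + b \<in> S" if "a \<in> S" "b \<in> S" using d[OF that(1) u[OF that(2)]] by simp
  show "a ^ n \<in> S" if "a \<in> S" using that by (induction n) (simp_all add: one m)
qed

lemma subring_sum: "is_subring S \<Longrightarrow> (\<And>i. i \<in> A
    \<Longrightarrow> h i \<in> S) \<Longrightarrow> sum h A \<in> S"
  by (induction A rule: infinite_finite_induct) (simp_all add: subring_closed)

lemma subring_prod: "is_subring S \<Longrightarrow> (\<And>i. i \<in> A
    \<Longrightarrow> h i \<in> S) \<Longrightarrow> prod h A \<in> S"
  by (induction A rule: infinite_finite_induct) (simp_all add: subring_closed)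

lemma subring_of_int: "is_subring S \<Longrightarrow> of_int n \<in> S"
proof (induction n rule: int_induct[of _ 0])
  case (step1 i)
  then show ?case by (simp add: subring_closed)
next
  case (step2 i)
  then show ?case by (simp add: subring_closed)
qed (simp add: subring_closed)

lemma subring_powi: "is_subring S \<Longrightarrow> a \<in> S
    \<Longrightarrow> inverse a \<in> S \<Longrightarrow> a powi k \<in> S"
  by (simp add: power_int_def subring_closed)

lemma subring_hull: "is_subring (is_subring hull X)"
  by (rule hull_in) (auto simp: is_subring_def)

lemma subring_laurent_eval:
  "is_subring S \<Longrightarrow> (\<And>v. z v \<in> S)
      \<Longrightarrow> (\<And>v. inverse (z v) \<in> S) \<Longrightarrow> laurent_eval z P \<in> S"
  unfolding laurent_eval_def
  by (intro subring_sum subring_closed subring_prod subring_of_int subring_powi)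

lemma subring_presentation_map:
  "is_subring S \<Longrightarrow> (\<And>v. z v \<in> S)
      \<Longrightarrow> (\<And>v. inverse (z v) \<in> S)
      \<Longrightarrow> (\<And>s. g s \<in> S) \<Longrightarrow>
    presentation_map z g p \<in> S"
  unfolding presentation_map_def poly_eval_def
  by (intro subring_sum subring_closed subring_prod subring_laurent_eval)

lemma range_presentation_map:
  assumes nz: "\<And>v. z v \<noteq> 0"
  shows "range (presentation_map z g) = is_subring hull (range g \<union> range z
      \<union> inverse ` range z)"
    (is "?R = ?H")
proof
  show "?R \<subseteq> ?H"
    by (intro image_subsetI subring_presentation_map[OF subring_hull] hull_inc) blast+
  have "is_subring ?R"
    unfolding is_subring_def
  proof (intro conjI ballI)
    show "1 \<in> ?R" by (rule range_eqI[of _ _ 1]) (simp add: presentation_map_hom[of z, OF nz])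
    fix a b assume "a \<in> ?R" "b \<in> ?R"
    then obtain p q where "a = presentation_map z g p" "b = presentation_map z g q" by auto
    then have "a - b = presentation_map z g (p - q)" "a * b = presentation_map z g (p * q)"
      by (simp_all only: presentation_map_hom[of z, OF nz])
    then show "a - b \<in> ?R" "a * b \<in> ?R" by blast+
  qed
  moreover have "range g \<subseteq> ?R"
    by (rule image_subsetI, rule range_eqI[of _ "presentation_map z g"])
      (rule presentation_map_vars(2)[of z, OF nz, symmetric])
  moreover have "range z \<subseteq> ?R"
    by (rule image_subsetI, rule range_eqI[of _ "presentation_map z g"])
      (rule presentation_map_vars(1)[of z, OF nz, symmetric])
  moreover have "inverse ` range z \<subseteq> ?R"
  proof -
    have "presentation_map z g (frozen_inv i) = inverse (z i)" for i
      by (simp add: frozen_inv_def coef_def presentation_map_hom[of z, OF nz] laurent_eval_hom[of z, OF nz]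
          power_int_minus)
    then show ?thesis unfolding image_image by (intro image_subsetI range_eqI[OF sym])
  qed
  ultimately show "?H \<subseteq> ?R" by (intro hull_minimal Un_least)
qed

subsection \<open>The generators as elements of the field\<close>

definition generators ::
    "'a::field \<Rightarrow> 'a \<Rightarrow> 'a \<Rightarrow> 'a \<Rightarrow> 'a \<Rightarrow> 'a \<Rightarrow> gen_sym \<Rightarrow> 'a" where
  "generators x1 x2 x3 f1 f2 f3 = (
    let l1 = (x2\<^sup>2 + f2 * f3 * x3\<^sup>2 + f3 * x1\<^sup>2) / (x2 * x3);
        l2 = (x3\<^sup>2 + f3 * f1 * x1\<^sup>2 + f1 * x2\<^sup>2) / (x3 * x1);
        l3 = (x1\<^sup>2 + f1 * f2 * x2\<^sup>2 + f2 * x3\<^sup>2) / (x1 * x2)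
    in case_gen_sym x1 x2 x3 l1 l2 l3
      ((f1 * l1\<^sup>2 + (f1 * f2 * f3 - 1)\<^sup>2) / x1)
      ((f2 * l2\<^sup>2 + (f1 * f2 * f3 - 1)\<^sup>2) / x2)
      ((f3 * l3\<^sup>2 + (f1 * f2 * f3 - 1)\<^sup>2) / x3))"

lemma generators_simps:
  fixes x1 x2 x3 f1 f2 f3 :: "'a::field"
  defines "g \<equiv> generators x1 x2 x3 f1 f2 f3"
  shows "g X1 = x1" "g X2 = x2" "g X3 = x3"
    "g L1 = (x2\<^sup>2 + f2 * f3 * x3\<^sup>2 + f3 * x1\<^sup>2) / (x2 * x3)"
    "g L2 = (x3\<^sup>2 + f3 * f1 * x1\<^sup>2 + f1 * x2\<^sup>2) / (x3 * x1)"
    "g L3 = (x1\<^sup>2 + f1 * f2 * x2\<^sup>2 + f2 * x3\<^sup>2) / (x1 * x2)"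
    "g Y1 = (f1 * (g L1)\<^sup>2 + (f1 * f2 * f3 - 1)\<^sup>2) / x1"
    "g Y2 = (f2 * (g L2)\<^sup>2 + (f1 * f2 * f3 - 1)\<^sup>2) / x2"
    "g Y3 = (f3 * (g L3)\<^sup>2 + (f1 * f2 * f3 - 1)\<^sup>2) / x3"
  by (simp_all add: g_def generators_def Let_def)

lemma generators_rotate:
  fixes x1 x2 x3 f1 f2 f3 :: "'a::field"
  shows "generators x2 x3 x1 f2 f3 f1 = generators x1 x2 x3 f1 f2 f3 \<circ>
    case_gen_sym X2 X3 X1 L2 L3 L1 Y2 Y3 Y1"
proof
  have a: "f2 * f3 * f1 - 1 = f1 * f2 * f3 - 1" by (simp only: mult_ac)
  fix s show "generators x2 x3 x1 f2 f3 f1 s = (generators x1 x2 x3 f1 f2 f3 \<circ>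
    case_gen_sym X2 X3 X1 L2 L3 L1 Y2 Y3 Y1) s"
    by (cases s; simp only: o_apply gen_sym.case generators_def Let_def a)
qed

lemma mgen_eq_generators:
  fixes x1 x2 x3 f1 f2 f3 :: "'a::field"
  assumes nz: "x1 \<noteq> 0" "x2 \<noteq> 0" "x3 \<noteq> 0" and E: "f1 * x2\<^sup>2
      + x3\<^sup>2 \<noteq> 0"
  shows "mgen ((f1 * x2\<^sup>2 + x3\<^sup>2) / x1) x2 x3 f1 f2 f3 = generators x1 x2 x3 f1 f2 f3"
proof -
  define w where "w = (f1 * x2\<^sup>2 + x3\<^sup>2) / x1"
  have w: "w * x1 = f1 * x2\<^sup>2 + x3\<^sup>2" "w \<noteq> 0" using nz E by (simp_all add: w_def)
  have x1: "(f1 * x2\<^sup>2 + x3\<^sup>2) / w = x1" unfolding w(1)[symmetric] using w(2) by simp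
  have "(w + f1 * f3 * x1) * (x3 * x1) = (x3\<^sup>2 + f3 * f1 * x1\<^sup>2 + f1 * x2\<^sup>2) * x3"
    using w(1) by algebra
  then have l2: "(w + f1 * f3 * x1) / x3 = (x3\<^sup>2 + f3 * f1 * x1\<^sup>2
      + f1 * x2\<^sup>2) / (x3 * x1)"
    using nz by (simp only: frac_eq_eq mult_eq_0_iff simp_thms not_False_eq_True)
  have "(x1 + f2 * w) * (x1 * x2) = (x1\<^sup>2 + f1 * f2 * x2\<^sup>2 + f2 * x3\<^sup>2) * x2"
    using w(1) by algebra
  then have l3: "(x1 + f2 * w) / x2 = (x1\<^sup>2 + f1 * f2 * x2\<^sup>2 + f2 * x3\<^sup>2) / (x1 * x2)"
    using nz by (simp only: frac_eq_eq mult_eq_0_iff simp_thms not_False_eq_True)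
  let ?l1 = "(x2\<^sup>2 + f2 * f3 * x3\<^sup>2 + f3 * x1\<^sup>2) / (x2 * x3)"
  let ?N = "w * (x2\<^sup>2 + f1 * (f2 * f3)\<^sup>2 * x3\<^sup>2) + 2 * f1 * f3 * x1 * (x2\<^sup>2
      + f2 * f3 * x3\<^sup>2) + f1 * f3\<^sup>2 * x1 ^ 3"
  \<comment> \<open>The terms of the right side without x1 factor as f1 * x2^2 + x3^2 times x2^2 +
    f1 * (f2 * f3)^2 * x3^2, thanks to the summand \<alpha>^2 in y1. As the first factor is w * x1,
    the denominator x1 of y1 cancels.\<close>
  have "x1 * ?N = f1 * (x2\<^sup>2 + f2 * f3 * x3\<^sup>2 + f3 * x1\<^sup>2)\<^sup>2
      + (f1 * f2 * f3 - 1)\<^sup>2 * (x2 * x3)\<^sup>2"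
    using w(1) by algebra
  also have "\<dots> = (f1 * ?l1\<^sup>2 + (f1 * f2 * f3 - 1)\<^sup>2) * (x2 * x3)\<^sup>2"
    using nz by (simp add: power_divide distrib_right)
  finally have "?N * x1 = (f1 * ?l1\<^sup>2 + (f1 * f2 * f3 - 1)\<^sup>2) * (x2 * x3)\<^sup>2"
    by (simp only: mult.commute)
  then have y1: "?N / (x2 * x3)\<^sup>2 = (f1 * ?l1\<^sup>2 + (f1 * f2 * f3 - 1)\<^sup>2) / x1"
    using nz by (simp only: frac_eq_eq power_eq_0_iff mult_eq_0_iff simp_thms not_False_eq_True)
  show ?thesis
    unfolding mgen_def generators_def Let_def w_def[symmetric] x1 l2 l3 y1 by (rule refl)
qed

lemma relations_in_hom:
  assumes "\<And>p q. h (p + q) = h p + h q" "\<And>p q. h (p - q)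
      = h p - h q" "\<And>p q. h (p * q) = h p * h q"
    "\<And>p n. h (p ^ n) = h p ^ n" "h 1 = 1"
  shows "h ` relations_in f1 f2 f3 x1 x2 x3 l1 l2 l3 y1 y2 y3 =
    relations_in (h f1) (h f2) (h f3) (h x1) (h x2) (h x3) (h l1) (h l2) (h l3) (h y1) (h y2) (h y3)"
  unfolding relations_in_def Let_def by (simp only: image_insert image_empty assms)

lemma relations_in_generators:
  fixes x1 x2 x3 f1 f2 f3 :: "'a::field"
  assumes nz: "x1 \<noteq> 0" "x2 \<noteq> 0" "x3 \<noteq> 0"
  defines "g \<equiv> generators x1 x2 x3 f1 f2 f3"
  shows "relations_in f1 f2 f3 (g X1) (g X2) (g X3) (g L1) (g L2) (g L3) (g Y1) (g Y2) (g Y3) \<subseteq> {0}"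
proof -
  let ?\<alpha> = "f1 * f2 * f3 - 1"
  note g = generators_simps[of x1 x2 x3 f1 f2 f3, folded g_def]
  have l: "x2 * x3 * g L1 = x2\<^sup>2 + f2 * f3 * x3\<^sup>2 + f3 * x1\<^sup>2"
    "x3 * x1 * g L2 = x3\<^sup>2 + f3 * f1 * x1\<^sup>2 + f1 * x2\<^sup>2"
    "x1 * x2 * g L3 = x1\<^sup>2 + f1 * f2 * x2\<^sup>2 + f2 * x3\<^sup>2"
    unfolding g(4-6) using nz by simp_all
  have y: "x1 * g Y1 = f1 * (g L1)\<^sup>2 + ?\<alpha>\<^sup>2" "x2 * g Y2 = f2 * (g L2)\<^sup>2
      + ?\<alpha>\<^sup>2"
    "x3 * g Y3 = f3 * (g L3)\<^sup>2 + ?\<alpha>\<^sup>2"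
    unfolding g(7-9) using nz by simp_all
  have a: "?\<alpha> = f2 * f3 * f1 - 1" "?\<alpha> = f3 * f1 * f2 - 1" by simp_all
  note r1 = relations_aux[OF nz refl l y]
  note r2 = relations_aux[OF nz(2,3,1) a(1) l(2,3,1) y(2,3,1)]
  note r3 = relations_aux[OF nz(3,1,2) a(2) l(3,1,2) y(3,1,2)]
  show ?thesis
    unfolding relations_in_def Let_def insert_subset g(1-3)
    by (intro conjI empty_subsetI; simp only: singleton_iff right_minus_eq; fact l y r1 r2 r3)
qed

lemma rel_ideal_zero:
  fixes h :: "gen_ring \<Rightarrow> 'a::comm_ring_1"
  assumes "h 0 = 0" "\<And>p q. h (p + q) = h p + h q" "\<And>p q. h (p * q) = h p * h q"
    and rel: "h ` relations \<subseteq> {0}" and "i \<in> rel_ideal"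
  shows "h i = 0"
proof -
  have "rel_ideal \<subseteq> {i. h i = 0}"
    unfolding ideal_generated_def
    by (rule module.span_minimal[OF module_mult])
      (use rel in \<open>auto simp: module.subspace_def[OF module_mult] assms(1-3)\<close>)
  then show ?thesis using assms(5) by auto
qed

section \<open>Kernel and division by x1 in one cluster\<close>

locale markov_cluster =
  fixes x1 x2 x3 f1 f2 f3 :: "'a::field"
  assumes ind: "laurent_independent (cluster_vars x1 x2 x3 f1 f2 f3)"
begin

lemma nonzero: "x1 \<noteq> 0" "x2 \<noteq> 0" "x3 \<noteq> 0" "f1 \<noteq> 0" "f2
    \<noteq> 0" "f3 \<noteq> 0"
  using ind unfolding laurent_independent_def all_cluster_sym by simp_all

definition \<phi> :: "gen_ring \<Rightarrow> 'a" where
  "\<phi> = presentation_map (case_frozen_sym f1 f2 f3) (generators x1 x2 x3 f1 f2 f3)"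

definition x1' :: 'a where "x1' = (f1 * x2\<^sup>2 + x3\<^sup>2) / x1"

lemma ind': "laurent_independent (cluster_vars x1' x2 x3 f1 f2 f3)"
  unfolding x1'_def using ind by (rule laurent_independent_mutate)

lemma nonzero': "\<forall>v. cluster_vars x1' x2 x3 f1 f2 f3 v \<noteq> 0"
  using ind' by (simp add: laurent_independent_def)

lemma x1'_nonzero: "x1' \<noteq> 0"
  using nonzero' unfolding all_cluster_sym by simp

lemma phi_hom: "\<phi> (p + q) = \<phi> p + \<phi> q" "\<phi> (p - q)
    = \<phi> p - \<phi> q" "\<phi> (p * q) = \<phi> p * \<phi> q"
  "\<phi> (p ^ n) = \<phi> p ^ n" "\<phi> 1 = 1" "\<phi> 0 = 0"
  unfolding \<phi>_def by (simp_all only: presentation_map_hom[of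
      "case_frozen_sym f1 f2 f3", OF case_frozen_sym_nonzero[OF nonzero(4-6)]])

lemma phi_vars: "\<phi> (frozen_var i) = case_frozen_sym f1 f2 f3 i"
  "\<phi> (gen_var s) = generators x1 x2 x3 f1 f2 f3 s"
  unfolding \<phi>_def by (simp_all only: presentation_map_vars[of
      "case_frozen_sym f1 f2 f3", OF case_frozen_sym_nonzero[OF nonzero(4-6)]])

lemma phi_ideal: "i \<in> rel_ideal \<Longrightarrow> \<phi> i = 0"
proof (rule rel_ideal_zero[of \<phi>])
  have "\<phi> ` relations
      = relations_in f1 f2 f3 (\<phi> (gen_var X1)) (\<phi> (gen_var X2)) (\<phi> (gen_var X3))
     (\<phi> (gen_var L1)) (\<phi> (gen_var L2)) (\<phi> (gen_var L3)) (\<phi> (gen_var Y1)) (\<phi> (gen_var Y2)) (\<phi> (gen_var Y3))"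
    unfolding relations_def
        by (simp only: relations_in_hom[of \<phi>, OF phi_hom(1-5)] phi_vars(1) frozen_sym.case)
  also have "\<dots> \<subseteq> {0}"
    unfolding phi_vars(2) by (rule relations_in_generators) (fact nonzero)+
  finally show "\<phi> ` relations \<subseteq> {0}" .
qed (simp_all only: phi_hom)

text \<open>The cluster with x1' is chosen because none of the generators has x1 in the denominator
  there, so these functions are defined on the divisor as well.\<close>

lemma rep_phi:
  "rep (cluster_vars x1' x2 x3 f1 f2 f3) (\<phi> p)
    (\<lambda>v. real_eval (v (Inl F1)) (v (Inl F2)) (v (Inl F3)) (v (Inr F1)) (v (Inr F2)) (v (Inr F3)) p)"
proof -
  have E: "f1 * x2\<^sup>2 + x3\<^sup>2 \<noteq> 0" using x1'_nonzero by (auto simp: x1'_def)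
  have fr: "case_frozen_sym (v (Inr F1)) (v (Inr F2)) (v (Inr F3)) = (\<lambda>i. v (Inr i))"
    for v :: "cluster_sym \<Rightarrow> real"
    by (rule ext) (simp split: frozen_sym.split)
  show ?thesis
    unfolding real_eval_def \<phi>_def mgen_eq_generators[OF nonzero(1-3) E, folded x1'_def, symmetric]
      fr cluster_vars_frozen[of x1' x2 x3 f1 f2 f3, symmetric]
    by (rule rep_presentation_map[OF nonzero']) (rule rep_mgen[OF nonzero'])
qed

text \<open>The function \<open>real_eval\<close> of p depends only on the element
  \<open>\<phi> p\<close> and may be computed from any Laurent expression of it, in particular from
  one that does not come from the generators.\<close>

lemma phi_eq_rep:
  assumes "rep (cluster_vars x1' x2 x3 f1 f2 f3) (\<phi> p) h"
    and nz: "w \<noteq> 0" "a2 \<noteq> 0" "a3 \<noteq> 0" "b1 \<noteq> 0" "b2 \<noteq> 0" "b3 \<noteq> 0"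
  shows "real_eval w a2 a3 b1 b2 b3 p = h (cluster_vars w a2 a3 b1 b2 b3)"
proof -
  let ?v = "cluster_vars w a2 a3 b1 b2 b3"
  have v: "\<forall>i. ?v i \<noteq> 0" unfolding all_cluster_sym using nz by simp
  have "rep (cluster_vars x1' x2 x3 f1 f2 f3) (\<phi> p - \<phi> p) (\<lambda>v.
    real_eval (v (Inl F1)) (v (Inl F2)) (v (Inl F3)) (v (Inr F1)) (v (Inr F2)) (v (Inr F3)) p - h v)"
    by (rule rep_diff[OF nonzero' rep_phi assms(1)])
  then have "real_eval (?v (Inl F1)) (?v (Inl F2)) (?v (Inl F3)) (?v (Inr F1)) (?v (Inr F2)) (?v (Inr F3)) p - h ?v = 0"
    unfolding diff_self by (rule rep_zeroD[OF ind']) (rule v[rule_format])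
  then show ?thesis by simp
qed

lemma real_eval_zero:
  assumes "\<phi> p = 0" "w \<noteq> 0" "a2 \<noteq> 0" "a3 \<noteq> 0" "b1 \<noteq> 0" "b2
      \<noteq> 0" "b3 \<noteq> 0"
  shows "real_eval w a2 a3 b1 b2 b3 p = 0"
  using phi_eq_rep[of p "\<lambda>_. 0" w a2 a3 b1 b2 b3] rep_numeral(1)[OF nonzero'] assms by simp

lemma kernel: "{p. \<phi> p = 0} = rel_ideal"
proof
  show "rel_ideal \<subseteq> {p. \<phi> p = 0}" using phi_ideal by auto
  show "{p. \<phi> p = 0} \<subseteq> rel_ideal"
  proof
    fix p assume "p \<in> {p. \<phi> p = 0}"
    then have "\<phi> p = 0" by simp
    show "p \<in> rel_ideal"
    proof (rule kernel_subset_ideal[of \<phi>])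
      show "\<phi> (gen_var X1) \<noteq> 0"
        unfolding phi_vars(2) generators_simps(1) by (rule nonzero)
    qed (fact phi_ideal phi_hom real_eval_zero \<open>\<phi> p = 0\<close>)+
  qed
qed

lemma division_by_x1:
  assumes u: "u \<in> laurent_ring {x1', x2, x3, f1, f2, f3}" and xu: "x1 * u \<in> range \<phi>"
  shows "u \<in> range \<phi>"
proof -
  obtain p where p: "x1 * u = \<phi> p" using xu by auto
  obtain h where h: "rep (cluster_vars x1' x2 x3 f1 f2 f3) u h"
    using laurent_ring_rep[OF nonzero', unfolded range_cluster_vars, OF u] by auto
  have "rep (cluster_vars x1' x2 x3 f1 f2 f3) (\<phi> (gen_var X1) * u)
    (\<lambda>v. real_eval (v (Inl F1)) (v (Inl F2)) (v (Inl F3)) (v (Inr F1)) (v (Inr F2)) (v (Inr F3)) (gen_var X1) * h v)"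
    by (rule rep_mult[OF nonzero' rep_phi h])
  \<comment> \<open>The second expression of \<open>\<phi> p\<close> is x1 times u. As u is a
    Laurent polynomial in the mutated cluster, h has no pole on the divisor and the product vanishes
    there.\<close>
  then have rep: "rep (cluster_vars x1' x2 x3 f1 f2 f3) (\<phi> p)
    (\<lambda>v. real_eval (v (Inl F1)) (v (Inl F2)) (v (Inl F3)) (v (Inr F1)) (v (Inr F2)) (v (Inr F3)) (gen_var X1) * h v)"
    unfolding phi_vars(2) generators_simps(1) p .
  have "\<exists>q. p - gen_var X1 * q \<in> rel_ideal"
  proof (rule divisible_by_X1)
    fix w a2 a3 b1 b2 b3 :: real
    assume nz: "w \<noteq> 0" "a2 \<noteq> 0" "a3 \<noteq> 0" "b1 \<noteq> 0" "b2
        \<noteq> 0" "b3 \<noteq> 0"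
    show "real_eval w a2 a3 b1 b2 b3 i = 0" if "i \<in> rel_ideal" for i
      using real_eval_zero[OF phi_ideal[OF that] nz] .
    assume "b1 * a2\<^sup>2 + a3\<^sup>2 = 0"
    then show "real_eval w a2 a3 b1 b2 b3 p = 0"
      using phi_eq_rep[OF rep nz] by (simp add: real_eval_hom(3)[OF nz(4-6)])
  qed
  then obtain q where "p - gen_var X1 * q \<in> rel_ideal" by auto
  then have "\<phi> p - \<phi> (gen_var X1) * \<phi> q = 0"
    using phi_ideal phi_hom(2,3) by metis
  then have "x1 * u = x1 * \<phi> q"
    unfolding phi_vars(2) generators_simps(1) p by simp
  then show ?thesis using nonzero(1) by simp
qed

lemma range_phi:
  "range \<phi> = is_subring hull (range (generators x1 x2 x3 f1 f2 f3)
      \<union> {f1, f2, f3} \<union> inverse ` {f1, f2, f3})"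
proof -
  have "range (case_frozen_sym f1 f2 f3) = {f1, f2, f3}"
    by (auto simp: image_iff split: frozen_sym.splits)
  then show ?thesis
    unfolding \<phi>_def using range_presentation_map[of
        "case_frozen_sym f1 f2 f3", OF case_frozen_sym_nonzero[OF nonzero(4-6)]] by simp
qed

end

lemma range_generators_rotate:
  fixes x1 x2 x3 f1 f2 f3 :: "'a::field"
  shows "range (generators x2 x3 x1 f2 f3 f1) = range (generators x1 x2 x3 f1 f2 f3)"
proof -
  have "surj (case_gen_sym X2 X3 X1 L2 L3 L1 Y2 Y3 Y1)"
  proof
    show "UNIV \<subseteq> range (case_gen_sym X2 X3 X1 L2 L3 L1 Y2 Y3 Y1)"
    proof
      fix s :: gen_sym
      have "s = case_gen_sym X2 X3 X1 L2 L3 L1 Y2 Y3 Y1 (case_gen_sym X3 X1 X2 L3 L1 L2 Y3 Y1 Y2 s)"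
        by (cases s) simp_all
      then show "s \<in> range (case_gen_sym X2 X3 X1 L2 L3 L1 Y2 Y3 Y1)" by (rule range_eqI)
    qed
  qed simp
  then have "range (generators x1 x2 x3 f1 f2 f3 \<circ> case_gen_sym X2 X3 X1 L2 L3 L1 Y2 Y3 Y1)
      = range (generators x1 x2 x3 f1 f2 f3)"
    by (simp only: image_comp[symmetric])
  then show ?thesis by (simp only: generators_rotate[of x2 x3 x1 f2 f3 f1])
qed

section \<open>Generators of neighbouring seeds\<close>

lemma generators_in_subring:
  fixes a1 a2 a3 q1 q2 q3 :: "'a::field"
  assumes S: "is_subring S"
    and a: "a1 \<in> S" "a2 \<in> S" "a3 \<in> S" "inverse a1 \<in> S" "inverse a2 \<in> S"
        "inverse a3 \<in> S"
    and q: "q1 \<in> S" "q2 \<in> S" "q3 \<in> S"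
  shows "generators a1 a2 a3 q1 q2 q3 s \<in> S"
  unfolding generators_def Let_def divide_inverse inverse_mult_distrib
  by (cases s; simp only: gen_sym.case) (intro subring_closed[OF S] a q)+

lemma frozen_power_eq_divide:
  fixes z :: "'b \<Rightarrow> 'a::field"
  assumes "\<And>r. r \<in> R \<Longrightarrow> z r \<noteq> 0"
  shows "(\<Prod>r\<in>R. z r powi b r)
      = (\<Prod>r\<in>R. z r ^ nat (b r)) / (\<Prod>r\<in>R. z r ^ nat (- b r))"
  unfolding prod_dividef[symmetric]
  by (rule prod.cong) (auto simp: power_int_def divide_inverse power_inverse)

text \<open>
  Mutation at 1 reverses the orientation, so the mutated seed lists its variables as
  \<open>b1, a3, a2\<close>; \<open>p / m\<close>, \<open>q2\<close>, \<open>q3\<close> are the monomials in the frozen variables given by the columns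
  of the exchange matrix.
\<close>

lemma generators_mutate:
  fixes a1 a2 a3 p m q2 q3 :: "'a::field"
  assumes nz: "a1 \<noteq> 0" "a2 \<noteq> 0" "a3 \<noteq> 0" "p \<noteq> 0" "m
      \<noteq> 0" "q2 \<noteq> 0" "q3 \<noteq> 0"
    and b1: "b1 = (p * a2\<^sup>2 + m * a3\<^sup>2) / a1" "b1 \<noteq> 0"
  defines "g \<equiv> generators a1 a2 a3 (p / m) q2 q3"
    and "h \<equiv> generators b1 a3 a2 (m / p) (q3 * p\<^sup>2) (q2 / m\<^sup>2)"
  shows "g X1 = (h X2 * h L3 - h X1) / (p * q3)" "g X2 = h X3" "g X3 = h X2"
    "g L1 = h L2 * h L3 - h L1 * m / p" "g L2 = h L3 / m" "g L3 = p * h L2"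
    "g Y1 = (h Y2 * h L3 - q3 * p * m * h Y1) / m" "g Y2 = h Y3" "g Y3 = h Y2"
proof -
  \<comment> \<open>The quotients of frozen monomials get names and polynomial equations, so that
    \<open>algebra\<close> meets no division.\<close>
  define r c1 c2 where "r = p / m" and "c1 = m / p" and "c2 = q2 / m\<^sup>2"
  have r: "m * r - p = 0" and c1: "p * c1 - m = 0" and c2: "m\<^sup>2 * c2 - q2 = 0"
    using nz by (simp_all add: r_def c1_def c2_def)
  define \<alpha> where "\<alpha> = r * q2 * q3 - 1"
  note g = generators_simps[of a1 a2 a3 r q2 q3, folded g_def[folded r_def] \<alpha>_def]
  have \<alpha>: "m * \<alpha> = p * q2 * q3 - m" unfolding \<alpha>_def using r by algebra
  \<comment> \<open>The product of the three column monomials is the same for both seeds, hence so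
    is \<alpha>.\<close>
  have "(p * m\<^sup>2) * (c1 * (q3 * p\<^sup>2) * c2 - 1 - \<alpha>) = 0"
    using \<alpha> c1 c2 by algebra
  then have \<alpha>': "c1 * (q3 * p\<^sup>2) * c2 - 1 = \<alpha>" using nz by simp
  note h = generators_simps[of b1 a3 a2 c1 "q3
      * p\<^sup>2" c2, folded h_def[folded c1_def c2_def], unfolded \<alpha>']
  have e: "a1 * b1 = p * a2\<^sup>2 + m * a3\<^sup>2" unfolding b1(1) using nz(1) by simp
  have gl: "a2 * a3 * g L1 = a2\<^sup>2 + q2 * q3 * a3\<^sup>2 + q3 * a1\<^sup>2"
    "a3 * a1 * g L2 = a3\<^sup>2 + q3 * r * a1\<^sup>2 + r * a2\<^sup>2"
    "a1 * a2 * g L3 = a1\<^sup>2 + r * q2 * a2\<^sup>2 + q2 * a3\<^sup>2"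
    unfolding g(4-6) using nz(1-3) by simp_all
  have gy: "a1 * g Y1 = r * (g L1)\<^sup>2 + \<alpha>\<^sup>2" "a2 * g Y2 = q2 * (g L2)\<^sup>2
      + \<alpha>\<^sup>2"
    "a3 * g Y3 = q3 * (g L3)\<^sup>2 + \<alpha>\<^sup>2"
    unfolding g(7-9) using nz(1-3) by simp_all
  have l: "a3 * a2 * h L1 = a3\<^sup>2 + q3 * p\<^sup>2 * c2 * a2\<^sup>2 + c2 * b1\<^sup>2"
    "a2 * b1 * h L2 = a2\<^sup>2 + c2 * c1 * b1\<^sup>2 + c1 * a3\<^sup>2"
    "b1 * a3 * h L3 = b1\<^sup>2 + c1 * (q3 * p\<^sup>2) * a3\<^sup>2 + q3 * p\<^sup>2 * a2\<^sup>2"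
    unfolding h(4-6) using nz(1-3) b1(2) by simp_all
  have y: "b1 * h Y1 = c1 * (h L1)\<^sup>2 + \<alpha>\<^sup>2" "a3 * h Y2
      = q3 * p\<^sup>2 * (h L2)\<^sup>2 + \<alpha>\<^sup>2"
    "a2 * h Y3 = c2 * (h L3)\<^sup>2 + \<alpha>\<^sup>2"
    unfolding h(7-9) using nz(1-3) b1(2) by simp_all
  have gl2: "m * a3 * a1 * g L2 = m * a3\<^sup>2 + q3 * p * a1\<^sup>2 + p * a2\<^sup>2"
    and gl3: "m * a1 * a2 * g L3 = m * a1\<^sup>2 + p * q2 * a2\<^sup>2 + m * q2 * a3\<^sup>2"
    and gy1: "m * a1 * g Y1 = p * (g L1)\<^sup>2 + m * \<alpha>\<^sup>2"
    using gl(2,3) gy(1) r by algebra+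
  have hl: "m\<^sup>2 * a3 * a2 * h L1 = m\<^sup>2 * a3\<^sup>2 + q3 * p\<^sup>2 * q2 * a2\<^sup>2
      + q2 * b1\<^sup>2"
    using l(1) c2 by algebra
  have hl2: "p * m * a2 * b1 * h L2 = p * m * a2\<^sup>2 + q2 * b1\<^sup>2 + m\<^sup>2 * a3\<^sup>2"
    using l(2) c1 c2 by algebra
  have hl3: "b1 * a3 * h L3 = b1\<^sup>2 + m * p * q3 * a3\<^sup>2 + q3 * p\<^sup>2 * a2\<^sup>2"
    using l(3) c1 by algebra
  note rel = relations_aux[OF b1(2) nz(3,2) \<alpha>'[symmetric] l y]
  \<comment> \<open>\<open>relations_aux\<close> is applied a second time, to the rotated order a3,
    a2, b1, in order to get the product a3 * h Y1.\<close>
  have \<alpha>'': "\<alpha> = q3 * p\<^sup>2 * c2 * c1 - 1"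
    unfolding \<alpha>'[symmetric] by (simp only: mult_ac)
  note rel' = relations_aux[OF nz(3,2) b1(2) \<alpha>'' l(2,3,1) y(2,3,1)]
  show X2: "g X2 = h X3" "g X3 = h X2" by (simp_all only: g h)
  have "(m * a3 * a1 * b1) * (g L2 * m) = (m * a3 * a1 * b1) * h L3"
    using gl2 hl3 e by algebra
  then have L2: "g L2 * m = h L3" using nz b1(2) by simp
  then show "g L2 = h L3 / m" by (simp only: nonzero_eq_divide_eq[OF nz(5)])
  have "(m * a1 * a2 * b1) * g L3 = (m * a1 * a2 * b1) * (p * h L2)"
    using gl3 hl2 e by algebra
  then show L3: "g L3 = p * h L2" using nz b1(2) by simp
  have "(m * a1\<^sup>2 * a2 * a3) * (p * g L1) = (m * a1\<^sup>2 * a2 * a3) * (m * (g L2 * g L3 - h L1))"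
    using gl(1) gl2 gl3 hl e by algebra
  then have "p * g L1 = m * (g L2 * g L3 - h L1)"
    by (rule mult_left_cancel[THEN iffD1, rotated]) (use nz in simp)
  then have L1: "p * g L1 = p * h L2 * h L3 - h L1 * m" using L2 L3 by algebra
  have "p * (g L1 - (h L2 * h L3 - h L1 * c1)) = 0"
    using L1 c1 by algebra
  then have "g L1 = h L2 * h L3 - h L1 * c1" using nz(4) by simp
  then show "g L1 = h L2 * h L3 - h L1 * m / p" by (simp only: c1_def times_divide_eq_right)
  have "a2 * g Y2 = a2 * h Y3"
    unfolding gy y L2[symmetric] using c2 by algebra
  then show "g Y2 = h Y3" using nz(2) by simp
  have "a3 * g Y3 = a3 * h Y2"
    unfolding gy y L3 by algebra
  then show "g Y3 = h Y2" using nz(3) by simp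
  have "b1 * (p * q3 * a1) = b1 * (a3 * h L3 - b1)"
    using hl3 e by algebra
  then have X1: "p * q3 * a1 = a3 * h L3 - b1" using b1(2) by simp
  have pq: "p * q3 \<noteq> 0" using nz by simp
  show "g X1 = (h X2 * h L3 - h X1) / (p * q3)"
    unfolding g h(1,2) nonzero_eq_divide_eq[OF pq] using X1 by (simp only: mult_ac)
  have E12: "b1 * h Y2 = q3 * p * m * (h L1 * h L2) - \<alpha> * h L3"
    using rel(4) c1 by algebra
  have "q3 * p * m * c2 * m = (\<alpha> + 1) * m"
    using \<alpha> c2 by algebra
  then have "q3 * p * m * c2 = \<alpha> + 1" using nz(5) by simp
  then have E21: "q3 * p * m * (a3 * h Y1) = q3 * p * m * (h L1 * h L2) + (\<alpha> + 1) * \<alpha> * h L3"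
    using rel'(5) by algebra
  have E11: "p * (b1 * h Y1) = m * (h L1)\<^sup>2 + p * \<alpha>\<^sup>2"
    using y(1) c1 by algebra
  \<comment> \<open>In terms of the new seed p * q3 * a1 is a3 * h L3 - b1, so after this
    multiplication h Y1 and h Y2 appear only in products with a3 or b1, which the relations express
    through the h L's.\<close>
  have "(p * q3 * a1) * (m * g Y1) = q3 * (p * m * a1 * g Y1)"
    by (simp only: mult_ac)
  also have "\<dots> = q3 * ((p * g L1)\<^sup>2 + p * m * \<alpha>\<^sup>2)"
    using gy1 by algebra
  also have "\<dots> = (a3 * h L3 - b1) * (h Y2 * h L3 - q3 * p * m * h Y1)"
    unfolding L1 using E11 E12 E21 y(2) by algebra
  also have "\<dots> = (p * q3 * a1) * (h Y2 * h L3 - q3 * p * m * h Y1)"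
    unfolding X1 ..
  finally have "m * g Y1 = h Y2 * h L3 - q3 * p * m * h Y1"
    by (rule mult_left_cancel[THEN iffD1, rotated]) (use nz in simp)
  then show "g Y1 = (h Y2 * h L3 - q3 * p * m * h Y1) / m"
    by (simp only: nonzero_eq_divide_eq[OF nz(5)] mult.commute)
qed

section \<open>Free generation and nonvanishing in the field\<close>

lemma mp_hom_of_rat: "mp_hom of_rat (mon (x :: 'v \<Rightarrow> 'a::field_char_0))"
  by unfold_locales (simp_all add: of_rat_add of_rat_mult mon_add)

lemma mon_sum_single:
  "finite A \<Longrightarrow> mon x (\<Sum>v\<in>A. Poly_Mapping.single (i v) (n v))
      = (\<Prod>v\<in>A. x (i v) ^ n v)"
  by (induction A rule: finite_induct) (simp_all add: mon_add)

text \<open>Multiplying by the N-th power of all variables turns a Laurent relation into a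
  polynomial one. The exponent map \<open>conv\<close> is injective on the monomials of P, so no two
  terms merge.\<close>

lemma free_laurent_independent:
  fixes x :: "nat \<Rightarrow> 'a::field_char_0" and idx :: "'v::finite \<Rightarrow> nat"
  assumes free: "freely_generates n x" and idx: "inj idx" "\<And>v. idx v \<in> {1..n}"
  shows "laurent_independent (\<lambda>v. x (idx v))"
proof -
  interpret mp_hom of_rat "mon x" by (rule mp_hom_of_rat)
  have free0: "p = 0" if "\<And>e. e \<in> Poly_Mapping.keys p
      \<Longrightarrow> Poly_Mapping.keys e \<subseteq> {1..n}"
      "mp_eval of_rat (mon x) p = 0" for p :: "(nat \<Rightarrow>\<^sub>0 nat) \<Rightarrow>\<^sub>0 rat"
    using free that unfolding freely_generates_def poly_eval_eq by blast
  have nz: "x (idx v) \<noteq> 0" for v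
  proof
    assume x0: "x (idx v) = 0"
    have "Poly_Mapping.single (Poly_Mapping.single (idx v) (1 :: nat)) (1 :: rat) = 0"
    proof (rule free0)
      fix e assume "e \<in> Poly_Mapping.keys (Poly_Mapping.single (Poly_Mapping.single (idx v) (1 :: nat)) (1 :: rat))"
      then have "e = Poly_Mapping.single (idx v) 1" by simp
      then show "Poly_Mapping.keys e \<subseteq> {1..n}" using idx(2)[of v] by simp
    qed (simp add: eval_single x0)
    then have "Poly_Mapping.lookup (Poly_Mapping.single (Poly_Mapping.single (idx v) (1 :: nat)) (1 :: rat))
        (Poly_Mapping.single (idx v) 1) = 0" by simp
    then show False by simp
  qed
  have "P = 0" if P: "laurent_eval (\<lambda>v. x (idx v)) P = 0" for P
  proof (rule poly_mapping_eqI)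
    fix e0
    define N where "N = (\<Sum>e\<in>Poly_Mapping.keys P. \<Sum>v\<in>UNIV. \<bar>Poly_Mapping.lookup e v\<bar>)"
    have N: "0 \<le> Poly_Mapping.lookup e v + N" if "e \<in> Poly_Mapping.keys P" for e v
    proof -
      have "\<bar>Poly_Mapping.lookup e v\<bar> \<le> (\<Sum>v\<in>UNIV. \<bar>Poly_Mapping.lookup e v\<bar>)"
        by (rule member_le_sum) auto
      also have "\<dots> \<le> N"
        unfolding N_def using that by (intro member_le_sum sum_nonneg) auto
      finally show ?thesis by simp
    qed
    define conv where "conv e
        = (\<Sum>v\<in>UNIV. Poly_Mapping.single (idx v) (nat (Poly_Mapping.lookup e v + N)))"
      for e :: "'v \<Rightarrow>\<^sub>0 int"
    have lookup_conv: "Poly_Mapping.lookup (conv e) (idx v) = nat (Poly_Mapping.lookup e v + N)" for e v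
      unfolding conv_def lookup_sum lookup_single
      by (simp add: inj_eq[OF idx(1)] when_def sum.delta)
    have keys_conv: "Poly_Mapping.keys (conv e) \<subseteq> {1..n}" for e
    proof -
      have "Poly_Mapping.keys (conv e)
          \<subseteq> (\<Union>v. Poly_Mapping.keys (Poly_Mapping.single (idx v) (nat (Poly_Mapping.lookup e v + N))))"
        unfolding conv_def by (rule keys_sum)
      also have "\<dots> \<subseteq> {1..n}" using idx(2) by (auto split: if_splits)
      finally show ?thesis .
    qed
    have inj_conv: "e = e'" if "conv e = conv e'" "e \<in> Poly_Mapping.keys P"
        "e' \<in> Poly_Mapping.keys P" for e e'
    proof (rule poly_mapping_eqI)
      fix v
      have "nat (Poly_Mapping.lookup e v + N) = nat (Poly_Mapping.lookup e' v + N)"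
        using lookup_conv that(1) by metis
      then show "Poly_Mapping.lookup e v = Poly_Mapping.lookup e' v"
        using N[OF that(2), of v] N[OF that(3), of v] by simp
    qed
    define p where "p = (\<Sum>e\<in>Poly_Mapping.keys P. Poly_Mapping.single (conv e) (of_int (Poly_Mapping.lookup P e) :: rat))"
    have "p = 0"
    proof (rule free0)
      fix e assume "e \<in> Poly_Mapping.keys p"
      then obtain d where "e \<in> Poly_Mapping.keys (Poly_Mapping.single (conv d) (of_int (Poly_Mapping.lookup P d) :: rat))"
        unfolding p_def by (rule subsetD[OF keys_sum, THEN UN_E])
      then have "e = conv d" by (simp split: if_splits)
      then show "Poly_Mapping.keys e \<subseteq> {1..n}" using keys_conv[of d] by simp
    next
      have m: "mon x (conv e) = lmon (\<lambda>v. x (idx v)) e * (\<Prod>v\<in>UNIV. x (idx v) powi N)"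
        if "e \<in> Poly_Mapping.keys P" for e
      proof -
        have "x (idx v) ^ nat (Poly_Mapping.lookup e v + N)
            = x (idx v) powi Poly_Mapping.lookup e v * x (idx v) powi N"
          for v
          using N[OF that, of v] power_int_add[of "x (idx v)" "Poly_Mapping.lookup e v" N] nz[of v]
          by (simp add: power_int_def)
        then show ?thesis
          unfolding conv_def mon_sum_single[OF finite_UNIV] lmon_superset[OF finite_UNIV subset_UNIV, of _ e]
          by (simp only: prod.distrib)
      qed
      have "mp_eval of_rat (mon x) p
          = (\<Sum>e\<in>Poly_Mapping.keys P. of_int (Poly_Mapping.lookup P e) * mon x (conv e))"
        unfolding p_def eval_sum eval_single by simp
      also have "\<dots> = laurent_eval (\<lambda>v. x (idx v)) P * (\<Prod>v\<in>UNIV. x (idx v) powi N)"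
        unfolding laurent_eval_eq mp_eval_def sum_distrib_right
        by (rule sum.cong[OF refl]) (simp only: m mult.assoc)
      finally show "mp_eval of_rat (mon x) p = 0" unfolding P by simp
    qed
    then have "0 = Poly_Mapping.lookup p (conv e0)" by simp
    also have "\<dots> = (\<Sum>e\<in>Poly_Mapping.keys P. of_int (Poly_Mapping.lookup P e) when conv e = conv e0)"
      unfolding p_def lookup_sum lookup_single ..
    finally have s: "(\<Sum>e\<in>Poly_Mapping.keys P. of_int (Poly_Mapping.lookup P e) when conv e
        = conv e0) = (0 :: rat)"
      by simp
    have "Poly_Mapping.lookup P e0 = 0" if "e0 \<in> Poly_Mapping.keys P"
    proof -
      have "(\<Sum>e\<in>Poly_Mapping.keys P. of_int (Poly_Mapping.lookup P e) when conv e = conv e0)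
        = (\<Sum>e\<in>Poly_Mapping.keys P. if e
            = e0 then of_int (Poly_Mapping.lookup P e) else (0 :: rat))"
        by (rule sum.cong[OF refl]) (use inj_conv[OF _ _ that] in \<open>auto simp: when_def\<close>)
      then show ?thesis using s that by (simp add: sum.delta)
    qed
    then show "Poly_Mapping.lookup P e0 = Poly_Mapping.lookup 0 e0"
      by (auto simp: in_keys_iff)
  qed
  then show ?thesis using nz by (simp add: laurent_independent_def)
qed

text \<open>A nonvanishing certificate that survives sums, products and inverses: a quotient of
  Laurent polynomials both positive at (1, ..., 1). Mutation formulas contain no subtraction, so all
  cluster variables have it.\<close>

definition positive :: "('v \<Rightarrow> 'a::field) \<Rightarrow> 'a \<Rightarrow> bool" where
  "positive z a \<longleftrightarrow> (\<exists>r s h k. rep z r h \<and> rep z s k \<and> a * s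
      = r \<and> 0 < h (\<lambda>_. 1) \<and> 0 < k (\<lambda>_. 1))"

lemma positiveI:
  "rep z r h \<Longrightarrow> rep z s k \<Longrightarrow> a * s
      = r \<Longrightarrow> 0 < h (\<lambda>_. 1)
      \<Longrightarrow> 0 < k (\<lambda>_. 1) \<Longrightarrow> positive z a"
  unfolding positive_def by (rule exI[of _ r], rule exI[of _ s], rule exI[of _ h], rule exI[of _ k]) simp

context
  fixes z :: "'v \<Rightarrow> 'a::field"
  assumes ind: "laurent_independent z"
begin

lemma ind_nonzero: "\<forall>v. z v \<noteq> 0"
  using ind by (simp add: laurent_independent_def)

lemma rep_positive_nonzero: "rep z r h \<Longrightarrow> 0 < h (\<lambda>_. 1)
    \<Longrightarrow> r \<noteq> 0"
  using rep_zeroD[OF ind, of h "\<lambda>_. 1"] by auto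

lemma positive_nonzero: "positive z a \<Longrightarrow> a \<noteq> 0"
  unfolding positive_def using rep_positive_nonzero by (metis mult_zero_left)

lemma positive_var: "positive z (z v)"
  unfolding positive_def
  using rep_var[OF ind_nonzero, where i = v] rep_numeral(2)[OF ind_nonzero]
  by (intro exI[of _ "z v"] exI[of _ 1] exI[of _ "\<lambda>u. u v"] exI[of _ "\<lambda>_. 1"]) simp

lemma positive_add:
  assumes "positive z a" "positive z b"
  shows "positive z (a + b)"
proof -
  obtain r s h k where a: "rep z r h" "rep z s k" "a * s = r" "0 < h (\<lambda>_. 1)"
      "0 < k (\<lambda>_. 1)"
    using assms(1) unfolding positive_def by auto
  obtain r' s' h' k' where b: "rep z r' h'" "rep z s' k'" "b * s'
      = r'" "0 < h' (\<lambda>_. 1)" "0 < k' (\<lambda>_. 1)"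
    using assms(2) unfolding positive_def by auto
  show ?thesis
  proof (rule positiveI)
    show "rep z (r * s' + r' * s) (\<lambda>v. h v * k' v + h' v * k v)"
        "rep z (s * s') (\<lambda>v. k v * k' v)"
      by (intro rep_add[OF ind_nonzero] rep_mult[OF ind_nonzero] a b)+
    show "(a + b) * (s * s') = r * s' + r' * s"
      unfolding a(3)[symmetric] b(3)[symmetric] by (simp only: distrib_right distrib_left mult_ac)
  qed (intro add_pos_pos mult_pos_pos a b)+
qed

lemma positive_mult:
  assumes "positive z a" "positive z b"
  shows "positive z (a * b)"
proof -
  obtain r s h k where a: "rep z r h" "rep z s k" "a * s = r" "0 < h (\<lambda>_. 1)"
      "0 < k (\<lambda>_. 1)"
    using assms(1) unfolding positive_def by auto
  obtain r' s' h' k' where b: "rep z r' h'" "rep z s' k'" "b * s'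
      = r'" "0 < h' (\<lambda>_. 1)" "0 < k' (\<lambda>_. 1)"
    using assms(2) unfolding positive_def by auto
  show ?thesis
  proof (rule positiveI)
    show "rep z (r * r') (\<lambda>v. h v * h' v)" "rep z (s * s') (\<lambda>v. k v * k' v)"
      by (intro rep_mult[OF ind_nonzero] a b)+
    show "(a * b) * (s * s') = r * r'"
      unfolding a(3)[symmetric] b(3)[symmetric] by (simp only: mult_ac)
  qed (intro mult_pos_pos a b)+
qed

lemma positive_inverse:
  assumes "positive z a"
  shows "positive z (inverse a)"
proof -
  obtain r s h k where a: "rep z r h" "rep z s k" "a * s = r" "0 < h (\<lambda>_. 1)"
      "0 < k (\<lambda>_. 1)"
    using assms(1) unfolding positive_def by auto
  have "inverse a * r = s" using a(3) positive_nonzero[OF assms] by auto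
  then show ?thesis by (rule positiveI[OF a(2,1) _ a(5,4)])
qed

lemma positive_one: "positive z 1"
  by (rule positiveI[OF rep_numeral(2)[OF ind_nonzero] rep_numeral(2)[OF ind_nonzero]]) simp_all

lemma positive_power: "positive z a \<Longrightarrow> positive z (a ^ n)"
  by (induction n) (simp_all add: positive_one positive_mult)

lemma positive_prod: "(\<And>i. i \<in> A \<Longrightarrow> positive z (h i))
    \<Longrightarrow> positive z (\<Prod>i\<in>A. h i)"
  by (induction A rule: infinite_finite_induct) (simp_all add: positive_one positive_mult)

end

subsection \<open>Mutation\<close>

lemma prod_positive_part:
  fixes z :: "'b \<Rightarrow> 'a::comm_monoid_mult" and b :: "'b \<Rightarrow> int"
  assumes "finite A"
  shows "(\<Prod>j | j \<in> A \<and> b j > 0. z j ^ nat (b j)) = (\<Prod>j\<in>A. z j ^ nat (b j))"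
proof (rule prod.mono_neutral_left)
  show "\<forall>i\<in>A - {j \<in> A. b j > 0}. z i ^ nat (b i) = 1"
  proof
    fix i assume "i \<in> A - {j \<in> A. b j > 0}"
    then have "nat (b i) = 0" by auto
    then show "z i ^ nat (b i) = 1" by (simp only: power_0)
  qed
qed (use assms in auto)

lemma mutate_simps:
  "fst (mutate n k (z, B)) i = (if i = k
      then ((\<Prod>j\<in>{1..n}. z j ^ nat (B j k)) + (\<Prod>j\<in>{1..n}. z j ^ nat (- B j k)))
          * inverse (z k)
      else z i)"
  "snd (mutate n k (z, B)) i j = (if i = k \<or> j = k then - B i j
      else B i j + (\<bar>B i k\<bar> * B k j + B i k * \<bar>B k j\<bar>) div 2)"
  using prod_positive_part[of "{1..n}" z "\<lambda>j. B j k"] prod_positive_part[of "{1..n}" z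
      "\<lambda>j. - B j k"]
  by (simp_all add: mutate_def)

definition seed_eq :: "'a seed \<Rightarrow> 'a seed \<Rightarrow> bool" where
  "seed_eq s t \<longleftrightarrow> (\<forall>i\<in>{1..6}. fst s i
      = fst t i) \<and> (\<forall>i\<in>{1..6}. \<forall>j\<in>{1..3}. snd s i j = snd t i j)"

text \<open>The hypotheses speak of the mutated seed because in a backward step only that one is
  known to be good. A zero variable at k would mutate to zero, as \<open>inverse 0 = 0\<close>, so
  the old variable is nonzero too.\<close>

lemma mutate_mutate:
  fixes t :: "'a::field_char_0 seed"
  assumes "fst (mutate 6 k t) k \<noteq> 0" "snd (mutate 6 k t) k k = 0" "k \<in> {1..3}"
  shows "seed_eq (mutate 6 k (mutate 6 k t)) t"
proof -
  obtain z B where t: "t = (z, B)" by (cases t)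
  define z' B' where "z' = fst (mutate 6 k t)" and "B' = snd (mutate 6 k t)"
  have m: "mutate 6 k t = (z', B')" by (simp add: z'_def B'_def)
  let ?P = "\<Prod>j\<in>{1..6}. z j ^ nat (B j k)" and ?N = "\<Prod>j\<in>{1..6}. z j ^ nat (- B j k)"
  have Bkk: "B k k = 0" using assms(2) by (simp add: t mutate_simps)
  have B'col: "B' j k = - B j k" for j by (simp add: B'_def t mutate_simps)
  have z'k: "z' k = (?P + ?N) * inverse (z k)" and z'j: "j \<noteq> k \<Longrightarrow> z' j = z j" for j
    by (simp_all add: z'_def t mutate_simps)
  have nz: "?P + ?N \<noteq> 0" "z k \<noteq> 0"
    using assms(1) unfolding z'_def[symmetric] z'k by auto
  have P': "(\<Prod>j\<in>{1..6}. z' j ^ nat (B' j k)) = ?N"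
      "(\<Prod>j\<in>{1..6}. z' j ^ nat (- B' j k)) = ?P"
    by (rule prod.cong[OF refl]; metis B'col Bkk z'j minus_zero nat_0 power_0 minus_minus)+
  have "fst (mutate 6 k (z', B')) i = z i" for i
  proof (cases "i = k")
    case True
    have "(?N + ?P) * inverse ((?P + ?N) * inverse (z k)) = z k"
      using nz by (simp add: add.commute)
    then show ?thesis unfolding mutate_simps P' z'k using True by simp
  qed (simp add: mutate_simps z'j)
  moreover have "snd (mutate 6 k (z', B')) i j = B i j" for i j
  proof -
    let ?X = "\<bar>B i k\<bar> * B k j + B i k * \<bar>B k j\<bar>"
    \<comment> \<open>For opposite signs the two products cancel and for equal signs they agree.
      Exactness matters: \<open>div\<close> rounds down, so halving commutes with negation only for
      even numbers.\<close>
    have "even ?X" by (cases "B i k \<ge> 0"; cases "B k j \<ge> 0") simp_all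
    then obtain Y where Y: "?X = 2 * Y" by (elim evenE)
    have "?X div 2 + (- ?X) div 2 = 0" unfolding Y minus_mult_right by simp
    moreover have "\<bar>- B i k\<bar> * - B k j + - B i k * \<bar>- B k j\<bar> = - ?X" by simp
    ultimately show ?thesis
      unfolding mutate_simps(2) B'_def t
          by (simp only: mutate_simps(2) simp_thms if_True if_False split: if_split) simp
  qed
  ultimately show ?thesis unfolding seed_eq_def m by (simp add: t)
qed

text \<open>Mutation changes a frozen entry in a neighbouring column by twice a positive or negative
  part, so the column monomial changes by a square.\<close>

lemma powi_double_add:
  fixes a :: "'a::field"
  assumes "a \<noteq> 0"
  shows "a powi (b + 2 * int n) = a powi b * (a ^ n)\<^sup>2"
proof -
  have "a powi (2 * int n) = (a ^ n)\<^sup>2"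
    using power_int_of_nat[of a "n * 2"] by (simp add: power_mult mult.commute)
  then show ?thesis using assms by (simp add: power_int_add)
qed

lemma powi_double_diff:
  fixes a :: "'a::field"
  assumes "a \<noteq> 0"
  shows "a powi (b - 2 * int n) = a powi b / (a ^ n)\<^sup>2"
  using powi_double_add[OF assms, of "b - 2 * int n" n] assms by (simp add: eq_divide_eq)

section \<open>The invariant of the mutation class\<close>

definition frozen_monomial ::
    "(nat \<Rightarrow> 'a::field) \<Rightarrow> (nat \<Rightarrow> int) \<Rightarrow> 'a" where
  "frozen_monomial z b = (\<Prod>r\<in>{4..6}. z r powi b r)"

locale markov_seed = markov_cluster x1 x2 x3 f1 f2 f3
  for x1 x2 x3 f1 f2 f3 :: "'a::field_char_0"
begin

definition frozen_gens :: "'a set" where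
  "frozen_gens = {f1, f2, f3} \<union> inverse ` {f1, f2, f3}"

text \<open>In the nine generators the column monomials replace f1, f2, f3, whereas the adjoined
  units remain the original frozen variables.\<close>

definition gen_subring ::
    "(nat \<Rightarrow> 'a) \<Rightarrow> (nat \<Rightarrow> nat \<Rightarrow> int) \<Rightarrow> nat \<Rightarrow> nat \<Rightarrow> nat \<Rightarrow> 'a set" where
  "gen_subring z B i j k = is_subring hull (range (generators (z i) (z j) (z k)
    (frozen_monomial z (\<lambda>r. B r i)) (frozen_monomial z (\<lambda>r. B r j)) (frozen_monomial z (\<lambda>r. B r k)))
    \<union> frozen_gens)"

text \<open>The order i, j, k is a cyclic one in which the mutable part is the given Markov matrix;
  a change of sign is absorbed by swapping two indices. The last clause is the inclusion wanted, and
  positivity makes backward mutations possible.\<close>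

definition good :: "(nat \<Rightarrow> 'a) \<Rightarrow> (nat \<Rightarrow> nat \<Rightarrow> int) \<Rightarrow> nat \<Rightarrow> nat \<Rightarrow> nat \<Rightarrow> bool" where
  "good z B i j k \<longleftrightarrow> {i, j, k} = {1..3} \<and> i \<noteq> j \<and> i
      \<noteq> k \<and> j \<noteq> k \<and>
     B i i = 0 \<and> B j j = 0 \<and> B k k = 0 \<and>
     B i j = -2 \<and> B j i = 2 \<and> B j k = -2 \<and> B k j = 2 \<and> B k i = -2 \<and> B i k
         = 2 \<and>
     z ` {4..6} = {f1, f2, f3} \<and>
     positive (cluster_vars x1 x2 x3 f1 f2 f3) (z i) \<and>
     positive (cluster_vars x1 x2 x3 f1 f2 f3) (z j) \<and>
     positive (cluster_vars x1 x2 x3 f1 f2 f3) (z k) \<and>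
     range (generators x1 x2 x3 f1 f2 f3) \<subseteq> gen_subring z B i j k"

lemma good_rotate: "good z B i j k \<Longrightarrow> good z B j k i"
  unfolding good_def gen_subring_def range_generators_rotate by (auto simp only: insert_commute)

lemma good_cong:
  assumes "good (fst s) (snd s) i j k" "seed_eq s t"
  shows "good (fst t) (snd t) i j k"
proof -
  have ijk: "i \<in> {1..3}" "j \<in> {1..3}" "k \<in> {1..3}" using assms(1) unfolding good_def by blast+
  have f: "fst s n = fst t n" if "n \<in> {1..6}" for n using assms(2) that by (simp add: seed_eq_def)
  have z: "fst s i = fst t i" "fst s j = fst t j" "fst s k = fst t k"
    by (rule f; use ijk in simp)+
  have B: "snd s a b = snd t a b" if "a \<in> {1..6}" "b \<in> {i, j, k}" for a b
    using assms(2) that ijk by (auto simp: seed_eq_def)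
  have fz: "fst s ` {4..6} = fst t ` {4..6}" by (rule image_cong) (use f in auto)
  have m: "frozen_monomial (fst s) (\<lambda>r. snd s r b)
      = frozen_monomial (fst t) (\<lambda>r. snd t r b)"
    if "b \<in> {i, j, k}" for b
    unfolding frozen_monomial_def by (rule prod.cong) (use f B that in auto)
  have i6: "i \<in> {1..6}" "j \<in> {1..6}" "k \<in> {1..6}" using ijk by auto
  show ?thesis
    using assms(1) unfolding good_def gen_subring_def
    by (simp only: z fz m B i6 insertI1 insertI2 simp_thms)
qed

lemma frozen_var_facts:
  assumes "z ` {4..6} = {f1, f2, f3}" "r \<in> {4..6::nat}"
  shows "z r \<in> frozen_gens" "inverse (z r) \<in> frozen_gens"
    "positive (cluster_vars x1 x2 x3 f1 f2 f3) (z r)" "z r \<noteq> 0"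
proof -
  have r: "z r \<in> {f1, f2, f3}" using assms by blast
  then show "z r \<in> frozen_gens" "inverse (z r) \<in> frozen_gens" by (auto simp: frozen_gens_def)
  show "z r \<noteq> 0" using r nonzero by auto
  show "positive (cluster_vars x1 x2 x3 f1 f2 f3) (z r)"
    using r positive_var[OF ind, of "Inr F1"] positive_var[OF ind, of "Inr F2"]
      positive_var[OF ind, of "Inr F3"] by auto
qed

lemma good_mutate:
  assumes good: "good z B i j k"
  shows "good (fst (mutate 6 i (z, B))) (snd (mutate 6 i (z, B))) i k j"
proof -
  let ?c = "cluster_vars x1 x2 x3 f1 f2 f3"
  define z' B' where "z' = fst (mutate 6 i (z, B))" and "B' = snd (mutate 6 i (z, B))"
  note g = good[unfolded good_def]
  have ne: "i \<noteq> j" "i \<noteq> k" "j \<noteq> k" and ijk: "{i, j, k} = {1..3}" using g by blast+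
  have B: "B i i = 0" "B j j = 0" "B k k = 0" "B i j = -2" "B j i = 2" "B j k = -2" "B k j = 2"
    "B k i = -2" "B i k = 2" using g by blast+
  have fz: "z ` {4..6} = {f1, f2, f3}" using g by blast
  have pos: "positive ?c (z i)" "positive ?c (z j)" "positive ?c (z k)" using g by blast+
  note nz = positive_nonzero[OF ind pos(1)] positive_nonzero[OF ind pos(2)] positive_nonzero[OF ind pos(3)]
  note fr = frozen_var_facts[OF fz]
  have small: "i \<notin> {4..6}" "j \<notin> {4..6}" "k \<notin> {4..6}"
  proof -
    have "{i, j, k} \<inter> {4..6} = {}" unfolding ijk by auto
    then show "i \<notin> {4..6}" "j \<notin> {4..6}" "k \<notin> {4..6}" by blast+
  qed
  have split: "(\<Prod>n\<in>{1..6}. h n) = h i * (h j * (h k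
      * (\<Prod>n\<in>{4..6}. h n)))" for h :: "nat \<Rightarrow> 'a"
  proof -
    have "{1..6::nat} = {1..3} \<union> {4..6}" by auto
    then have "{1..6::nat} = insert i (insert j (insert k {4..6}))" unfolding ijk[symmetric] by auto
    then show ?thesis using small ne by simp
  qed
  define p m where "p = (\<Prod>r\<in>{4..6}. z r ^ nat (B r i))" and "m
      = (\<Prod>r\<in>{4..6}. z r ^ nat (- B r i))"
  define q where "q n = frozen_monomial z (\<lambda>r. B r n)" for n
  have pm: "positive ?c p" "positive ?c m"
    unfolding p_def m_def by (intro positive_prod[OF ind] positive_power[OF ind] fr; assumption)+
  have pmnz: "p \<noteq> 0" "m \<noteq> 0" using pm positive_nonzero[OF ind] by blast+
  have qi: "q i = p / m"
    unfolding q_def frozen_monomial_def p_def m_def by (rule frozen_power_eq_divide) (rule fr)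
  have qnz: "q n \<noteq> 0" for n
    unfolding q_def frozen_monomial_def using fr(4) by (simp add: prod_zero_iff)
  have z'i: "z' i = (p * (z j)\<^sup>2 + m * (z k)\<^sup>2) / z i"
    unfolding z'_def mutate_simps split p_def m_def by (simp add: B divide_inverse mult.commute)
  have z'n: "z' n = z n" if "n \<noteq> i" for n
    unfolding z'_def mutate_simps using that by simp
  have ri: "r \<noteq> i" if "r \<in> {4..6}" for r using small(1) that by metis
  have z'r: "z' r = z r" if "r \<in> {4..6}" for r by (rule z'n[OF ri[OF that]])
  have B'i: "B' r i = - B r i" for r unfolding B'_def mutate_simps by simp
  \<comment> \<open>As \<open>B i k = 2\<close>, the correction is \<bar>b\<bar> + b with b =
    \<open>B r i\<close>, twice the positive part; in column j the factor -2 gives minus twice the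
    negative part.\<close>
  have B'k: "B' r k = B r k + 2 * int (nat (B r i))" if "r \<in> {4..6}" for r
  proof -
    show ?thesis using ri[OF that] unfolding B'_def mutate_simps using ne(2) by (simp add: B)
  qed
  have B'j: "B' r j = B r j - 2 * int (nat (- B r i))" if "r \<in> {4..6}" for r
  proof -
    show ?thesis using ri[OF that] unfolding B'_def mutate_simps using ne(1) by (simp add: B)
  qed
  have q'i: "frozen_monomial z' (\<lambda>r. B' r i) = m / p"
  proof -
    have "frozen_monomial z' (\<lambda>r. B' r i) = (\<Prod>r\<in>{4..6}. z r powi (- B r i))"
      unfolding frozen_monomial_def by (rule prod.cong) (simp_all only: z'r B'i)
    also have "\<dots> = m / p"
      unfolding p_def m_def by (subst frozen_power_eq_divide) (simp_all add: fr)
    finally show ?thesis .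
  qed
  have q'k: "frozen_monomial z' (\<lambda>r. B' r k) = q k * p\<^sup>2"
  proof -
    have "z' r powi B' r k = z r powi B r k * (z r ^ nat (B r i))\<^sup>2" if "r \<in> {4..6}" for r
      unfolding z'r[OF that] B'k[OF that] using fr(4)[OF that]
      by (rule powi_double_add)
    then show ?thesis
      unfolding frozen_monomial_def q_def p_def by (simp add: prod.distrib prod_power_distrib)
  qed
  have q'j: "frozen_monomial z' (\<lambda>r. B' r j) = q j / m\<^sup>2"
  proof -
    have "z' r powi B' r j = z r powi B r j / (z r ^ nat (- B r i))\<^sup>2" if "r \<in> {4..6}" for r
      unfolding z'r[OF that] B'j[OF that] using fr(4)[OF that]
      by (rule powi_double_diff)
    then show ?thesis
      unfolding frozen_monomial_def q_def m_def by (simp add: prod_dividef prod_power_distrib)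
  qed
  have pos': "positive ?c (z' i)"
    unfolding z'i divide_inverse
    by (intro positive_mult[OF ind] positive_add[OF ind] positive_power[OF ind] positive_inverse[OF ind] pm pos)
  have sub: "gen_subring z B i j k \<subseteq> gen_subring z' B' i k j"
    unfolding gen_subring_def[of z B]
  proof (rule hull_minimal)
    let ?S = "gen_subring z' B' i k j"
    show S: "is_subring ?S" unfolding gen_subring_def by (rule subring_hull)
    define h where "h = generators (z' i) (z k) (z j) (m / p) (q k * p\<^sup>2) (q j / m\<^sup>2)"
    have h: "h s \<in> ?S" for s
      unfolding gen_subring_def q'i q'j q'k z'n[OF ne(1)[symmetric]] z'n[OF ne(2)[symmetric]] h_def
      by (rule hull_inc) blast
    have frS: "a \<in> ?S" if "a \<in> frozen_gens" for a
      unfolding gen_subring_def using that by (intro hull_inc) blast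
    have u: "z r \<in> ?S" "inverse (z r) \<in> ?S" if "r \<in> {4..6}" for r
      using frS fr[OF that] by blast+
    have pS: "p \<in> ?S" "m \<in> ?S" "inverse p \<in> ?S" "inverse m \<in> ?S"
      unfolding p_def m_def prod_inversef[symmetric] o_def power_inverse[symmetric]
      by (intro subring_prod[OF S] subring_closed[OF S] u; assumption)+
    have qS: "inverse (q k) \<in> ?S"
      unfolding q_def frozen_monomial_def prod_inversef[symmetric] o_def power_int_inverse[symmetric]
      by (intro subring_prod[OF S] subring_powi[OF S]) (simp_all add: u)
    have qkS: "q k \<in> ?S"
      unfolding q_def frozen_monomial_def
      by (intro subring_prod[OF S] subring_powi[OF S]) (simp_all add: u)
    have "generators (z i) (z j) (z k) (q i) (q j) (q k) s \<in> ?S" for s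
    proof -
      have b: "z' i \<noteq> 0" by (rule positive_nonzero[OF ind pos'])
      note gm = generators_mutate[OF nz pmnz qnz[of j] qnz[of k] z'i b, folded h_def qi]
      show ?thesis
        by (cases s; simp only: gm divide_inverse inverse_mult_distrib)
          (intro subring_closed[OF S] h pS qS qkS)+
    qed
    then show "range (generators (z i) (z j) (z k) (frozen_monomial z (\<lambda>r. B r i))
        (frozen_monomial z (\<lambda>r. B r j)) (frozen_monomial z (\<lambda>r. B r k)))
            \<union> frozen_gens \<subseteq> ?S"
      unfolding q_def using frS by blast
  qed
  show ?thesis
    unfolding good_def z'_def[symmetric] B'_def[symmetric]
  proof (intro conjI)
    show "{i, k, j} = {1..3}" using ijk by blast
    show "i \<noteq> k" "i \<noteq> j" "k \<noteq> j" using ne by simp_all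
    \<comment> \<open>For instance \<open>B' j k\<close> is -2 + 4 = 2: the Markov matrix changes
      sign, which is why k and j trade places.\<close>
    show "B' i i = 0" "B' k k = 0" "B' j j = 0" "B' i k = -2" "B' k i = 2" "B' k j = -2" "B' j k = 2"
      "B' j i = -2" "B' i j = 2"
      unfolding B'_def mutate_simps using ne by (simp_all add: B)
    show "z' ` {4..6} = {f1, f2, f3}"
      unfolding fz[symmetric] by (rule image_cong) (simp_all only: z'r)
    show "positive ?c (z' i)" by (fact pos')
    show "positive ?c (z' k)" "positive ?c (z' j)"
      using pos z'n ne by simp_all
    show "range (generators x1 x2 x3 f1 f2 f3) \<subseteq> gen_subring z' B' i k j"
      using g sub by blast
  qed
qed

end

context markov_seed
begin

lemma good_permute:
  assumes good: "good z B i j k" and \<sigma>: "\<sigma> permutes {1..6}" "\<sigma> ` {1..3} = {1..3}"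
  shows "good (\<lambda>n. z (\<sigma> n)) (\<lambda>n m. B (\<sigma> n) (\<sigma> m)) (inv \<sigma> i) (inv \<sigma> j) (inv \<sigma> k)"
proof -
  have inv: "\<sigma> (inv \<sigma> n) = n" for n using \<sigma>(1) by (rule permutes_inverses)
  have inj: "inj \<sigma>" using \<sigma>(1) by (rule permutes_inj)
  have "\<sigma> ` ({1..6} - {1..3}) = {1..6} - {1..3}"
    unfolding image_set_diff[OF inj] \<sigma>(2) permutes_image[OF \<sigma>(1)] ..
  moreover have "{1..6} - {1..3} = {4..6::nat}" by auto
  ultimately have im: "\<sigma> ` {4..6} = {4..6}" by simp
  have "bij_betw \<sigma> {4..6} {4..6}" 
    by (rule bij_betw_imageI[OF inj_on_subset[OF inj subset_UNIV]]) (use im in simp)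
  then have fm: "frozen_monomial (\<lambda>n. z (\<sigma> n)) (\<lambda>r. B (\<sigma> r) b)
      = frozen_monomial z (\<lambda>r. B r b)" for b
    unfolding frozen_monomial_def by (rule prod.reindex_bij_betw)
  have "inv \<sigma> ` {1..3} = inv \<sigma> ` \<sigma> ` {1..3}" unfolding \<sigma>(2) ..
  also have "\<dots> = {1..3}" unfolding image_image by (simp add: inv_f_f[OF inj])
  finally have inv3: "inv \<sigma> ` {1..3} = {1..3}" .
  note g = good[unfolded good_def]
  have ijk: "{inv \<sigma> i, inv \<sigma> j, inv \<sigma> k} = {1..3}"
  proof -
    have "{inv \<sigma> i, inv \<sigma> j, inv \<sigma> k} = inv \<sigma> ` {i, j, k}" by simp
    also have "\<dots> = {1..3}" using g inv3 by simp
    finally show ?thesis .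
  qed
  have ne: "inv \<sigma> i \<noteq> inv \<sigma> j" "inv \<sigma> i
      \<noteq> inv \<sigma> k" "inv \<sigma> j \<noteq> inv \<sigma> k"
    using g inv by metis+
  have fz: "(\<lambda>n. z (\<sigma> n)) ` {4..6} = z ` {4..6}"
    unfolding image_image[of z \<sigma>, symmetric] im ..
  show ?thesis
    unfolding good_def gen_subring_def inv fm fz
    using g[unfolded gen_subring_def] ijk ne by (simp only: simp_thms)
qed

definition good_seed :: "'a seed \<Rightarrow> bool" where
  "good_seed t \<longleftrightarrow> (\<exists>i j k. good (fst t) (snd t) i j k)"

lemma good_at:
  assumes "good_seed t" "k \<in> {1..3}"
  shows "\<exists>i j. good (fst t) (snd t) k i j"
proof -
  obtain a b c where g: "good (fst t) (snd t) a b c" using assms(1) by (auto simp: good_seed_def)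
  then have "k \<in> {a, b, c}" using assms(2) by (simp only: good_def)
  then show ?thesis using g good_rotate[OF g] good_rotate[OF good_rotate[OF g]] by auto
qed

lemma good_seed_mutate: "good_seed t \<Longrightarrow> k \<in> {1..3}
    \<Longrightarrow> good_seed (mutate 6 k t)"
  using good_at[of t k] good_mutate[of "fst t" "snd t"] unfolding good_seed_def by fastforce

lemma good_seed_permute:
  assumes "good_seed t" "\<sigma> permutes {1..6}" "\<sigma> ` {1..3} = {1..3}"
  shows "good_seed (permute_seed \<sigma> t)"
proof -
  obtain z B where t: "t = (z, B)" by (cases t)
  then obtain i j k where "good z B i j k" using assms(1) by (auto simp: good_seed_def)
  from good_permute[OF this assms(2,3)] show ?thesis
    unfolding good_seed_def t permute_seed_def by auto
qed

lemma good_seed_step: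
  assumes "good_seed s" "seed_step 6 3 s t \<or> seed_step 6 3 t s"
  shows "good_seed t"
proof -
  consider k where "k \<in> {1..3}" "t = mutate 6 k s" | k where "k \<in> {1..3}" "s = mutate 6 k t"
    | \<sigma> where "\<sigma> permutes {1..6}" "\<sigma> ` {1..3} = {1..3}" "t = permute_seed \<sigma> s"
    | \<sigma> where "\<sigma> permutes {1..6}" "\<sigma> ` {1..3} = {1..3}" "s = permute_seed \<sigma> t"
    using assms(2) unfolding seed_step_def by blast
  then show ?thesis
  proof cases
    case 1
    then show ?thesis using good_seed_mutate assms(1) by simp
  next
    case 2
    \<comment> \<open>Here s arises from t, which is not yet known to be good. Mutating s again
      gives a good seed, and it agrees with t in all relevant entries.\<close>
    obtain i j where g: "good (fst s) (snd s) k i j" using good_at[OF assms(1) 2(1)] by auto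
    then have "positive (cluster_vars x1 x2 x3 f1 f2 f3) (fst s k)" "snd s k k = 0"
      by (simp_all add: good_def)
    then have "seed_eq (mutate 6 k s) t"
      using mutate_mutate[of k t] 2 positive_nonzero[OF ind] by blast
    moreover obtain a b c where "good (fst (mutate 6 k s)) (snd (mutate 6 k s)) a b c"
      using good_seed_mutate[OF assms(1) 2(1)] by (auto simp: good_seed_def)
    ultimately show ?thesis using good_cong unfolding good_seed_def by blast
  next
    case 3
    then show ?thesis using good_seed_permute assms(1) by simp
  next
    case 4
    have "\<sigma> (inv \<sigma> n) = n" for n using 4(1) by (rule permutes_inverses)
    then have "t = permute_seed (inv \<sigma>) s"
      unfolding 4(3) permute_seed_def by (cases t) simp
    moreover have "inv \<sigma> ` {1..3} = {1..3}"
      using 4(2) permutes_inj[OF 4(1)] by (metis image_inv_f_f)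
    ultimately show ?thesis using good_seed_permute[OF assms(1) permutes_inv[OF 4(1)]] by simp
  qed
qed

lemma good_seed_mutation_equivalent:
  assumes "mutation_equivalent 6 3 s t" "good_seed s"
  shows "good_seed t"
  using assms(1) unfolding mutation_equivalent_def
  by (induction rule: equivclp_induct) (use assms(2) good_seed_step in blast)+

text \<open>The nine elements of a seed are visibly Laurent polynomials in its own cluster, and
  those of a good seed generate a ring containing the original ones.\<close>

lemma generators_in_laurent_ring:
  assumes "good_seed t"
  shows "range \<phi> \<subseteq> laurent_ring (fst t ` {1..6})"
proof -
  obtain i j k where g: "good (fst t) (snd t) i j k" using assms by (auto simp: good_seed_def)
  let ?S = "laurent_ring (fst t ` {1..6})"
  have S: "is_subring ?S" unfolding laurent_ring_def by (rule subring_hull)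
  have z: "fst t n \<in> ?S" "inverse (fst t n) \<in> ?S" if "n \<in> {1..6}" for n
    unfolding laurent_ring_def using that by (auto intro: hull_inc)
  have ijk: "{i, j, k} = {1..3}" using g unfolding good_def by blast
  have "i \<in> {1..6}" "j \<in> {1..6}" "k \<in> {1..6}"
  proof -
    have "{i, j, k} \<subseteq> {1..6}" unfolding ijk by auto
    then show "i \<in> {1..6}" "j \<in> {1..6}" "k \<in> {1..6}" by auto
  qed
  note zi = z[OF this(1)] z[OF this(2)] z[OF this(3)]
  have q: "frozen_monomial (fst t) b \<in> ?S" for b
    unfolding frozen_monomial_def
  proof (rule subring_prod[OF S])
    fix r assume "r \<in> {4..6::nat}"
    then have "r \<in> {1..6}" by simp
    from z[OF this] show "fst t r powi b r \<in> ?S" by (rule subring_powi[OF S])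
  qed
  have "{f1, f2, f3} = fst t ` {4..6}" using g unfolding good_def by blast
  then have fr: "frozen_gens \<subseteq> ?S"
    unfolding frozen_gens_def using z by auto
  have "gen_subring (fst t) (snd t) i j k \<subseteq> ?S"
    unfolding gen_subring_def
  proof (rule hull_minimal, rule Un_least)
    show "range (generators (fst t i) (fst t j) (fst t k) (frozen_monomial (fst t) (\<lambda>r. snd t r i))
        (frozen_monomial (fst t) (\<lambda>r. snd t r j)) (frozen_monomial (fst t) (\<lambda>r. snd t r k))) \<subseteq> ?S"
      by (intro image_subsetI generators_in_subring[OF S] zi q)
  qed (rule fr S)+
  moreover have "range (generators x1 x2 x3 f1 f2 f3) \<subseteq> gen_subring (fst t) (snd t) i j k"
    using g unfolding good_def by blast
  ultimately have "range (generators x1 x2 x3 f1 f2 f3) \<union> frozen_gens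
      \<subseteq> ?S" using fr by blast
  then show ?thesis
    unfolding range_phi Un_assoc frozen_gens_def[symmetric] by (rule hull_minimal) (rule S)
qed

end

section \<open>Clearing denominators and the theorem\<close>

lemma atLeastAtMost_1_6: "{1..6::nat} = {1, 2, 3, 4, 5, 6}"
  by auto

lemma laurent_ring_clear_denominators:
  fixes x1 x2 x3 f1 f2 f3 :: "'a::field"
  assumes S: "is_subring S" "x1 \<in> S" "x2 \<in> S" "x3 \<in> S" "f1 \<in> S" "f2 \<in> S" "f3 \<in> S"
    "inverse f1 \<in> S" "inverse f2 \<in> S" "inverse f3 \<in> S"
    and nz: "x1 \<noteq> 0" "x2 \<noteq> 0" "x3 \<noteq> 0"
    and u: "u \<in> laurent_ring {x1, x2, x3, f1, f2, f3}"
  shows "\<exists>N. (x1 * x2 * x3) ^ N * u \<in> S"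
proof -
  let ?m = "x1 * x2 * x3"
  let ?T = "{u. \<exists>N. ?m ^ N * u \<in> S}"
  note c = subring_closed[OF S(1)]
  have m: "?m ^ N \<in> S" for N by (intro c S)
  have base: "u \<in> ?T" if "u \<in> S" for u
    using that by (intro CollectI exI[of _ 0]) simp
  have one: "u \<in> ?T" if "?m * u \<in> S" for u
    using that by (intro CollectI exI[of _ 1]) simp
  have "is_subring ?T"
    unfolding is_subring_def
  proof (intro conjI ballI)
    show "1 \<in> ?T" by (rule base) (rule c)
    fix a b assume "a \<in> ?T" "b \<in> ?T"
    then obtain M N where a: "?m ^ M * a \<in> S" and b: "?m ^ N * b \<in> S" by auto
    have "?m ^ (M + N) * (a - b) = ?m ^ N * (?m ^ M * a) - ?m ^ M * (?m ^ N * b)"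
      by (simp only: power_add right_diff_distrib left_diff_distrib mult_ac)
    also have "\<dots> \<in> S" by (intro c(3,4) m a b)
    finally show "a - b \<in> ?T" by blast
    have "?m ^ (M + N) * (a * b) = (?m ^ M * a) * (?m ^ N * b)"
      by (simp only: power_add mult_ac)
    also have "\<dots> \<in> S" by (intro c(4) a b)
    finally show "a * b \<in> ?T" by blast
  qed
  moreover have "{x1, x2, x3, f1, f2, f3} \<union> inverse ` {x1, x2, x3, f1, f2, f3} \<subseteq> ?T"
  proof -
    have "?m * inverse x1 = x2 * x3" "?m * inverse x2 = x1 * x3" "?m * inverse x3 = x1 * x2"
      using nz by simp_all
    then have "inverse x1 \<in> ?T" "inverse x2 \<in> ?T" "inverse x3 \<in> ?T"
      using one S c(4) by metis+
    then show ?thesis using base S by blast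
  qed
  ultimately have "laurent_ring {x1, x2, x3, f1, f2, f3} \<subseteq> ?T"
    unfolding laurent_ring_def by (intro hull_minimal)
  then show ?thesis using u by blast
qed


definition cluster_index ::
    "nat \<Rightarrow> nat \<Rightarrow> nat \<Rightarrow> cluster_sym \<Rightarrow> nat" where
  "cluster_index i j k = cluster_vars i j k (i + 3) (j + 3) (k + 3)"

lemma free_cluster_independent:
  fixes x :: "nat \<Rightarrow> 'a::field_char_0"
  assumes "freely_generates 6 x" "{i, j, k} = {1..3}" "i \<noteq> j" "i \<noteq> k" "j \<noteq> k"
  shows "laurent_independent (cluster_vars (x i) (x j) (x k) (x (i + 3)) (x (j + 3)) (x (k + 3)))"
proof -
  have ijk: "i \<in> {1..3}" "j \<in> {1..3}" "k \<in> {1..3}" using assms(2) by blast+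
  have ind: "laurent_independent (\<lambda>v. x (cluster_index i j k v))"
  proof (rule free_laurent_independent[OF assms(1)])
    have "\<forall>v. cluster_index i j k v \<in> {1..6}"
      unfolding cluster_index_def all_cluster_sym cluster_vars_simps using ijk by simp
    then show "cluster_index i j k v \<in> {1..6}" for v by blast
    have "\<forall>v w. cluster_index i j k v = cluster_index i j k w \<longrightarrow> v = w"
      unfolding cluster_index_def all_cluster_sym cluster_vars_simps using ijk assms(3-5) by auto
    then show "inj (cluster_index i j k)" by (intro injI) blast
  qed
  have "\<forall>v. x (cluster_index i j k v) =
      cluster_vars (x i) (x j) (x k) (x (i + 3)) (x (j + 3)) (x (k + 3)) v"
    unfolding cluster_index_def all_cluster_sym cluster_vars_simps by simp
  then have eq: "(\<lambda>v. x (cluster_index i j k v)) =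
      cluster_vars (x i) (x j) (x k) (x (i + 3)) (x (j + 3)) (x (k + 3))"
    by (intro ext) (rule spec)
  show ?thesis by (rule ind[unfolded eq])
qed

theorem proposition7p1p1:
  fixes x1 x2 x3 f1 f2 f3 l1 l2 l3 y1 y2 y3 :: "'a::field_char_0"
    and s :: "'a seed" and \<phi> :: "gen_ring \<Rightarrow> 'a"
  assumes s: "s = (vector_of [x1, x2, x3, f1, f2, f3], exchange_matrix)"
    and seed: "is_seed 6 3 s"
    and l1: "l1 = (x2\<^sup>2 + f2 * f3 * x3\<^sup>2 + f3 * x1\<^sup>2) / (x2 * x3)"
    and l2: "l2 = (x3\<^sup>2 + f3 * f1 * x1\<^sup>2 + f1 * x2\<^sup>2) / (x3 * x1)"
    and l3: "l3 = (x1\<^sup>2 + f1 * f2 * x2\<^sup>2 + f2 * x3\<^sup>2) / (x1 * x2)"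
    and y1: "y1 = (f1 * l1\<^sup>2 + (f1 * f2 * f3 - 1)\<^sup>2) / x1"
    and y2: "y2 = (f2 * l2\<^sup>2 + (f1 * f2 * f3 - 1)\<^sup>2) / x2"
    and y3: "y3 = (f3 * l3\<^sup>2 + (f1 * f2 * f3 - 1)\<^sup>2) / x3"
    and \<phi>: "\<phi> = presentation_map (case_frozen_sym f1 f2 f3)
                 (case_gen_sym x1 x2 x3 l1 l2 l3 y1 y2 y3)"
  shows "range \<phi> = upper_cluster_algebra 6 3 s \<and>
         {p. \<phi> p = 0} = ideal_generated relations"
proof -
  define x where "x = vector_of [x1, x2, x3, f1, f2, f3]"
  have x: "x 1 = x1" "x 2 = x2" "x 3 = x3" "x 4 = f1" "x 5 = f2" "x 6 = f3"
    by (simp_all add: x_def vector_of_def)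
  note xs = x x[unfolded One_nat_def]
  have free: "freely_generates 6 x" using seed by (simp add: s is_seed_def x_def)
  have I3: "{1..3::nat} = {1, 2, 3}" by auto
  have ind: "laurent_independent (cluster_vars x1 x2 x3 f1 f2 f3)"
    "laurent_independent (cluster_vars x2 x3 x1 f2 f3 f1)"
    "laurent_independent (cluster_vars x3 x1 x2 f3 f1 f2)"
    using free_cluster_independent[OF free, of 1 2 3] free_cluster_independent[OF free, of 2 3 1]
      free_cluster_independent[OF free, of 3 1 2] unfolding I3 by (simp_all add: xs insert_commute)
  interpret c1: markov_seed x1 x2 x3 f1 f2 f3 by unfold_locales (rule ind)
  interpret c2: markov_cluster x2 x3 x1 f2 f3 f1 by unfold_locales (rule ind)
  interpret c3: markov_cluster x3 x1 x2 f3 f1 f2 by unfold_locales (rule ind)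
  have "case_gen_sym x1 x2 x3 l1 l2 l3 y1 y2 y3 = generators x1 x2 x3 f1 f2 f3"
    unfolding generators_def Let_def l1[symmetric] l2[symmetric] l3[symmetric]
      y1[symmetric] y2[symmetric] y3[symmetric] ..
  then have phi: "\<phi> = c1.\<phi>" unfolding \<phi> c1.\<phi>_def by simp
  have rot: "range c2.\<phi> = range \<phi>" "range c3.\<phi> = range \<phi>"
    unfolding phi c1.range_phi c2.range_phi c3.range_phi
      range_generators_rotate[of x2 x3 x1 f2 f3 f1] range_generators_rotate[of x3 x1 x2 f3 f1 f2]
    by (simp_all only: insert_commute)
  let ?U = "upper_cluster_algebra 6 3 s"
  let ?B = "exchange_matrix"
  have good: "c1.good_seed s"
  proof -
    have B: "?B 1 1 = 0" "?B 1 2 = -2" "?B 1 3 = 2" "?B 2 1 = 2" "?B 2 2 = 0" "?B 2 3 = -2"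
      "?B 3 1 = -2" "?B 3 2 = 2" "?B 3 3 = 0"
      by (simp_all add: exchange_matrix_def matrix_of_rows_def)
    have I6: "{4..6::nat} = {4, 5, 6}" by auto
    have fm: "frozen_monomial x (\<lambda>r. ?B r 1) = f1" "frozen_monomial x (\<lambda>r. ?B r 2) = f2"
      "frozen_monomial x (\<lambda>r. ?B r 3) = f3"
      unfolding frozen_monomial_def I6 by (simp_all add: exchange_matrix_def matrix_of_rows_def x)
    have "c1.good x ?B 1 2 3"
      unfolding c1.good_def c1.gen_subring_def fm x B I3 I6
    proof (intro conjI)
      show "range (generators x1 x2 x3 f1 f2 f3)
          \<subseteq> is_subring hull (range (generators x1 x2 x3 f1 f2 f3) \<union> c1.frozen_gens)"
        by (rule order_trans[OF Un_upper1 hull_subset])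
      show "positive (cluster_vars x1 x2 x3 f1 f2 f3) x1" "positive (cluster_vars x1 x2 x3 f1 f2 f3) x2"
        "positive (cluster_vars x1 x2 x3 f1 f2 f3) x3"
        using positive_var[OF ind(1), of "Inl F1"] positive_var[OF ind(1), of "Inl F2"]
          positive_var[OF ind(1), of "Inl F3"] by simp_all
    qed (simp_all add: x)
    then show ?thesis
      unfolding c1.good_seed_def s x_def[symmetric] fst_conv snd_conv by (intro exI)
  qed
  have "range \<phi> \<subseteq> ?U"
    unfolding phi upper_cluster_algebra_def clusters_def
    using c1.generators_in_laurent_ring c1.good_seed_mutation_equivalent[OF _ good] by blast
  moreover have "?U \<subseteq> range \<phi>"
  proof
    fix u assume u: "u \<in> ?U"
    have S: "is_subring (range \<phi>)" unfolding phi c1.range_phi by (rule subring_hull)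
    have US: "is_subring ?U"
      unfolding upper_cluster_algebra_def laurent_ring_def
      using subring_hull by (auto simp: is_subring_def)
    have cluster: "fst t ` {1..6} \<in> clusters 6 3 s" if "t = s \<or> (\<exists>k\<in>{1..3}. t
        = mutate 6 k s)" for t
    proof -
      have "mutation_equivalent 6 3 s t"
        using that unfolding mutation_equivalent_def seed_step_def
        by (auto intro: r_into_equivclp)
      then show ?thesis unfolding clusters_def by blast
    qed
    have Z0: "?U \<subseteq> laurent_ring {x1, x2, x3, f1, f2, f3}"
    proof -
      have "fst s ` {1..6} = {x1, x2, x3, f1, f2, f3}"
        unfolding s fst_conv x_def[symmetric] atLeastAtMost_1_6 by (simp add: xs)
      then show ?thesis using cluster[of s] unfolding upper_cluster_algebra_def by auto
    qed
    have Z: "?U \<subseteq> laurent_ring (fst (mutate 6 k s) ` {1..6})" if "k \<in> {1..3}" for k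
      using cluster[of "mutate 6 k s"] that unfolding upper_cluster_algebra_def by blast
    have B: "(\<Prod>j\<in>{1..6}. x j ^ nat (?B j 1)) = x2\<^sup>2 * f1"
        "(\<Prod>j\<in>{1..6}. x j ^ nat (- ?B j 1)) = x3\<^sup>2"
      "(\<Prod>j\<in>{1..6}. x j ^ nat (?B j 2)) = x3\<^sup>2 * f2"
          "(\<Prod>j\<in>{1..6}. x j ^ nat (- ?B j 2)) = x1\<^sup>2"
      "(\<Prod>j\<in>{1..6}. x j ^ nat (?B j 3)) = x1\<^sup>2 * f3"
          "(\<Prod>j\<in>{1..6}. x j ^ nat (- ?B j 3)) = x2\<^sup>2"
      unfolding atLeastAtMost_1_6 by (simp_all add: exchange_matrix_def matrix_of_rows_def xs)
    have image_seed: "h ` {1..6} = {h 1, h 2, h 3, h 4, h 5, h 6}" for h :: "nat \<Rightarrow> 'a"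
      unfolding atLeastAtMost_1_6 by (simp only: image_insert image_empty)
    have m: "fst (mutate 6 1 s) ` {1..6} = {c1.x1', x2, x3, f1, f2, f3}"
      "fst (mutate 6 2 s) ` {1..6} = {c2.x1', x3, x1, f2, f3, f1}"
      "fst (mutate 6 3 s) ` {1..6} = {c3.x1', x1, x2, f3, f1, f2}"
      unfolding s x_def[symmetric] c1.x1'_def c2.x1'_def c3.x1'_def image_seed mutate_simps B
      by (simp_all add: xs divide_inverse insert_commute mult.commute)
    \<comment> \<open>Each variable is divided out with the help of the cluster mutated at that
      variable, so only the initial seed and its three neighbours are used for this
      inclusion.\<close>
    have strip: "w \<in> range \<phi>" if "w \<in> ?U" "x1 * w \<in> range \<phi> \<or> x2
        * w \<in> range \<phi> \<or> x3 * w \<in> range \<phi>" for w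
    proof -
      have "w \<in> laurent_ring {c1.x1', x2, x3, f1, f2, f3}"
          "w \<in> laurent_ring {c2.x1', x3, x1, f2, f3, f1}"
        "w \<in> laurent_ring {c3.x1', x1, x2, f3, f1, f2}"
        using Z[of 1] Z[of 2] Z[of 3] that(1) unfolding m by auto
      then show ?thesis
        using that(2) c1.division_by_x1[of w] c2.division_by_x1[of w] c3.division_by_x1[of w]
        unfolding rot phi[symmetric] by blast
    qed
    have gens: "generators x1 x2 x3 f1 f2 f3 g \<in> range \<phi>" "{f1, f2, f3}
        \<union> inverse ` {f1, f2, f3} \<subseteq> range \<phi>" for g
      unfolding phi c1.range_phi by (auto intro: hull_inc)
    have xS: "x1 \<in> range \<phi>" "x2 \<in> range \<phi>" "x3 \<in> range \<phi>"
      using gens(1)[of X1] gens(1)[of X2] gens(1)[of X3] by (simp_all add: generators_simps)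
    have xU: "x1 \<in> ?U" "x2 \<in> ?U" "x3 \<in> ?U" using xS \<open>range \<phi>
        \<subseteq> ?U\<close> by blast+
    have "\<exists>N. (x1 * x2 * x3) ^ N * u \<in> range \<phi>"
    proof (rule laurent_ring_clear_denominators[OF S xS])
      show "u \<in> laurent_ring {x1, x2, x3, f1, f2, f3}" using Z0 u by blast
    qed (use gens(2) c1.nonzero in auto)
    then obtain N where "(x1 * x2 * x3) ^ N * u \<in> range \<phi>" by blast
    then show "u \<in> range \<phi>"
    proof (induction N)
      case (Suc N)
      note c = subring_closed(4,7)[OF US]
      let ?v = "(x1 * x2 * x3) ^ N * u"
      \<comment> \<open>The factors are stripped one at a time, and \<open>strip\<close> asks that
        what remains after each division lie in the upper cluster algebra.\<close>
      have v: "?v \<in> ?U" "x3 * ?v \<in> ?U" "x2 * (x3 * ?v) \<in> ?U" by (intro c xU u)+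
      have "x1 * (x2 * (x3 * ?v)) \<in> range \<phi>" using Suc.prems by (simp only: power_Suc mult.assoc)
      then have "x2 * (x3 * ?v) \<in> range \<phi>" using strip v by blast
      then have "x3 * ?v \<in> range \<phi>" using strip v by blast
      then have "?v \<in> range \<phi>" using strip v by blast
      then show ?case by (rule Suc.IH)
    qed simp
  qed
  ultimately show ?thesis using c1.kernel unfolding phi by blast
qed

end
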